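(* Let $\mathfrak{h}$ be a Lie subalgebra of a Lie algebra $\mathfrak{g}$ over a field $\mathbb{K}$. Assume that any of the following is true: (i) The algebra $\mathfrak{h}$ is perfect, i.e. $\mathfrak{h}=[\mathfrak{h},\mathfrak{h}]$. (ii) The algebra $\mathfrak{g}$ is finite-dimensional, $\mathbb{K}$ has characteristic zero and the radical $\mathfrak{r}_{\mathfrak{h}}$ of $\mathfrak{h}$ is contained in the center of $\mathfrak{g}$. (iii) $\mathbb{K}=\mathbb{R}$, $\mathfrak{g}$ is finite-dimensional, and there is a symmetric bilinear form $B$ on $\mathfrak{g}$ such that $B$ is non-degenerate on $\mathfrak{h}$, $B$ is positive definite on the $B$-orthogonal complement of $\mathfrak{h}$ in $\mathfrak{g}$, and every operator $\operatorname{ad}_X$, $X\in\mathfrak{h}$, is skew-symmetric with respect to $B$, i.e. $B(\operatorname{ad}_XY,Z)+B(Y,\operatorname{ad}_XZ)=0$ for all $X\in\mathfrak{h}$, $Y,Z\in\mathfrak{g}$. More specifically, (iv) The algebra $\mathfrak{g}$ is finite-dimensional and compact with $\mathbb{K}=\mathbb{R}$. (v) The algebra $\mathfrak{g}$ is finite-dimensional, $\mathbb{K}=\mathbb{R}$ and $\mathfrak{h}$ is compactly embedded in $\mathfrak{g}$. (vi) The algebra $\mathfrak{g}$ is finite-dimensional and semisimple, $\mathbb{K}=\mathbb{R}$ and $\mathfrak{h}$ contains an eigenspace of a Cartan involution of $\mathfrak{g}$. Then the normalizer $N_{\mathfrak{g}}(\mathfrak{h})$ is a self-normalizing subalgebra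 of $\mathfrak{g}$, i.e. $N_{\mathfrak{g}}(N_{\mathfrak{g}}(\mathfrak{h}))=N_{\mathfrak{g}}(\mathfrak{h})$.
   Context: The normalizer of a Lie subalgebra $\mathfrak{h}$ in $\mathfrak{g}$ is $N_{\mathfrak{g}}(\mathfrak{h})=\{X\in\mathfrak{g}:[X,Y]\in\mathfrak{h}\text{ for all }Y\in\mathfrak{h}\}$; $\mathfrak{h}$ is self-normalizing in $\mathfrak{g}$ if $\mathfrak{h}=N_{\mathfrak{g}}(\mathfrak{h})$. The radical of a finite-dimensional Lie algebra is its maximal solvable ideal. A real Lie algebra is compact if it is the Lie algebra of a compact Lie group. A Lie subalgebra $\mathfrak{h}$ of a real Lie algebra $\mathfrak{g}$ is compactly embedded in $\mathfrak{g}$ if there exists an inner product on $\mathfrak{g}$ with respect to which every operator $\operatorname{ad}_X:\mathfrak{g}\to\mathfrak{g}$, $X\in\mathfrak{h}$, is skew-symmetric. A Cartan involution of a real semisimple Lie algebra $\mathfrak{g}$ with Killing form $B$ is a Lie algebra automorphism $\theta$ with $\theta^2=\operatorname{id}$ such that $\langle X,Y\rangle=-B(X,\theta(Y))$ is positive definite; its eigenspaces are the $+1$-eigenspace $\mathfrak{u}$ and the $-1$-eigenspace $\mathfrak{p}$ (so in (vi), $\mathfrak{h}$ contains $\mathfrak{u}$ or $\mathfrak{p}$). In case (i) there is no restriction on the field or the dimension. *)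

theory Defs
  imports "HOL-Analysis.Analysis" "HOL-Computational_Algebra.Computational_Algebra"
begin

section \<open>Lie algebras over a field\<close>

text \<open>The Lie algebra is a whole type, of arbitrary dimension; its subalgebras and ideals are sets.\<close>

locale lie_algebra = vector_space scale
  for scale :: "'k::field \<Rightarrow> 'a::ab_group_add \<Rightarrow> 'a" +
  fixes br :: "'a \<Rightarrow> 'a \<Rightarrow> 'a"
  assumes br_add_left: "br (x + y) z = br x z + br y z"
    and br_add_right: "br x (y + z) = br x y + br x z"
    and br_scale_left: "br (scale c x) y = scale c (br x y)"
    and br_scale_right: "br x (scale c y) = scale c (br x y)"
    and br_self: "br x x = 0"
    and jacobi: "br x (br y z) + br y (br z x) + br z (br x y) = 0"
begin

definition subalgebra :: "'a set \<Rightarrow> bool" where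
  "subalgebra h \<longleftrightarrow> subspace h \<and> (\<forall>x\<in>h. \<forall>y\<in>h. br x y \<in> h)"

definition normalizer :: "'a set \<Rightarrow> 'a set" where
  "normalizer h = {x. \<forall>y\<in>h. br x y \<in> h}"

definition self_normalizing :: "'a set \<Rightarrow> bool" where
  "self_normalizing h \<longleftrightarrow> h = normalizer h"

definition commutator :: "'a set \<Rightarrow> 'a set \<Rightarrow> 'a set" where
  "commutator u v = span {br x y | x y. x \<in> u \<and> y \<in> v}"

definition perfect :: "'a set \<Rightarrow> bool" where
  "perfect h \<longleftrightarrow> h = commutator h h"

definition center :: "'a set" where
  "center = {z. \<forall>x. br z x = 0}"

definition ideal_of :: "'a set \<Rightarrow> 'a set \<Rightarrow> bool" where
  "ideal_of i h \<longleftrightarrow> subspace i \<and> i \<subseteq> h \<and> (\<forall>x\<in>h. \<forall>y\<in>i. br x y \<in> i)"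

primrec derived_series :: "'a set \<Rightarrow> nat \<Rightarrow> 'a set" where
  "derived_series h 0 = h"
| "derived_series h (Suc n) = commutator (derived_series h n) (derived_series h n)"

definition solvable :: "'a set \<Rightarrow> bool" where
  "solvable h \<longleftrightarrow> (\<exists>n. derived_series h n = {0})"

text \<open>The greatest element exists in finite dimension, where a sum of solvable ideals is solvable;
  only that case is used.\<close>

definition radical :: "'a set \<Rightarrow> 'a set" where
  "radical h = (GREATEST i. ideal_of i h \<and> solvable i)"

definition semisimple :: bool where
  "semisimple \<longleftrightarrow> radical UNIV = {0}"

text \<open>The trace is computed in a fixed basis; in finite dimension its value does not depend on
  this choice.\<close>

definition trace_endo :: "('a \<Rightarrow> 'a) \<Rightarrow> 'k" where
  "trace_endo f = (\<Sum>b\<in>extend_basis {}. representation (extend_basis {}) (f b) b)"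

definition killing_form :: "'a \<Rightarrow> 'a \<Rightarrow> 'k" where
  "killing_form x y = trace_endo (\<lambda>z. br x (br y z))"

definition automorphism :: "('a \<Rightarrow> 'a) \<Rightarrow> bool" where
  "automorphism f \<longleftrightarrow> Vector_Spaces.linear scale scale f \<and> bij f \<and>
     (\<forall>x y. f (br x y) = br (f x) (f y))"

end


section \<open>Real Lie algebras\<close>

definition ad_skew_on :: "('b \<Rightarrow> 'b \<Rightarrow> 'b) \<Rightarrow> 'b set \<Rightarrow> ('b \<Rightarrow> 'b \<Rightarrow> real) \<Rightarrow> bool" where
  "ad_skew_on br h B \<longleftrightarrow> (\<forall>x\<in>h. \<forall>y z. B (br x y) z + B y (br x z) = 0)"

definition symmetric_bilinear :: "('b::real_vector \<Rightarrow> 'b \<Rightarrow> real) \<Rightarrow> bool" where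
  "symmetric_bilinear B \<longleftrightarrow> bilinear B \<and> (\<forall>x y. B x y = B y x)"

definition nondegenerate_on :: "'b::real_vector set \<Rightarrow> ('b \<Rightarrow> 'b \<Rightarrow> real) \<Rightarrow> bool" where
  "nondegenerate_on h B \<longleftrightarrow> (\<forall>x\<in>h. (\<forall>y\<in>h. B x y = 0) \<longrightarrow> x = 0)"

definition positive_definite_on :: "'b::real_vector set \<Rightarrow> ('b \<Rightarrow> 'b \<Rightarrow> real) \<Rightarrow> bool" where
  "positive_definite_on s B \<longleftrightarrow> (\<forall>x\<in>s. x \<noteq> 0 \<longrightarrow> B x x > 0)"

definition orthogonal_compl :: "('b \<Rightarrow> 'b \<Rightarrow> real) \<Rightarrow> 'b set \<Rightarrow> 'b set" where
  "orthogonal_compl B h = {x. \<forall>y\<in>h. B x y = 0}"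

definition inner_product :: "('b::real_vector \<Rightarrow> 'b \<Rightarrow> real) \<Rightarrow> bool" where
  "inner_product B \<longleftrightarrow> symmetric_bilinear B \<and> positive_definite_on UNIV B"

definition compactly_embedded :: "('b::real_vector \<Rightarrow> 'b \<Rightarrow> 'b) \<Rightarrow> 'b set \<Rightarrow> bool" where
  "compactly_embedded br h \<longleftrightarrow> (\<exists>B. inner_product B \<and> ad_skew_on br h B)"

definition cartan_involution :: "('b::real_vector \<Rightarrow> 'b \<Rightarrow> 'b) \<Rightarrow> ('b \<Rightarrow> 'b) \<Rightarrow> bool" where
  "cartan_involution br \<theta> \<longleftrightarrow>
     lie_algebra.automorphism (*\<^sub>R) br \<theta> \<and> \<theta> \<circ> \<theta> = id \<and>
     positive_definite_on UNIV (\<lambda>x y. - lie_algebra.killing_form (*\<^sub>R) br x (\<theta> y))"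


section \<open>Lie groups and compact Lie algebras\<close>

text \<open>\<open>Ck_on k s f\<close>, for \<open>s\<close> open: \<open>f\<close> is \<open>k\<close> times continuously differentiable on \<open>s\<close>.\<close>

primrec Ck_on :: "nat \<Rightarrow> 'e::real_normed_vector set \<Rightarrow> ('e \<Rightarrow> 'f::real_normed_vector) \<Rightarrow> bool" where
  "Ck_on 0 s f \<longleftrightarrow> continuous_on s f"
| "Ck_on (Suc k) s f \<longleftrightarrow>
     (\<forall>x\<in>s. f differentiable at x) \<and> (\<forall>v. Ck_on k s (\<lambda>x. frechet_derivative f (at x) v))"

definition smooth_on :: "'e::real_normed_vector set \<Rightarrow> ('e \<Rightarrow> 'f::real_normed_vector) \<Rightarrow> bool" where
  "smooth_on s f \<longleftrightarrow> (\<forall>k. Ck_on k s f)"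

text \<open>A chart \<open>(U, \<phi>)\<close> is an open set \<open>U\<close> with a map \<open>\<phi>\<close> that is only relevant on \<open>U\<close>; its inverse
  \<open>\<phi> ` U \<rightarrow> U\<close> is \<open>inv_into U \<phi>\<close>.\<close>

locale smooth_atlas =
  fixes \<A> :: "('g::{t2_space, second_countable_topology} set \<times> ('g \<Rightarrow> 'e::euclidean_space)) set"
  assumes chart_open: "(U, \<phi>) \<in> \<A> \<Longrightarrow> open U \<and> open (\<phi> ` U)"
    and chart_homeo: "(U, \<phi>) \<in> \<A> \<Longrightarrow> homeomorphism U (\<phi> ` U) \<phi> (inv_into U \<phi>)"
    and charts_cover: "(\<Union>(U, \<phi>)\<in>\<A>. U) = UNIV"
    and transition_smooth:
      "(U, \<phi>) \<in> \<A> \<Longrightarrow> (V, \<psi>) \<in> \<A> \<Longrightarrow> smooth_on (\<phi> ` (U \<inter> V)) (\<psi> \<circ> inv_into U \<phi>)"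
begin

definition smooth_functions :: "('g \<Rightarrow> real) set" where
  "smooth_functions = {f. \<forall>(U, \<phi>)\<in>\<A>. smooth_on (\<phi> ` U) (f \<circ> inv_into U \<phi>)}"

text \<open>Vector fields are derivations of the algebra of smooth functions. On the other functions the
  value is fixed to be \<open>0\<close>, so that distinct operators are distinct vector fields.\<close>

definition vector_fields :: "(('g \<Rightarrow> real) \<Rightarrow> ('g \<Rightarrow> real)) set" where
  "vector_fields = {D.
     (\<forall>f\<in>smooth_functions. D f \<in> smooth_functions) \<and>
     (\<forall>f. f \<notin> smooth_functions \<longrightarrow> D f = (\<lambda>x. 0)) \<and>
     (\<forall>f\<in>smooth_functions. \<forall>g\<in>smooth_functions. D (\<lambda>x. f x + g x) = (\<lambda>x. D f x + D g x)) \<and>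
     (\<forall>c. \<forall>f\<in>smooth_functions. D (\<lambda>x. c * f x) = (\<lambda>x. c * D f x)) \<and>
     (\<forall>f\<in>smooth_functions. \<forall>g\<in>smooth_functions.
        D (\<lambda>x. f x * g x) = (\<lambda>x. f x * D g x + D f x * g x))}"

end

text \<open>The group is written additively, as in the type class \<open>group_add\<close>, which does not assume
  commutativity.\<close>

locale lie_group = smooth_atlas \<A>
  for \<A> :: "('g::{topological_group_add, t2_space, second_countable_topology} set \<times>
              ('g \<Rightarrow> 'e::euclidean_space)) set" +
  assumes mult_smooth:
      "(U, \<phi>) \<in> \<A> \<Longrightarrow> (V, \<psi>) \<in> \<A> \<Longrightarrow> (W, \<xi>) \<in> \<A> \<Longrightarrow>
       smooth_on {(\<phi> x, \<psi> y) | x y. x \<in> U \<and> y \<in> V \<and> x + y \<in> W}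
         (\<lambda>(a, b). \<xi> (inv_into U \<phi> a + inv_into V \<psi> b))"
    and inverse_smooth:
      "(U, \<phi>) \<in> \<A> \<Longrightarrow> (V, \<psi>) \<in> \<A> \<Longrightarrow>
       smooth_on {\<phi> x | x. x \<in> U \<and> - x \<in> V} (\<lambda>a. \<psi> (- inv_into U \<phi> a))"
begin

definition left_invariant_fields :: "(('g \<Rightarrow> real) \<Rightarrow> ('g \<Rightarrow> real)) set" where
  "left_invariant_fields =
     {D \<in> vector_fields. \<forall>a. \<forall>f\<in>smooth_functions. D (\<lambda>x. f (a + x)) = (\<lambda>x. D f (a + x))}"

text \<open>\<open>\<Phi>\<close> is an isomorphism of the real Lie algebra with bracket \<open>br\<close> onto the Lie algebra of the
  group: the left-invariant vector fields with the commutator bracket.\<close>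

definition lie_algebra_iso ::
    "('b::real_vector \<Rightarrow> 'b \<Rightarrow> 'b) \<Rightarrow> ('b \<Rightarrow> ('g \<Rightarrow> real) \<Rightarrow> ('g \<Rightarrow> real)) \<Rightarrow> bool" where
  "lie_algebra_iso br \<Phi> \<longleftrightarrow>
     bij_betw \<Phi> UNIV left_invariant_fields \<and>
     (\<forall>x y. \<Phi> (x + y) = (\<lambda>f p. \<Phi> x f p + \<Phi> y f p)) \<and>
     (\<forall>c x. \<Phi> (c *\<^sub>R x) = (\<lambda>f p. c * \<Phi> x f p)) \<and>
     (\<forall>x y. \<Phi> (br x y) = (\<lambda>f p. \<Phi> x (\<Phi> y f) p - \<Phi> y (\<Phi> x f) p))"

end

text \<open>The Lie algebra is compact: it is isomorphic to the Lie algebra of a compact Lie group. The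
  type arguments are the underlying set of the group and the model space of its charts; a definition
  cannot quantify over them, so theorems about compact Lie algebras keep them as type variables.
  The first disjunct is the case of a group of dimension \<open>0\<close>: such a compact group is finite, its
  Lie algebra is zero, and the class \<open>euclidean_space\<close> has no \<open>0\<close>-dimensional instance to
  carry its charts.\<close>

definition compact_lie_algebra ::
    "'g::{topological_group_add, t2_space, second_countable_topology} itself \<Rightarrow>
     'e::euclidean_space itself \<Rightarrow> ('b::real_vector \<Rightarrow> 'b \<Rightarrow> 'b) \<Rightarrow> bool" where
  "compact_lie_algebra TG TE br \<longleftrightarrow>
     (\<forall>x::'b. x = 0) \<or>
     (compact (UNIV :: 'g set) \<and>
      (\<exists>(\<A> :: ('g set \<times> ('g \<Rightarrow> 'e)) set) \<Phi>. lie_group \<A> \<and> lie_group.lie_algebra_iso \<A> br \<Phi>))"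

end

theory Submission
  imports "HOL-Algebra.Algebraic_Closure_Type" "HOL-Library.Function_Algebras" Defs
begin

text \<open>
  If \<open>h\<close> is spanned by its brackets and central elements, the Jacobi identity carries
  \<open>[X, h] \<subseteq> N(h)\<close> back to \<open>[X, h] \<subseteq> h\<close>. This settles (i), and (ii) once \<open>h = [h, h] + rad h\<close> is known. The latter
  holds because the radical of the trace form of \<open>h\<close> on \<open>g\<close> is solvable by Cartan's criterion. In the
  proof of the criterion, \<open>ad x\<close> is tested against the derivations \<open>q(ad x)\<close> that act on the generalized
  eigenspace of \<open>c\<close>, over the algebraic closure, as \<open>f(c)\<close> for a \<open>\<rat>\<close>-linear functional \<open>f\<close>; Engel's theorem
  concludes.

  In (iii) the \<open>B\<close>-orthogonal complement of \<open>h\<close> in \<open>N(h)\<close> centralizes \<open>h\<close>, and invariance makes \<open>[X, Y]\<close> a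
  null vector of that complement. For (v) the form \<open>B\<close> is the given inner product, for (vi) it is the Killing
  form up to sign.

  In (iv) it suffices that \<open>(ad Y)\<^sup>2 X = 0\<close> implies \<open>[Y, X] = 0\<close>. On the group, \<open>F(a) = ((Ad\<^sub>a X) f)(1)\<close> is a smooth
  function of \<open>a\<close> with \<open>Y F = G\<close> and \<open>Y G = 0\<close>, where \<open>G\<close> belongs to \<open>[Y, X]\<close>. At a maximum of \<open>F + k G\<close> the
  function \<open>G = Y (F + k G)\<close> vanishes, so \<open>F + k G \<le> max F\<close> for every real \<open>k\<close>, which forces \<open>G = 0\<close>.
\<close>

text \<open>For (ii) a Levi decomposition is bypassed. The form is the Killing form of the whole
  algebra restricted to \<open>h\<close>, and its radical \<open>S\<close> in \<open>h\<close> is a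
  solvable ideal, hence central. A functional that vanishes on \<open>[h, h]\<close> and on the
  center of the algebra is represented on \<open>h\<close> by some \<open>y\<close> in
  \<open>h\<close>; invariance puts \<open>[h, y]\<close> into \<open>S\<close>, so the radical and
  \<open>y\<close> span an abelian ideal and \<open>y\<close> is central. Then
  \<open>ad y = 0\<close>, and the functional vanishes on \<open>h\<close>.

  The obstacle in Cartan's criterion is that the field has neither eigenvalues nor a conjugation,
  and that \<open>q(ad x)\<close> need not be inner. It is enough that \<open>D = q(ad x)\<close> is
  a derivation preserving the extension of \<open>h\<close>: then
  \<open>[D, ad v] = ad (D v)\<close>, whose product with \<open>ad u\<close> has trace zero.
  Rational values of \<open>f\<close> turn the trace of \<open>ad x q(ad x)\<close> into a sum of
  \<open>m f(c)^2\<close>, with \<open>m\<close> the dimension of the generalized eigenspace.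

  For (iv) neither flows nor an invariant integral are constructed. The price is elementary
  calculus: vector fields are abstract derivations and have to be recognized as directional
  derivatives at the identity.\<close>

no_notation vector_scalar_mult (infixl "*s" 70)

section \<open>Linear algebra\<close>

context vector_space
begin

text \<open>On the kernel of one functional the remaining ones suffice by induction; the difference
  left over vanishes on that kernel, hence is a multiple of that functional. With
  \<open>\<phi> c\<close> the pairing with \<open>c\<close>, this represents functionals by vectors
  even where the pairing is degenerate.\<close>

lemma functional_in_span_of_functionals:
  assumes "finite C" and "subspace W"
    and "\<And>c. c \<in> C \<Longrightarrow> Vector_Spaces.linear scale (*) (\<phi> c)"
    and "Vector_Spaces.linear scale (*) l"
    and "\<And>x. x \<in> W \<Longrightarrow> (\<And>c. c \<in> C \<Longrightarrow> \<phi> c x = 0) \<Longrightarrow> l x = 0"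
  shows "\<exists>a. \<forall>x\<in>W. l x = (\<Sum>c\<in>C. a c * \<phi> c x)"
  using assms
proof (induction C arbitrary: W rule: finite_induct)
  case empty
  then show ?case by simp
next
  case (insert c C)
  interpret pc: Vector_Spaces.linear scale "(*)" "\<phi> c" using insert.prems(2) by simp
  interpret l: Vector_Spaces.linear scale "(*)" l by fact
  \<comment> \<open>Shrinking the subspace trades the functional \<open>\<phi> c\<close> for a
    condition on vectors, which is why \<open>W\<close> is general in the induction.\<close>
  define W' where "W' = {x\<in>W. \<phi> c x = 0}"
  have sub: "subspace W'"
    using \<open>subspace W\<close> unfolding subspace_def W'_def by (auto simp: pc.add pc.scale pc.zero)
  obtain a where a: "\<forall>x\<in>W'. l x = (\<Sum>d\<in>C. a d * \<phi> d x)"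
    using insert.IH[OF sub] insert.prems unfolding W'_def by (auto intro: insert.prems)
  define l' where "l' x = l x - (\<Sum>d\<in>C. a d * \<phi> d x)" for x
  have lin: "l' (x + y) = l' x + l' y" "l' (r *s x) = r * l' x" for x y r
  proof -
    have *: "\<phi> d (x + y) = \<phi> d x + \<phi> d y" "\<phi> d (r *s x) = r * \<phi> d x" if "d \<in> C" for d
      using insert.prems(2)[of d] that by (auto simp: Vector_Spaces.linear_iff)
    show "l' (x + y) = l' x + l' y"
      by (simp add: l'_def l.add * sum.distrib algebra_simps)
    show "l' (r *s x) = r * l' x"
      by (simp add: l'_def l.scale * sum_distrib_left algebra_simps)
  qed
  have zero: "l' x = 0" if "x \<in> W" "\<phi> c x = 0" for x
    using a that by (simp add: l'_def W'_def)
  show ?case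
  proof (cases "\<forall>x\<in>W. \<phi> c x = 0")
    case True
    then show ?thesis
      using zero insert.hyps by (intro exI[of _ a]) (auto simp: l'_def)
  next
    case False
    then obtain x0 where x0: "x0 \<in> W" "\<phi> c x0 \<noteq> 0" by auto
    have "l x = l' x0 / \<phi> c x0 * \<phi> c x + (\<Sum>d\<in>C. a d * \<phi> d x)" if "x \<in> W" for x
    proof -
      let ?y = "x + (- (\<phi> c x / \<phi> c x0)) *s x0"
      have "?y \<in> W" using \<open>subspace W\<close> that x0 by (intro subspace_add subspace_scale)
      moreover have "\<phi> c ?y = 0" using x0 by (simp add: pc.add pc.scale pc.neg pc.diff)
      ultimately have "l' ?y = 0" by (rule zero)
      then have "l' x = \<phi> c x / \<phi> c x0 * l' x0"
        unfolding lin by (simp add: add_eq_0_iff)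
      then have "l' x = l' x0 / \<phi> c x0 * \<phi> c x" by simp
      then show ?thesis by (simp only: l'_def[of x] diff_eq_eq)
    qed
    moreover have "(\<Sum>d\<in>insert c C. (a(c := r)) d * \<phi> d x) = r * \<phi> c x + (\<Sum>d\<in>C. a d * \<phi> d x)" for r x
    proof -
      have "(\<Sum>d\<in>C. (a(c := r)) d * \<phi> d x) = (\<Sum>d\<in>C. a d * \<phi> d x)"
        using insert.hyps by (intro sum.cong) auto
      then show ?thesis using insert.hyps by simp
    qed
    ultimately show ?thesis by metis
  qed
qed

text \<open>The coordinate along \<open>x\<close> in a basis that extends \<open>x\<close> and a
  basis of \<open>U\<close>. No dimension is bounded, so this also applies to a field over its prime
  field.\<close>

lemma separating_functional:
  assumes "subspace U" "x \<notin> U"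
  shows "\<exists>l. Vector_Spaces.linear scale (*) l \<and> (\<forall>u\<in>U. l u = 0) \<and> l x = 1"
proof -
  obtain B where B: "B \<subseteq> U" "independent B" "U \<subseteq> span B"
    using maximal_independent_subset[of U] by auto
  have sB: "span B = U" using B assms(1) by (simp add: span_subspace)
  then have ind: "independent (insert x B)" using B assms(2) by (simp add: independent_insert)
  let ?E = "extend_basis (insert x B)"
  have E: "independent ?E" "span ?E = UNIV" "insert x B \<subseteq> ?E"
    using ind extend_basis_superset[OF ind] by (simp_all add: independent_extend_basis)
  have "representation ?E u x = 0" if "u \<in> U" for u
  proof -
    have u: "u \<in> span B" using that sB by simp
    have "representation ?E u = representation B u"
      using E u by (intro representation_extend) auto
    moreover have "x \<notin> B" using assms(2) B by auto
    ultimately show ?thesis using representation_ne_zero[of B u x] by auto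
  qed
  moreover have "Vector_Spaces.linear scale (*) (\<lambda>v. representation ?E v x)"
    using E by (intro linear_representation) auto
  moreover have "representation ?E x x = 1"
    using E by (simp add: representation_basis)
  ultimately show ?thesis by blast
qed

text \<open>A trace on \<open>span B\<close>, meaningful when \<open>f\<close> maps that span into
  itself. Subspaces matter because the extension of scalars will be a span inside a larger function
  space.\<close>

definition trace_on :: "'b set \<Rightarrow> ('b \<Rightarrow> 'b) \<Rightarrow> 'a" where
  "trace_on B f = (\<Sum>b\<in>B. representation B (f b) b)"

end

context vector_space
begin

lemma endo_expand:
  assumes "finite B" "independent B" "Vector_Spaces.linear scale scale f" "v \<in> span B"
  shows "f v = (\<Sum>b\<in>B. representation B v b *s f b)"
proof -
  interpret f: Vector_Spaces.linear scale scale f by fact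
  have "v = (\<Sum>b\<in>B. representation B v b *s b)"
    using assms sum_representation_eq[of B v B] by simp
  then have "f v = f (\<Sum>b\<in>B. representation B v b *s b)" by simp
  then show ?thesis by (simp add: f.sum f.scale)
qed

lemma trace_on_change_basis:
  assumes "finite B" "independent B" "finite C" "independent C"
    and "span B = span C" and "Vector_Spaces.linear scale scale f" and "f ` span B \<subseteq> span B"
  shows "trace_on B f = trace_on C f"
proof -
  have inB: "b \<in> span C" "f b \<in> span B" if "b \<in> B" for b
    using that assms span_base[of b B] by auto
  have inC: "c \<in> span B" "f c \<in> span B" if "c \<in> C" for c
    using that assms span_base[of c C] by auto
  have repsum: "representation D (\<Sum>i\<in>I. a i *s g i) d = (\<Sum>i\<in>I. a i * representation D (g i) d)"
    if "independent D" "\<And>i. i \<in> I \<Longrightarrow> g i \<in> span D" for D d I and a :: "'b \<Rightarrow> 'a" and g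
    using that by (simp add: representation_sum span_scale representation_scale)
  have "trace_on B f = (\<Sum>b\<in>B. representation B (\<Sum>c\<in>C. representation C b c *s f c) b)"
    unfolding trace_on_def using assms inB by (intro sum.cong refl) (simp add: endo_expand[of C f])
  also have "\<dots> = (\<Sum>b\<in>B. \<Sum>c\<in>C. representation C b c * representation B (f c) b)"
    using assms inC by (intro sum.cong refl repsum) auto
  also have "\<dots> = (\<Sum>c\<in>C. \<Sum>b\<in>B. representation B (f c) b * representation C b c)"
    by (subst sum.swap) (simp add: mult.commute)
  also have "\<dots> = (\<Sum>c\<in>C. representation C (\<Sum>b\<in>B. representation B (f c) b *s b) c)"
    using assms inB by (intro sum.cong refl repsum[symmetric]) auto
  also have "\<dots> = trace_on C f"
    unfolding trace_on_def using assms inC by (intro sum.cong refl) (simp add: sum_representation_eq)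
  finally show ?thesis .
qed

lemma trace_on_commute:
  assumes "finite B" "independent B"
    and f: "Vector_Spaces.linear scale scale f" "f ` span B \<subseteq> span B"
    and g: "Vector_Spaces.linear scale scale g" "g ` span B \<subseteq> span B"
  shows "trace_on B (\<lambda>v. f (g v)) = trace_on B (\<lambda>v. g (f v))"
proof -
  have sp: "f b \<in> span B" "g b \<in> span B" if "b \<in> B" for b
    using that f g span_base[of b B] by auto
  have *: "trace_on B (\<lambda>v. f (g v)) = (\<Sum>b\<in>B. \<Sum>c\<in>B. representation B (g b) c * representation B (f c) b)"
    if f: "Vector_Spaces.linear scale scale f" and sp: "\<And>b. b \<in> B \<Longrightarrow> f b \<in> span B" "\<And>b. b \<in> B \<Longrightarrow> g b \<in> span B"
    for f g
    unfolding trace_on_def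
    using assms(1,2) f sp
    by (intro sum.cong refl) (simp add: endo_expand[of B f] representation_sum span_scale representation_scale)
  have "trace_on B (\<lambda>v. f (g v)) = (\<Sum>b\<in>B. \<Sum>c\<in>B. representation B (g b) c * representation B (f c) b)"
    by (rule *) (use f sp in auto)
  also have "\<dots> = (\<Sum>b\<in>B. \<Sum>c\<in>B. representation B (f b) c * representation B (g c) b)"
    by (subst sum.swap) (simp add: mult.commute)
  also have "\<dots> = trace_on B (\<lambda>v. g (f v))"
    by (rule *[symmetric]) (use g sp in auto)
  finally show ?thesis .
qed

end

section \<open>Normalizers\<close>

context lie_algebra
begin

lemma br_0_left [simp]: "br 0 y = 0"
  using br_add_left[of 0 0 y] by simp

lemma br_0_right [simp]: "br x 0 = 0"
  using br_add_right[of x 0 0] by simp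

lemma br_anti: "br x y = - br y x"
proof -
  have "br (x + y) (x + y) = 0" by (rule br_self)
  then have "br x y + br y x = 0"
    unfolding br_add_left br_add_right by (simp add: br_self add.commute)
  then show ?thesis by (simp add: eq_neg_iff_add_eq_0)
qed

lemma br_minus_left [simp]: "br (- x) y = - br x y"
  using br_add_left[of x "- x" y] by (simp add: eq_neg_iff_add_eq_0 add.commute)

lemma br_minus_right [simp]: "br x (- y) = - br x y"
  using br_add_right[of x y "- y"] by (simp add: eq_neg_iff_add_eq_0 add.commute)

lemma br_diff_left: "br (x - y) z = br x z - br y z"
  using br_add_left[of x "- y" z] by simp

lemma br_diff_right: "br x (y - z) = br x y - br x z"
  using br_add_right[of x y "- z"] by simp

lemma leibniz: "br x (br y z) = br (br x y) z + br y (br x z)"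
proof -
  have "br y (br z x) = - br y (br x z)" by (subst br_anti[of z x]) simp
  moreover have "br z (br x y) = - br (br x y) z" by (rule br_anti)
  ultimately show ?thesis using jacobi[of x y z] by (simp add: algebra_simps add_eq_0_iff)
qed

lemma br_br_left: "br (br x y) z = br x (br y z) - br y (br x z)"
  by (simp add: leibniz[of x y z])

lemma linear_br: "Vector_Spaces.linear scale scale (br x)"
  by unfold_locales (auto simp: br_add_right br_scale_right)

lemma br_sum_right: "br x (\<Sum>i\<in>I. g i) = (\<Sum>i\<in>I. br x (g i))"
proof -
  interpret Vector_Spaces.linear scale scale "br x" by (rule linear_br)
  show ?thesis by (rule sum)
qed

lemma br_sum_left: "br (\<Sum>i\<in>I. g i) x = (\<Sum>i\<in>I. br (g i) x)"
proof -
  have "br (\<Sum>i\<in>I. g i) x = - (\<Sum>i\<in>I. br x (g i))"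
    by (subst br_anti) (simp add: br_sum_right)
  also have "\<dots> = (\<Sum>i\<in>I. br (g i) x)"
    unfolding sum_negf[symmetric] by (intro sum.cong refl) (rule br_anti[symmetric])
  finally show ?thesis .
qed

lemma subalgebra_normalizer:
  assumes "subalgebra h"
  shows "subalgebra (normalizer h)"
proof -
  have h: "subspace h" using assms by (simp add: subalgebra_def)
  have "br (br x y) z \<in> h" if "x \<in> normalizer h" "y \<in> normalizer h" "z \<in> h" for x y z
    using that h by (simp add: normalizer_def br_br_left subspace_diff)
  moreover have "subspace (normalizer h)"
    using h unfolding subspace_def[of "normalizer h"]
    by (auto simp: normalizer_def br_add_left br_scale_left subspace_0 subspace_add subspace_scale)
  ultimately show ?thesis by (auto simp: subalgebra_def normalizer_def[of h])
qed

lemma subset_normalizer: "subalgebra h \<Longrightarrow> h \<subseteq> normalizer h"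
  by (auto simp: subalgebra_def normalizer_def)

text \<open>Every subalgebra lies in its normalizer, so only one inclusion is at stake, and
  membership in \<open>normalizer h\<close> is tested on \<open>h\<close> alone.\<close>

lemma self_normalizing_normalizerI:
  assumes "subalgebra h"
    and "\<And>x y. x \<in> normalizer (normalizer h) \<Longrightarrow> y \<in> h \<Longrightarrow> br x y \<in> h"
  shows "self_normalizing (normalizer h)"
  unfolding self_normalizing_def
  using subset_normalizer[OF subalgebra_normalizer[OF assms(1)]] assms(2)
  by (auto simp: normalizer_def[of h])

lemma self_normalizing_if_generated:
  assumes h: "subalgebra h" and gen: "h \<subseteq> span ({br x y | x y. x \<in> h \<and> y \<in> h} \<union> center)"
  shows "self_normalizing (normalizer h)"
proof (rule self_normalizing_normalizerI[OF h])
  fix x y assume x: "x \<in> normalizer (normalizer h)" and y: "y \<in> h"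
  have sub: "subspace h" using h by (simp add: subalgebra_def)
  have n: "br x y \<in> normalizer h" if "y \<in> h" for y
    using x subset_normalizer[OF h] that by (auto simp: normalizer_def[of "normalizer h"])
  from y gen have "y \<in> span ({br x y | x y. x \<in> h \<and> y \<in> h} \<union> center)" by auto
  then show "br x y \<in> h"
  proof (induction rule: span_induct_alt)
    case base
    then show ?case using sub by (simp add: subspace_0)
  next
    case (step c a b)
    have "br x a \<in> h"
      using step(1)
    proof
      assume "a \<in> {br x y | x y. x \<in> h \<and> y \<in> h}"
      then obtain u v where uv: "a = br u v" "u \<in> h" "v \<in> h" by auto
      \<comment> \<open>\<open>br x u\<close> and \<open>br x v\<close> are only known to normalize
        \<open>h\<close>, but one further bracket with an element of \<open>h\<close> lands in
        \<open>h\<close>.\<close>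
      have "br (br x u) v \<in> h" "br (br x v) u \<in> h"
        using n uv by (auto simp: normalizer_def)
      then have "br (br x u) v + (- br (br x v) u) \<in> h"
        using sub by (intro subspace_add subspace_neg)
      then show ?thesis by (simp add: uv leibniz[of x u v] br_anti[of u "br x v"])
    next
      assume "a \<in> center"
      then have "br a x = 0" by (simp add: center_def)
      then have "br x a = 0" using br_anti[of x a] by simp
      then show ?thesis using sub by (simp add: subspace_0)
    qed
    then show ?case using step sub by (simp add: br_add_right br_scale_right subspace_add subspace_scale)
  qed
qed

lemma self_normalizing_perfect:
  assumes "subalgebra h" "perfect h"
  shows "self_normalizing (normalizer h)"
proof (rule self_normalizing_if_generated)
  have "span {br x y | x y. x \<in> h \<and> y \<in> h} \<subseteq> span ({br x y | x y. x \<in> h \<and> y \<in> h} \<union> center)"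
    by (rule span_mono) auto
  then show "h \<subseteq> span ({br x y | x y. x \<in> h \<and> y \<in> h} \<union> center)"
    using assms(2) unfolding perfect_def commutator_def by auto
qed fact

end

section \<open>Finite dimension and the Killing form\<close>

locale fd_lie_algebra = lie_algebra scale br
  for scale :: "'k::field \<Rightarrow> 'a::ab_group_add \<Rightarrow> 'a" (infixr "*s" 75) and br +
  assumes finite_basis: "finite (extend_basis {})"
begin

lemma basis_independent: "independent (extend_basis {})"
  and basis_span: "span (extend_basis {}) = UNIV"
  by (simp_all add: independent_extend_basis independent_empty)

sublocale finite_dimensional_vector_space scale "extend_basis {}"
  by unfold_locales (auto simp: finite_basis basis_independent basis_span)

text \<open>Finite dimension is expressed through the very basis used by \<open>trace_endo\<close>,
  so facts about \<open>trace_on\<close> transfer without a change of basis.\<close>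

lemma trace_endo_eq: "trace_endo = trace_on (extend_basis {})"
  by (simp add: fun_eq_iff trace_endo_def trace_on_def)

lemma trace_endo_commute:
  assumes "Vector_Spaces.linear scale scale f" "Vector_Spaces.linear scale scale g"
  shows "trace_endo (\<lambda>v. f (g v)) = trace_endo (\<lambda>v. g (f v))"
  unfolding trace_endo_eq
  by (rule trace_on_commute) (use assms in \<open>auto simp: finite_basis basis_independent basis_span\<close>)

lemma trace_endo_add: "trace_endo (\<lambda>v. f v + g v) = trace_endo f + trace_endo g"
  by (simp add: trace_endo_def representation_add basis_independent basis_span sum.distrib)

lemma trace_endo_diff: "trace_endo (\<lambda>v. f v - g v) = trace_endo f - trace_endo g"
  by (simp add: trace_endo_def representation_diff basis_independent basis_span sum_subtractf)

lemma trace_endo_scale: "trace_endo (\<lambda>v. c *s f v) = c * trace_endo f"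
  by (simp add: trace_endo_def representation_scale basis_independent basis_span sum_distrib_left)

lemma linear_br_br: "Vector_Spaces.linear scale scale (\<lambda>z. br x (br y z))"
  by unfold_locales (auto simp: br_add_right br_scale_right)

lemma killing_form_add_left: "killing_form (x + y) z = killing_form x z + killing_form y z"
  by (simp add: killing_form_def br_add_left trace_endo_add)

lemma killing_form_add_right: "killing_form x (y + z) = killing_form x y + killing_form x z"
  by (simp add: killing_form_def br_add_left br_add_right trace_endo_add)

lemma killing_form_scale_left: "killing_form (c *s x) y = c * killing_form x y"
  by (simp add: killing_form_def br_scale_left trace_endo_scale)

lemma killing_form_scale_right: "killing_form x (c *s y) = c * killing_form x y"
  by (simp add: killing_form_def br_scale_left br_scale_right trace_endo_scale)

lemma killing_form_commute: "killing_form x y = killing_form y x"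
  unfolding killing_form_def by (rule trace_endo_commute) (rule linear_br)+

text \<open>After expanding the brackets everything cancels except the traces of \<open>xyz\<close>
  and \<open>yzx\<close>, which agree by cyclicity.\<close>

lemma killing_form_invariant: "killing_form (br x y) z + killing_form y (br x z) = 0"
proof -
  have "trace_endo (\<lambda>v. br x (br y (br z v))) = trace_endo (\<lambda>v. br y (br z (br x v)))"
    using linear_br linear_br_br by (rule trace_endo_commute)
  then show ?thesis
    by (simp add: killing_form_def br_br_left trace_endo_diff br_diff_right)
qed

text \<open>\<open>ad (f x)\<close> is the conjugate of \<open>ad x\<close> by \<open>f\<close>, and
  the trace does not see conjugation.\<close>

lemma killing_form_automorphism:
  assumes "automorphism f"
  shows "killing_form (f x) (f y) = killing_form x y"
proof -
  have lin: "Vector_Spaces.linear scale scale f" and bij: "bij f"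
    and f: "\<And>x y. f (br x y) = br (f x) (f y)"
    using assms by (auto simp: automorphism_def)
  interpret f: Vector_Spaces.linear scale scale f by fact
  define g where "g = inv_into UNIV f"
  have fg: "f (g v) = v" and gf: "g (f v) = v" for v
    using bij by (simp_all add: g_def bij_def surj_f_inv_f)
  have g: "Vector_Spaces.linear scale scale g"
    by unfold_locales (metis fg gf f.add, metis fg gf f.scale)
  interpret g: Vector_Spaces.linear scale scale g by fact
  have "killing_form (f x) (f y) = trace_endo (\<lambda>v. f (br x (br y (g v))))"
    unfolding killing_form_def by (simp add: f fg)
  also have "\<dots> = trace_endo (\<lambda>v. br x (br y (g (f v))))"
    using lin by (rule trace_endo_commute)
      (unfold_locales, auto simp: g.add g.scale br_add_right br_scale_right)
  finally show ?thesis by (simp add: gf killing_form_def)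
qed

end

section \<open>Real Lie algebras with an invariant form\<close>

locale real_fd_lie_algebra = fd_lie_algebra scale br
  for scale :: "real \<Rightarrow> 'a::ab_group_add \<Rightarrow> 'a" (infixr "*s" 75) and br
begin

lemma self_normalizing_invariant_form:
  assumes h: "subalgebra h"
    and lin: "\<And>x. Vector_Spaces.linear scale (*) (B x)" and sym: "\<And>x y. B x y = B y x"
    and nondeg: "\<And>x. x \<in> h \<Longrightarrow> (\<And>y. y \<in> h \<Longrightarrow> B x y = 0) \<Longrightarrow> x = 0"
    and pos: "\<And>x. (\<And>y. y \<in> h \<Longrightarrow> B x y = 0) \<Longrightarrow> x \<noteq> 0 \<Longrightarrow> B x x > 0"
    and skew: "\<And>x y z. x \<in> h \<Longrightarrow> B (br x y) z + B y (br x z) = 0"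
  shows "self_normalizing (normalizer h)"
proof (rule self_normalizing_normalizerI[OF h])
  fix x y assume x: "x \<in> normalizer (normalizer h)" and y: "y \<in> h"
  have sub: "subspace h" using h by (simp add: subalgebra_def)
  have Badd: "B u (v + w) = B u v + B u w" "B (v + w) u = B v u + B w u"
    and Bscale: "B u (r *s v) = r * B u v" "B (r *s v) u = r * B v u" for u v w r
    using lin[of u] sym[of u] by (auto simp: Vector_Spaces.linear_iff)
  have B0: "B u 0 = 0" for u using Bscale(1)[of u 0 0] by simp
  have Bsum: "B (\<Sum>i\<in>I. g i) u = (\<Sum>i\<in>I. B (g i) u)" for I u and g :: "'a \<Rightarrow> 'a"
  proof -
    interpret Vector_Spaces.linear scale "(*)" "B u" by (rule lin)
    show ?thesis by (simp add: sym[of _ u] sum)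
  qed
  \<comment> \<open>Orthogonal projection onto \<open>h\<close>. The form may be indefinite on
    \<open>h\<close>, so nondegeneracy replaces the usual positivity argument: the pairing with
    \<open>a\<close> is a combination of pairings with a basis of \<open>h\<close>.\<close>
  have proj: "\<exists>b\<in>h. \<forall>z\<in>h. B (a - b) z = 0" for a
  proof -
    obtain C where C: "C \<subseteq> h" "independent C" "h \<subseteq> span C"
      using maximal_independent_subset[of h] by auto
    have fin: "finite C" using C(2) by (rule finiteI_independent)
    have "\<exists>c. \<forall>x\<in>h. B a x = (\<Sum>b\<in>C. c b * B b x)"
    proof (rule functional_in_span_of_functionals[OF fin sub lin lin])
      fix z assume z: "z \<in> h" "\<And>c. c \<in> C \<Longrightarrow> B c z = 0"
      have "B z w = 0" if "w \<in> h" for w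
      proof -
        have "w \<in> span C" using C that by auto
        then show ?thesis
        proof (induction rule: span_induct_alt)
          case base
          then show ?case by (rule B0)
        next
          case (step c u v)
          then show ?case using z(2)[of u] by (simp add: Badd Bscale sym[of u])
        qed
      qed
      then have "z = 0" using nondeg z by blast
      then show "B a z = 0" by (simp add: B0)
    qed
    then obtain c where c: "\<And>x. x \<in> h \<Longrightarrow> B a x = (\<Sum>b\<in>C. c b * B b x)" by blast
    let ?b = "\<Sum>b\<in>C. c b *s b"
    have "?b \<in> h" using C sub by (intro subspace_sum subspace_scale) auto
    moreover have "B (a - ?b) z = 0" if "z \<in> h" for z
    proof -
      have "B (a + (-1) *s ?b) z = 0"
        unfolding Badd Bscale Bsum using c[OF that] by simp
      then show ?thesis by simp
    qed
    ultimately show ?thesis by blast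
  qed
  obtain b where b: "b \<in> h" "\<And>z. z \<in> h \<Longrightarrow> B (x - b) z = 0" using proj[of x] by blast
  define u where "u = x - b"
  have "br b y \<in> h" using h b y by (simp add: subalgebra_def)
  \<comment> \<open>\<open>br x y\<close> equals \<open>br b y - w\<close>, and
    \<open>br b y\<close> is in \<open>h\<close>; the goal is therefore
    \<open>w = 0\<close>.\<close>
  define w where "w = br y u"
  have perp: "B w z = 0" if "z \<in> h" for z
  proof -
    have "br y z \<in> h" using h y that by (simp add: subalgebra_def)
    then show ?thesis using skew[OF y, of u z] b(2) by (simp add: w_def u_def)
  qed
  have "br x y \<in> normalizer h"
    using x y subset_normalizer[OF h] by (auto simp: normalizer_def[of "normalizer h"])
  moreover have "br b y \<in> normalizer h" using \<open>br b y \<in> h\<close> subset_normalizer[OF h] by auto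
  ultimately have "br x y - br b y \<in> normalizer h"
    using subalgebra_normalizer[OF h] by (simp add: subalgebra_def subspace_diff)
  then have wn: "br w z \<in> h" if "z \<in> h" for z
    using that sub subspace_neg[of h "br (br u y) z"]
    by (simp add: w_def u_def br_anti[of y] br_diff_left[symmetric] normalizer_def)
  \<comment> \<open>\<open>w\<close> normalizes \<open>h\<close> and is orthogonal to it, so
    \<open>br y w\<close> lies in \<open>h\<close> and, by skewness, is orthogonal to
    \<open>h\<close>. Then \<open>B w w = - B u (br y w)\<close> vanishes.\<close>
  have "br y w = 0"
  proof (rule nondeg)
    show "br y w \<in> h" using wn[OF y] subspace_neg[OF sub, of "br w y"] br_anti[of y w] by simp
    fix z assume "z \<in> h"
    then have "br y z \<in> h" using h y by (simp add: subalgebra_def)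
    then show "B (br y w) z = 0" using skew[OF y, of w z] perp by simp
  qed
  then have "B w w = 0" using skew[OF y, of u w] by (simp add: w_def B0)
  then have "w = 0" using pos[OF perp] by fastforce
  then have "br x y = br b y" using br_anti[of y u] by (simp add: w_def u_def br_diff_left)
  then show "br x y \<in> h" using \<open>br b y \<in> h\<close> by simp
qed

lemma self_normalizing_cartan_involution:
  assumes h: "subalgebra h" and aut: "automorphism \<theta>" and inv: "\<And>x. \<theta> (\<theta> x) = x"
    and pos: "\<And>x. x \<noteq> 0 \<Longrightarrow> killing_form x (\<theta> x) < 0"
    and sub: "{x. \<theta> x = x} \<subseteq> h \<or> {x. \<theta> x = - x} \<subseteq> h"
  shows "self_normalizing (normalizer h)"
proof -
  \<comment> \<open>\<open>s\<close> is the eigenvalue whose eigenspace lies in \<open>h\<close>. It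
    also fixes the sign of the form: the complement of \<open>h\<close> lies in the other
    eigenspace, where \<open>s\<close> times the Killing form is positive.\<close>
  obtain s :: real where s: "s = 1 \<or> s = -1" "{x. \<theta> x = s *s x} \<subseteq> h"
  proof (cases "{x. \<theta> x = x} \<subseteq> h")
    case True
    then show thesis by (intro that[of 1]) simp_all
  next
    case False
    then show thesis using sub by (intro that[of "-1"]) simp_all
  qed
  have ss: "s * s = 1" using s by auto
  interpret t: Vector_Spaces.linear scale scale \<theta> using aut by (simp add: automorphism_def)
  note K = killing_form_add_left killing_form_add_right killing_form_scale_left killing_form_scale_right
  have sh: "subspace h" using h by (simp add: subalgebra_def)
  have eig: "\<theta> (x + s *s \<theta> x) = s *s (x + s *s \<theta> x)" for x
    using s by (auto simp: t.add t.scale t.neg t.diff inv)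
  then have mem: "x + s *s \<theta> x \<in> h" for x using s by auto
  \<comment> \<open>Containing one eigenspace makes \<open>h\<close> stable under
    \<open>\<theta>\<close>; pairing \<open>x\<close> with \<open>\<theta> x\<close> then shows
    nondegeneracy on \<open>h\<close>.\<close>
  have stable: "\<theta> x \<in> h" if "x \<in> h" for x
  proof -
    have "s *s (x + s *s \<theta> x - x) \<in> h" using mem that sh by (intro subspace_scale subspace_diff)
    then show ?thesis by (simp add: ss)
  qed
  have zero: "x = 0" if "killing_form x (\<theta> x) = 0" for x using pos[of x] that by fastforce
  show ?thesis
  proof (rule self_normalizing_invariant_form[OF h, of "\<lambda>x y. s * killing_form x y"])
    show "Vector_Spaces.linear scale (*) (\<lambda>y. s * killing_form x y)" for x
      by unfold_locales (auto simp: K algebra_simps)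
    show "s * killing_form x y = s * killing_form y x" for x y
      by (simp add: killing_form_commute)
    show "x = 0" if "x \<in> h" "\<And>y. y \<in> h \<Longrightarrow> s * killing_form x y = 0" for x
      using that(2)[OF stable[OF that(1)]] s by (intro zero) auto
    show "s * killing_form (br x y) z + s * killing_form y (br x z) = 0" for x y z
      using killing_form_invariant[of x y z] by (simp add: distrib_left[symmetric])
    fix x assume x: "\<And>y. y \<in> h \<Longrightarrow> s * killing_form x y = 0" "x \<noteq> 0"
    \<comment> \<open>Twice the component of \<open>x\<close> in the eigenspace inside
      \<open>h\<close>. It is orthogonal to \<open>x\<close> and to \<open>\<theta> x\<close>, hence
      to itself, and definiteness kills it.\<close>
    define a where "a = x + s *s \<theta> x"
    have ta: "\<theta> a = s *s a" unfolding a_def by (rule eig)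
    have 0: "killing_form x a = 0" using x(1)[OF mem[of x]] s by (auto simp: a_def)
    have "killing_form (\<theta> x) a = killing_form (\<theta> (\<theta> x)) (\<theta> a)"
      by (rule killing_form_automorphism[OF aut, symmetric])
    then have "killing_form (\<theta> x) a = 0" by (simp add: inv ta K 0)
    then have "killing_form a a = 0"
      using 0 by (subst (1) a_def) (simp add: K)
    then have "a = 0" by (intro zero) (simp add: ta K)
    then have "s *s (x + s *s \<theta> x) = 0" by (simp add: a_def)
    then have "\<theta> x = - (s *s x)" by (simp add: scale_right_distrib ss add_eq_0_iff)
    then show "s * killing_form x x > 0"
      using pos[OF x(2)] K(4)[of x "-s" x] by simp
  qed
qed

end

section \<open>Endomorphisms and traces\<close>

context vector_space
begin

lemma trace_on_restrict:
  assumes "finite B" "independent B" "C \<subseteq> B" "f ` B \<subseteq> span C"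
  shows "trace_on B f = trace_on C f"
proof -
  have indC: "independent C" using assms independent_mono by blast
  have rep: "representation B (f b) = representation C (f b)" if "b \<in> B" for b
    using assms that by (intro representation_extend) auto
  have "trace_on B f = (\<Sum>b\<in>B. representation C (f b) b)"
    by (simp add: trace_on_def rep)
  also have "\<dots> = trace_on C f"
    unfolding trace_on_def
    using assms representation_ne_zero by (intro sum.mono_neutral_right) blast+
  finally show ?thesis .
qed

lemma obtain_adapted_basis:
  assumes "finite B" "independent B" "subspace U" "U \<subseteq> span B"
  obtains C D where "C \<subseteq> D" "finite D" "independent D" "span C = U" "span D = span B"
proof -
  obtain C where C: "C \<subseteq> U" "independent C" "U \<subseteq> span C"
    using maximal_independent_subset[of U] by auto
  then have "C \<subseteq> span B" using assms by auto
  then obtain D where D: "C \<subseteq> D" "D \<subseteq> span B" "independent D" "span B \<subseteq> span D"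
    using maximal_independent_subset_extend[of C "span B"] C by auto
  have "finite D" using independent_span_bound[OF assms(1) D(3) D(2)] by auto
  moreover have "span C = U" using C assms by (simp add: span_subspace)
  moreover have "span D = span B" using D by (simp add: span_subspace)
  ultimately show thesis using that D by blast
qed

text \<open>The trace can be computed on the image of \<open>f\<close>, where the exponent of
  nilpotency is one less.\<close>

lemma trace_on_nilpotent:
  assumes "finite B" "independent B" "Vector_Spaces.linear scale scale f" "f ` span B \<subseteq> span B"
    and "\<And>v. v \<in> span B \<Longrightarrow> (f ^^ n) v = 0"
  shows "trace_on B f = 0"
  using assms
proof (induction n arbitrary: B)
  case 0
  have "B = {}"
  proof (rule ccontr)
    assume "B \<noteq> {}"
    then obtain b where b: "b \<in> B" by auto
    then have "b = 0" using 0(5)[of b] by (simp add: span_base)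
    then show False using b 0(2) dependent_zero by blast
  qed
  then show ?case by (simp add: trace_on_def)
next
  case (Suc n)
  interpret f: Vector_Spaces.linear scale scale f by fact
  have sub: "subspace (f ` span B)" by (intro f.subspace_image subspace_span)
  obtain C D where CD: "C \<subseteq> D" "finite D" "independent D" "span C = f ` span B" "span D = span B"
    using obtain_adapted_basis[OF Suc.prems(1,2) sub Suc.prems(4)] by blast
  have "trace_on B f = trace_on D f"
    using Suc.prems CD by (intro trace_on_change_basis) auto
  also have "\<dots> = trace_on C f"
    using CD span_superset[of D] by (intro trace_on_restrict) auto
  also have "\<dots> = 0"
  proof (rule Suc.IH)
    show "finite C" "independent C" using CD finite_subset independent_mono by blast+
    show "f ` span C \<subseteq> span C" using Suc.prems(4) by (auto simp: CD)
    fix v assume "v \<in> span C"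
    then obtain u where u: "u \<in> span B" "v = f u" by (auto simp: CD)
    then show "(f ^^ n) v = 0" using Suc.prems(5)[of u] by (simp add: funpow_swap1)
  qed fact
  finally show ?case .
qed

text \<open>The trace of a projection is its rank. Positivity is recorded for the natural number
  because the field carries no order.\<close>

lemma trace_on_projection:
  assumes "finite B" "independent B" "Vector_Spaces.linear scale scale f"
    and "subspace U" "U \<subseteq> span B" "f ` span B \<subseteq> U" "\<And>u. u \<in> U \<Longrightarrow> f u = u"
  shows "\<exists>n. trace_on B f = of_nat n \<and> (U \<noteq> {0} \<longrightarrow> n > 0)"
proof -
  obtain C D where CD: "C \<subseteq> D" "finite D" "independent D" "span C = U" "span D = span B"
    using obtain_adapted_basis[OF assms(1,2,4,5)] by blast
  have fin: "finite C" "independent C" using CD finite_subset independent_mono by blast+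
  have "D \<subseteq> span B" using CD(5) span_superset[of D] by simp
  then have fD: "f ` D \<subseteq> span C" using assms(6) CD(4) by blast
  have "trace_on B f = trace_on D f"
    using assms CD by (intro trace_on_change_basis) auto
  also have "\<dots> = trace_on C f"
    using CD fD by (intro trace_on_restrict) auto
  also have "\<dots> = (\<Sum>b\<in>C. 1)"
    unfolding trace_on_def
  proof (intro sum.cong refl)
    fix b assume "b \<in> C"
    then show "representation C (f b) b = 1"
      using fin assms(7)[of b] CD(4) span_base[of b C] by (simp add: representation_basis)
  qed
  finally have "trace_on B f = of_nat (card C)" by simp
  moreover have "card C > 0" if "U \<noteq> {0}"
    using that fin CD(4) by (cases "C = {}") (auto simp: card_gt_0_iff)
  ultimately show ?thesis by blast
qed

end

section \<open>Polynomials in an endomorphism and primary decomposition\<close>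

locale endomorphism = vector_space scale
  for scale :: "'a::field \<Rightarrow> 'b::ab_group_add \<Rightarrow> 'b" (infixr "*s" 75) +
  fixes A :: "'b \<Rightarrow> 'b"
  assumes linear_A: "Vector_Spaces.linear scale scale A"
begin

sublocale A: Vector_Spaces.linear scale scale A by (rule linear_A)

text \<open>The operator \<open>p(A)\<close>, given vector by vector: the module structure over the
  polynomial ring.\<close>

definition pact :: "'a poly \<Rightarrow> 'b \<Rightarrow> 'b" where
  "pact p v = (\<Sum>i\<le>degree p. coeff p i *s (A ^^ i) v)"

lemma pact_bound:
  assumes "degree p \<le> n"
  shows "pact p v = (\<Sum>i\<le>n. coeff p i *s (A ^^ i) v)"
  unfolding pact_def using assms
  by (intro sum.mono_neutral_left) (auto simp: coeff_eq_0)

lemma linear_funpow: "Vector_Spaces.linear scale scale (A ^^ n)"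
proof (induction n)
  case 0
  show ?case by unfold_locales auto
next
  case (Suc n)
  interpret p: Vector_Spaces.linear scale scale "A ^^ n" by fact
  show ?case by unfold_locales (auto simp: p.add p.scale A.add A.scale)
qed

lemma pact_0 [simp]: "pact 0 v = 0"
  by (simp add: pact_def)

lemma pact_add: "pact (p + q) v = pact p v + pact q v"
  using pact_bound[of p "max (degree p) (degree q)" v] pact_bound[of q "max (degree p) (degree q)" v]
    pact_bound[of "p + q" "max (degree p) (degree q)" v] degree_add_le_max[of p q]
  by (simp add: scale_left_distrib sum.distrib)

lemma pact_smult: "pact (smult c p) v = c *s pact p v"
  using pact_bound[of "smult c p" "degree p" v] degree_smult_le[of c p]
  by (simp add: pact_def scale_sum_right)

lemma pact_pCons: "pact (pCons a p) v = a *s v + A (pact p v)"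
proof -
  have "pact (pCons a p) v = (\<Sum>i\<le>Suc (degree p). coeff (pCons a p) i *s (A ^^ i) v)"
    by (intro pact_bound degree_pCons_le)
  also have "\<dots> = a *s v + (\<Sum>i\<le>degree p. coeff p i *s (A ^^ Suc i) v)"
    by (subst sum.atMost_Suc_shift) simp
  finally show ?thesis by (simp add: pact_def A.sum A.scale)
qed

lemma linear_pact: "Vector_Spaces.linear scale scale (pact p)"
proof (induction p rule: pCons_induct)
  case 0
  then show ?case by unfold_locales auto
next
  case (pCons a p)
  interpret p: Vector_Spaces.linear scale scale "pact p" by fact
  show ?case
    by unfold_locales
      (auto simp: pact_pCons p.add p.scale A.add A.scale scale_right_distrib mult.commute)
qed

lemma pact_const [simp]: "pact [:c:] v = c *s v"
  by (simp add: pact_pCons)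

lemma pact_1 [simp]: "pact 1 v = v"
  by (simp add: one_pCons)

lemma pact_mult: "pact (p * q) v = pact p (pact q v)"
proof (induction p rule: pCons_induct)
  case (pCons a p)
  then show ?case by (simp add: mult_pCons_left pact_add pact_smult pact_pCons)
qed simp

lemma pact_minus: "pact (- p) v = - pact p v"
  using pact_smult[of "-1" p v] by simp

lemma pact_diff: "pact (p - q) v = pact p v - pact q v"
  using pact_add[of p "- q" v] by (simp add: pact_minus)

lemma pact_linear_factor: "pact [:- c, 1:] v = A v - c *s v"
  by (simp add: pact_pCons)

lemma pact_dvd_zero: "p dvd q \<Longrightarrow> pact p v = 0 \<Longrightarrow> pact q v = 0"
proof -
  assume "p dvd q" "pact p v = 0"
  then obtain r where "q = r * p" by (auto simp: dvd_def mult.commute)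
  interpret r: Vector_Spaces.linear scale scale "pact r" by (rule linear_pact)
  show "pact q v = 0" using \<open>pact p v = 0\<close> by (simp add: \<open>q = r * p\<close> pact_mult r.zero)
qed

lemma pact_funpow: "pact (monom 1 n) v = (A ^^ n) v"
  by (induction n) (simp_all add: monom_0 monom_Suc pact_pCons)

lemma pact_mem:
  assumes "subspace W" "A ` W \<subseteq> W" "v \<in> W"
  shows "pact p v \<in> W"
proof (induction p rule: pCons_induct)
  case 0
  then show ?case using assms by (simp add: subspace_0)
next
  case (pCons a p)
  then show ?case using assms by (auto simp: pact_pCons intro!: subspace_add subspace_scale)
qed

end

text \<open>Modulo \<open>X - c\<close> the polynomial \<open>P\<close> is the nonzero constant
  \<open>poly P c\<close>, which gives exponent one. Higher exponents come from inserting that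
  identity, which equals 1, into the previous one.\<close>

lemma linear_factor_bezout:
  fixes P :: "'a::field poly"
  assumes "poly P c \<noteq> 0"
  shows "\<exists>a b. a * P + b * [:- c, 1:] ^ n = 1"
proof -
  have "[:- c, 1:] dvd P - [:poly P c:]"
    by (simp add: poly_eq_0_iff_dvd[symmetric])
  then obtain g where g: "P - [:poly P c:] = [:- c, 1:] * g" by (auto simp: dvd_def)
  define a where "a = [:1 / poly P c:]"
  have "a * P + (- a * g) * [:- c, 1:] = a * (P - [:- c, 1:] * g)" by (simp add: algebra_simps)
  also have "\<dots> = a * [:poly P c:]" by (simp only: g[symmetric]) simp
  also have "\<dots> = 1" using assms by (simp add: a_def one_pCons)
  finally have 1: "a * P + (- a * g) * [:- c, 1:] = 1" .
  show ?thesis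
  proof (induction n)
    case 0
    then show ?case by (intro exI[of _ 0] exI[of _ 1]) simp
  next
    case (Suc n)
    then obtain u v where uv: "u * P + v * [:- c, 1:] ^ n = 1" by blast
    have "u * P + v * [:- c, 1:] ^ n * (a * P + (- a * g) * [:- c, 1:]) = 1"
      by (simp only: 1 uv mult_1_right)
    then have "(u + v * [:- c, 1:] ^ n * a) * P + (v * (- a * g)) * [:- c, 1:] ^ Suc n = 1"
      by (simp only: power_Suc ac_simps distrib_left distrib_right)
    then show ?case by blast
  qed
qed

text \<open>The Chinese remainder theorem for powers of distinct linear factors, with constant
  remainders.\<close>

lemma linear_factors_interpolation:
  fixes L :: "'a::field set"
  assumes "finite L"
  shows "\<exists>q. \<forall>c\<in>L. [:- c, 1:] ^ n dvd q - [:f c:]"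
  using assms
proof (induction L rule: finite_induct)
  case (insert c L)
  then obtain q where q: "\<forall>d\<in>L. [:- d, 1:] ^ n dvd q - [:f d:]" by blast
  define P where "P = (\<Prod>d\<in>L. [:- d, 1:] ^ n)"
  have "poly P c \<noteq> 0" using insert by (auto simp: P_def poly_prod poly_power)
  then obtain a b where ab: "a * P + b * [:- c, 1:] ^ n = 1"
    using linear_factor_bezout by blast
  \<comment> \<open>The correction is a multiple of \<open>P\<close>, so the old remainders survive;
    modulo the new factor \<open>a * P\<close> is 1, which makes the new remainder
    \<open>f c\<close>.\<close>
  define q' where "q' = q + a * P * ([:f c:] - q)"
  have "q' - [:f c:] = (a * P - 1) * ([:f c:] - q)" by (simp add: q'_def algebra_simps)
  also have "a * P - 1 = - (b * [:- c, 1:] ^ n)" using ab by (simp add: algebra_simps)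
  finally have "[:- c, 1:] ^ n dvd q' - [:f c:]" by simp
  moreover have "[:- d, 1:] ^ n dvd q' - [:f d:]" if "d \<in> L" for d
  proof -
    have "[:- d, 1:] ^ n dvd P" unfolding P_def using insert that by (intro dvd_prodI) auto
    moreover have "q' - [:f d:] = (q - [:f d:]) + P * (a * ([:f c:] - q))"
      by (simp add: q'_def algebra_simps)
    ultimately show ?thesis using q that by (metis dvd_add dvd_mult2)
  qed
  ultimately show ?case by blast
qed simp

context endomorphism
begin

text \<open>The exponent is kept explicit because exponents add when vectors are multiplied.
  Exponent 0 gives the zero space.\<close>

definition gen_eigenspace :: "nat \<Rightarrow> 'a \<Rightarrow> 'b set" where
  "gen_eigenspace n c = {v. pact ([:- c, 1:] ^ n) v = 0}"

lemma subspace_gen_eigenspace: "subspace (gen_eigenspace n c)"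
proof -
  interpret p: Vector_Spaces.linear scale scale "pact ([:- c, 1:] ^ n)" by (rule linear_pact)
  show ?thesis by (auto simp: subspace_def gen_eigenspace_def p.add p.scale p.zero)
qed

lemma pact_on_gen_eigenspace:
  assumes "[:- c, 1:] ^ n dvd q - [:r:]" "v \<in> gen_eigenspace n c"
  shows "pact q v = r *s v"
proof -
  have "pact (q - [:r:]) v = 0"
    using assms by (auto simp: gen_eigenspace_def intro: pact_dvd_zero)
  then show ?thesis by (simp add: pact_diff)
qed

text \<open>The Bezout identity splits \<open>v\<close> into a part killed by the power of one
  factor and a part killed by the product of the others. Both are polynomials in \<open>A\<close>
  applied to \<open>v\<close>, so they stay in the invariant subspace.\<close>

lemma primary_decomposition:
  assumes "finite L" "subspace W" "A ` W \<subseteq> W" "v \<in> W" "pact (\<Prod>c\<in>L. [:- c, 1:] ^ n) v = 0"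
  shows "v \<in> span (W \<inter> (\<Union>c\<in>L. gen_eigenspace n c))"
  using assms
proof (induction L arbitrary: v rule: finite_induct)
  case empty
  then show ?case by (simp add: span_zero)
next
  case (insert c L)
  define P where "P = (\<Prod>d\<in>L. [:- d, 1:] ^ n)"
  have "poly P c \<noteq> 0" using insert by (auto simp: P_def poly_prod poly_power)
  then obtain a b where ab: "a * P + b * [:- c, 1:] ^ n = 1"
    using linear_factor_bezout by blast
  let ?u = "pact (a * P) v" and ?w = "pact (b * [:- c, 1:] ^ n) v"
  have "v = ?u + ?w" using ab by (simp flip: pact_add)
  have kill: "pact (P * [:- c, 1:] ^ n) v = 0"
    using insert.prems(4) insert.hyps by (simp add: P_def mult.commute)
  have "pact ([:- c, 1:] ^ n) ?u = pact (a * (P * [:- c, 1:] ^ n)) v"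
    by (simp add: pact_mult[symmetric] ac_simps)
  also have "\<dots> = 0" by (rule pact_dvd_zero[OF _ kill]) simp
  finally have "?u \<in> W \<inter> (\<Union>c\<in>insert c L. gen_eigenspace n c)"
    using insert.prems by (auto simp: gen_eigenspace_def intro: pact_mem)
  moreover have "?w \<in> span (W \<inter> (\<Union>c\<in>L. gen_eigenspace n c))"
  proof (rule insert.IH)
    show "?w \<in> W" using insert.prems by (auto intro: pact_mem)
    have "pact P ?w = pact (b * (P * [:- c, 1:] ^ n)) v"
      by (simp add: pact_mult[symmetric] ac_simps)
    also have "\<dots> = 0" by (rule pact_dvd_zero[OF _ kill]) simp
    finally show "pact (\<Prod>d\<in>L. [:- d, 1:] ^ n) ?w = 0" by (simp add: P_def)
  qed (use insert.prems in auto)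
  then have "?w \<in> span (W \<inter> (\<Union>c\<in>insert c L. gen_eigenspace n c))"
    by (rule subsetD[OF span_mono, rotated]) auto
  ultimately have "?u + ?w \<in> span (W \<inter> (\<Union>c\<in>insert c L. gen_eigenspace n c))"
    by (intro span_add) (auto intro: span_base)
  then show ?case using \<open>v = ?u + ?w\<close> by simp
qed

text \<open>There are \<open>card B + 1\<close> iterates of \<open>b\<close> in a space of dimension
  at most \<open>card B\<close>. Repeated iterates form a separate case, since dependence is a
  property of the set and forgets repetitions.\<close>

lemma annihilating_poly:
  assumes "finite B" "A ` span B \<subseteq> span B" "b \<in> span B"
  shows "\<exists>p. p \<noteq> 0 \<and> pact p b = 0"
proof (cases "inj_on (\<lambda>i. (A ^^ i) b) {..card B}")
  case False
  then obtain i j where ij: "i \<noteq> j" "(A ^^ i) b = (A ^^ j) b" by (auto simp: inj_on_def)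
  then have "pact (monom 1 i - monom 1 j) b = 0" by (simp add: pact_diff pact_funpow)
  moreover have "coeff (monom 1 i - monom 1 j) i \<noteq> (0::'a)" using ij by simp
  then have "monom 1 i - monom 1 j \<noteq> (0::'a poly)" by (metis coeff_0)
  ultimately show ?thesis by blast
next
  case True
  let ?S = "(\<lambda>i. (A ^^ i) b) ` {..card B}"
  have "(A ^^ i) b \<in> span B" for i
    using pact_mem[of "span B" b "monom 1 i"] assms by (simp add: pact_funpow)
  then have "dependent ?S"
    using independent_span_bound[OF assms(1), of ?S] True by (force simp: card_image)
  then obtain u where u: "\<exists>v\<in>?S. u v \<noteq> 0" "(\<Sum>v\<in>?S. u v *s v) = 0"
    using dependent_finite[of ?S] by auto
  define p where "p = Abs_poly (\<lambda>i. if i \<le> card B then u ((A ^^ i) b) else 0)"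
  have coeff: "coeff p = (\<lambda>i. if i \<le> card B then u ((A ^^ i) b) else 0)"
    unfolding p_def by (intro coeff_Abs_poly_If_le)
  have "degree p \<le> card B" by (intro degree_le) (simp add: coeff)
  then have "pact p b = (\<Sum>i\<le>card B. u ((A ^^ i) b) *s (A ^^ i) b)"
    by (simp add: pact_bound coeff)
  also have "\<dots> = 0" using u(2) True by (simp add: sum.reindex)
  finally have "pact p b = 0" .
  moreover obtain i where i: "i \<le> card B" "u ((A ^^ i) b) \<noteq> 0" using u(1) by auto
  then have "coeff p i \<noteq> 0" by (simp add: coeff)
  then have "p \<noteq> 0" by auto
  ultimately show ?thesis by blast
qed

lemma annihilating_poly_uniform:
  assumes "finite B" "A ` span B \<subseteq> span B"
  shows "\<exists>p. p \<noteq> 0 \<and> (\<forall>v\<in>span B. pact p v = 0)"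
proof -
  have "\<forall>b\<in>B. \<exists>p. p \<noteq> 0 \<and> pact p b = 0"
    using annihilating_poly[OF assms] span_base by blast
  then obtain p where p: "\<And>b. b \<in> B \<Longrightarrow> p b \<noteq> 0" "\<And>b. b \<in> B \<Longrightarrow> pact (p b) b = 0" by metis
  have "pact (prod p B) v = 0" if "v \<in> span B" for v
    using that
  proof (induction rule: span_induct)
    case base
    interpret p: Vector_Spaces.linear scale scale "pact (prod p B)" by (rule linear_pact)
    show ?case by (simp add: subspace_def p.add p.scale p.zero)
  next
    case (step b)
    then show ?case using assms(1) p(2) by (auto intro: pact_dvd_zero[OF dvd_prodI])
  qed
  moreover have "prod p B \<noteq> 0" using p(1) assms(1) by simp
  ultimately show ?thesis by blast
qed

end

section \<open>Nilpotency from traces\<close>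

text \<open>The prime field of a field of characteristic zero; \<^const>\<open>of_rat\<close> is only available for the
  type class \<open>field_char_0\<close>.\<close>

definition rat_emb :: "rat \<Rightarrow> 'l::field" where
  "rat_emb r = of_int (fst (quotient_of r)) / of_int (snd (quotient_of r))"

context
  assumes char0: "CHAR('l::field) = 0"
begin

lemma of_int_eq_0_char_0: "(of_int n :: 'l) = 0 \<longleftrightarrow> n = 0"
  using char0 by (simp add: of_int_eq_0_iff_char_dvd)

lemma rat_emb_Fract:
  assumes "b \<noteq> 0"
  shows "(rat_emb (Rat.Fract a b) :: 'l) = of_int a / of_int b"
proof -
  obtain c d where cd: "quotient_of (Rat.Fract a b) = (c, d)" by fastforce
  have d: "d > 0" using quotient_of_denom_pos[OF cd] .
  have "Rat.Fract a b = Rat.Fract c d" using quotient_of_div[OF cd] by (simp add: Fract_of_int_quotient)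
  then have "a * d = c * b" using assms d by (simp add: eq_rat)
  then have "(of_int a * of_int d :: 'l) = of_int c * of_int b" by (metis of_int_mult)
  then show ?thesis
    using assms d by (simp add: rat_emb_def cd of_int_eq_0_char_0 frac_eq_eq)
qed

lemma rat_emb_add: "(rat_emb (r + s) :: 'l) = rat_emb r + rat_emb s"
  by (cases r; cases s) (simp add: rat_emb_Fract of_int_eq_0_char_0 add_frac_eq)

lemma rat_emb_mult: "(rat_emb (r * s) :: 'l) = rat_emb r * rat_emb s"
  by (cases r; cases s) (simp add: rat_emb_Fract)

lemma rat_emb_1: "(rat_emb 1 :: 'l) = 1"
  using rat_emb_Fract[of 1 1] by (simp add: One_rat_def)

lemma rat_emb_0: "(rat_emb 0 :: 'l) = 0"
  using rat_emb_Fract[of 1 0] by (simp add: Zero_rat_def)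

lemma rat_emb_of_nat: "(rat_emb (of_nat n) :: 'l) = of_nat n"
  by (induction n) (simp_all add: rat_emb_0 rat_emb_1 rat_emb_add)

text \<open>A substitute for complex conjugation: additivity will produce a derivation, and rational
  values have nonnegative squares.\<close>

lemma rational_functional:
  assumes "x \<noteq> (0::'l)"
  shows "\<exists>f :: 'l \<Rightarrow> rat. f x = 1 \<and> (\<forall>y z. f (y + z) = f y + f z) \<and> (\<forall>r y. f (rat_emb r * y) = r * f y)"
proof -
  interpret Q: vector_space "\<lambda>r (y::'l). rat_emb r * y"
    by unfold_locales (simp_all add: rat_emb_add rat_emb_mult rat_emb_1 algebra_simps)
  obtain f where "Vector_Spaces.linear (\<lambda>r (y::'l). rat_emb r * y) (*) f" "f x = 1"
    using Q.separating_functional[of "{0}" x] assms by (auto simp: Q.subspace_0)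
  then show ?thesis by (auto simp: Vector_Spaces.linear_iff)
qed

end

text \<open>An abstraction of the Lie algebra after extension of scalars. The derivation rule is
  confined to \<open>span B\<close>, which is the algebra proper inside an ambient function
  space.\<close>

locale derivation_on_span = endomorphism scale A
  for scale :: "'a::alg_closed_field \<Rightarrow> 'b::ab_group_add \<Rightarrow> 'b" (infixr "*s" 75) and A +
  fixes B :: "'b set" and mul :: "'b \<Rightarrow> 'b \<Rightarrow> 'b"
  assumes finite_B: "finite B" and independent_B: "independent B"
    and mul_add_left: "mul (u + v) w = mul u w + mul v w"
    and mul_add_right: "mul u (v + w) = mul u v + mul u w"
    and mul_scale_left: "mul (c *s u) v = c *s mul u v"
    and mul_scale_right: "mul u (c *s v) = c *s mul u v"
    and A_span: "A ` span B \<subseteq> span B"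
    and A_mul: "u \<in> span B \<Longrightarrow> v \<in> span B \<Longrightarrow> A (mul u v) = mul (A u) v + mul u (A v)"
begin

lemma mul_0: "mul 0 v = 0" "mul v 0 = 0"
  using mul_scale_left[of 0 0 v] mul_scale_right[of v 0 0] by simp_all

lemma pact_span: "v \<in> span B \<Longrightarrow> pact p v \<in> span B"
  by (rule pact_mem[OF subspace_span A_span])

text \<open>\<open>A - (c + d)\<close> acts on a product as \<open>A - c\<close> on the left factor
  plus \<open>A - d\<close> on the right one; each application lowers \<open>i + j\<close> by one,
  and a factor with exponent 0 is zero.\<close>

lemma mul_gen_eigenspace:
  assumes "u \<in> span B" "v \<in> span B" "u \<in> gen_eigenspace i c" "v \<in> gen_eigenspace j d"
  shows "mul u v \<in> gen_eigenspace (i + j) (c + d)"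
  using assms
proof (induction "i + j" arbitrary: i j u v)
  case 0
  then show ?case by (simp add: gen_eigenspace_def mul_0)
next
  case (Suc n)
  have shift: "pact [:- e, 1:] w \<in> span B" if "w \<in> span B" for e w
    using that by (rule pact_span)
  have eq: "pact [:- (c + d), 1:] (mul u v) = mul (pact [:- c, 1:] u) v + mul u (pact [:- d, 1:] v)"
  proof -
    have "mul (A u + (- c) *s u) v + mul u (A v + (- d) *s v) = mul (A u) v + mul u (A v) + (- (c + d)) *s mul u v"
      by (simp only: mul_add_left mul_add_right mul_scale_left mul_scale_right scale_left_distrib
          minus_add_distrib ac_simps)
    moreover have "pact [:r, 1:] w = A w + r *s w" for r w by (simp add: pact_pCons)
    ultimately show ?thesis using A_mul[OF Suc.prems(1,2)] by (simp only:)
  qed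
  have 1: "mul (pact [:- c, 1:] u) v \<in> gen_eigenspace n (c + d)"
  proof (cases i)
    case 0
    then have "u = 0" using Suc.prems by (simp add: gen_eigenspace_def)
    then show ?thesis
      using subspace_0[OF subspace_gen_eigenspace] A.zero by (simp add: pact_linear_factor mul_0)
  next
    case (Suc i')
    then have "pact [:- c, 1:] u \<in> gen_eigenspace i' c"
      using Suc.prems by (simp add: gen_eigenspace_def pact_mult[symmetric] mult.commute)
    then show ?thesis using Suc.hyps(1)[of i' j "pact [:- c, 1:] u" v] Suc.hyps(2) Suc.prems shift Suc by simp
  qed
  have 2: "mul u (pact [:- d, 1:] v) \<in> gen_eigenspace n (c + d)"
  proof (cases j)
    case 0
    then have "v = 0" using Suc.prems by (simp add: gen_eigenspace_def)
    then show ?thesis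
      using subspace_0[OF subspace_gen_eigenspace] A.zero by (simp add: pact_linear_factor mul_0)
  next
    case (Suc j')
    then have "pact [:- d, 1:] v \<in> gen_eigenspace j' d"
      using Suc.prems by (simp add: gen_eigenspace_def pact_mult[symmetric] mult.commute)
    then show ?thesis using Suc.hyps(1)[of i j' u "pact [:- d, 1:] v"] Suc.hyps(2) Suc.prems shift Suc by simp
  qed
  have "pact [:- (c + d), 1:] (mul u v) \<in> gen_eigenspace n (c + d)"
    unfolding eq using 1 2 by (intro subspace_add subspace_gen_eigenspace)
  then have "pact ([:- (c + d), 1:] ^ n * [:- (c + d), 1:]) (mul u v) = 0"
    by (simp only: gen_eigenspace_def pact_mult mem_Collect_eq)
  then show ?case
    unfolding gen_eigenspace_def mem_Collect_eq Suc.hyps(2)[symmetric] power_Suc2 .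
qed

text \<open>A nonzero eigenvalue \<open>c0\<close> yields a polynomial \<open>q\<close> acting as
  the scalar \<open>g c\<close> on each \<open>W c\<close>, hence as a derivation. The trace of
  \<open>A\<close> times it is the sum of \<open>g c * c\<close> weighted by dimensions, and its
  image under \<open>f\<close> is a positive sum of squares.\<close>

lemma nilpotent_if_traces_vanish:
  assumes char0: "CHAR('a) = 0"
    and tr: "\<And>q. (\<And>u v. u \<in> span B \<Longrightarrow> v \<in> span B \<Longrightarrow>
               pact q (mul u v) = mul (pact q u) v + mul u (pact q v)) \<Longrightarrow>
             trace_on B (\<lambda>v. A (pact q v)) = 0"
  shows "\<exists>n. \<forall>v\<in>span B. (A ^^ n) v = 0"
proof -
  obtain p where p: "p \<noteq> 0" "\<forall>v\<in>span B. pact p v = 0"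
    using annihilating_poly_uniform[OF finite_B A_span] by blast
  obtain M where M: "p = Polynomial.smult (lead_coeff p) (\<Prod>x\<in>#M. [:- x, 1:])"
    using alg_closed_imp_factorization[OF p(1)] by blast
  define L where "L = set_mset M"
  \<comment> \<open>The size of the multiset bounds every multiplicity, so one exponent serves all
    roots.\<close>
  define N where "N = size M"
  have finL: "finite L" by (simp add: L_def)
  have "(\<Prod>x\<in>#M. [:- x, 1:]) = (\<Prod>c\<in>L. [:- c, 1:] ^ count M c)"
    unfolding L_def by (rule image_prod_mset_multiplicity)
  moreover have "(\<Prod>c\<in>L. [:- c, 1:] ^ count M c) dvd (\<Prod>c\<in>L. [:- c, 1:] ^ N)"
    unfolding N_def by (intro prod_dvd_prod le_imp_power_dvd count_le_size)
  ultimately have "p dvd (\<Prod>c\<in>L. [:- c, 1:] ^ N)"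
    using M p(1) by (metis leading_coeff_0_iff smult_dvd_iff)
  then have kill: "pact (\<Prod>c\<in>L. [:- c, 1:] ^ N) v = 0" if "v \<in> span B" for v
    using p(2) that pact_dvd_zero by blast
  define W where "W c = span B \<inter> gen_eigenspace N c" for c
  have subW: "subspace (W c)" for c
    unfolding W_def by (intro subspace_inter subspace_span subspace_gen_eigenspace)
  have dec: "v \<in> span (\<Union>c\<in>L. W c)" if "v \<in> span B" for v
  proof -
    have "span B \<inter> (\<Union>c\<in>L. gen_eigenspace N c) = (\<Union>c\<in>L. W c)" by (auto simp: W_def)
    then show ?thesis
      using primary_decomposition[OF finL subspace_span A_span that kill[OF that]] by simp
  qed
  show ?thesis
  proof (cases "\<exists>c\<in>L. c \<noteq> 0 \<and> W c \<noteq> {0}")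
    case False
    \<comment> \<open>Only the eigenvalue 0 contributes to the decomposition, so its power of the
      linear factor, which is \<open>A ^^ N\<close>, kills everything.\<close>
    have "pact ([:- 0, 1:] ^ N) v = 0" if "v \<in> span (\<Union>c\<in>L. W c)" for v
      using that
    proof (induction rule: span_induct)
      case base
      show ?case using subspace_gen_eigenspace[of N 0] by (simp add: gen_eigenspace_def)
    next
      case (step v)
      then obtain c where c: "c \<in> L" "v \<in> W c" by auto
      show ?case
      proof (cases "c = 0")
        case True
        then show ?thesis using c by (simp add: W_def gen_eigenspace_def)
      next
        case c0: False
        then have "v = 0" using c False by auto
        then show ?thesis using subspace_0[OF subspace_gen_eigenspace[of N 0]] by (simp add: gen_eigenspace_def)
      qed
    qed
    moreover have "[:- 0, 1:] ^ N = Polynomial.monom (1::'a) N" by (simp add: monom_altdef)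
    ultimately show ?thesis using dec pact_funpow by metis
  next
    case True
    then obtain c0 where c0: "c0 \<in> L" "c0 \<noteq> 0" "W c0 \<noteq> {0}" by blast
    obtain f :: "'a \<Rightarrow> rat" where f: "f c0 = 1" "\<And>y z. f (y + z) = f y + f z"
      "\<And>r y. f (rat_emb r * y) = r * f y"
      using rational_functional[OF char0 c0(2)] by blast
    define g where "g c = (rat_emb (f c) :: 'a)" for c
    have g_add: "g (c + d) = g c + g d" for c d by (simp add: g_def f rat_emb_add[OF char0])
    \<comment> \<open>Products from \<open>W c\<close> and \<open>W d\<close> lie in the generalized
      eigenspace of \<open>c + d\<close> with exponent \<open>N + N\<close>, whether or not
      \<open>c + d\<close> is a root. Interpolating at these sums too, with doubled exponent, turns
      additivity of \<open>g\<close> into the derivation rule for \<open>pact q\<close>.\<close>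
    obtain q where q: "\<forall>c \<in> L \<union> (\<lambda>(c, d). c + d) ` (L \<times> L). [:- c, 1:] ^ (N + N) dvd q - [:g c:]"
      using linear_factors_interpolation[of "L \<union> (\<lambda>(c, d). c + d) ` (L \<times> L)" "N + N" g] finL by blast
    have qW: "pact q v = g c *s v" if "c \<in> L" "v \<in> W c" for c v
    proof (rule pact_on_gen_eigenspace)
      have "[:- c, 1:] ^ N dvd [:- c, 1:] ^ (N + N)" by (intro le_imp_power_dvd) simp
      then show "[:- c, 1:] ^ N dvd q - [:g c:]" using q that(1) dvd_trans by blast
    qed (use that in \<open>auto simp: W_def\<close>)
    have der0: "pact q (mul u v) = mul (pact q u) v + mul u (pact q v)"
      if "c \<in> L" "u \<in> W c" "d \<in> L" "v \<in> W d" for c d u v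
    proof -
      have "mul u v \<in> gen_eigenspace (N + N) (c + d)"
        using that by (intro mul_gen_eigenspace) (auto simp: W_def)
      moreover have "c + d \<in> L \<union> (\<lambda>(c, d). c + d) ` (L \<times> L)" using that by auto
      ultimately have "pact q (mul u v) = g (c + d) *s mul u v"
        using q by (intro pact_on_gen_eigenspace) blast+
      then show ?thesis
        using that by (simp add: qW g_add mul_scale_left mul_scale_right scale_left_distrib)
    qed
    interpret qq: Vector_Spaces.linear scale scale "pact q" by (rule linear_pact)
    note bil = mul_add_left mul_add_right mul_scale_left mul_scale_right mul_0
      qq.add qq.scale qq.zero scale_right_distrib
    have der1: "pact q (mul u v) = mul (pact q u) v + mul u (pact q v)"
      if "c \<in> L" "u \<in> W c" "v \<in> span (\<Union>c\<in>L. W c)" for c u v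
      using that(3)
    proof (induction rule: span_induct_alt)
      case (step r w v)
      then show ?case using der0[OF that(1,2)] by (auto simp: bil algebra_simps)
    qed (simp add: bil)
    have der2: "pact q (mul u v) = mul (pact q u) v + mul u (pact q v)"
      if "u \<in> span (\<Union>c\<in>L. W c)" "v \<in> span (\<Union>c\<in>L. W c)" for u v
      using that(1)
    proof (induction rule: span_induct_alt)
      case (step r w u)
      then show ?case using der1[OF _ _ that(2)] by (auto simp: bil algebra_simps)
    qed (simp add: bil)
    have tr0: "trace_on B (\<lambda>v. A (pact q v)) = 0"
      using der2 dec by (intro tr) blast
    \<comment> \<open>Remainder 1 at one root and 0 at the others makes \<open>pact (e c)\<close>
      the projection of \<open>span B\<close> onto \<open>W c\<close>.\<close>
    have "\<forall>c\<in>L. \<exists>e. \<forall>d\<in>L. [:- d, 1:] ^ N dvd e - [:if d = c then 1 else 0:]"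
    proof
      fix c
      show "\<exists>e. \<forall>d\<in>L. [:- d, 1:] ^ N dvd e - [:if d = c then 1 else 0:]"
        using linear_factors_interpolation[OF finL, of N "\<lambda>d. if d = c then 1 else 0"] by simp
    qed
    then obtain e where "\<forall>c\<in>L. \<forall>d\<in>L. [:- d, 1:] ^ N dvd e c - [:if d = c then 1 else 0:]"
      by metis
    then have eW: "pact (e c) v = (if d = c then v else 0)" if "c \<in> L" "d \<in> L" "v \<in> W d" for c d v
      using pact_on_gen_eigenspace[of d N "e c" "if d = c then 1 else 0" v] that by (auto simp: W_def)
    have "\<forall>c\<in>L. \<exists>m. trace_on B (pact (e c)) = of_nat m \<and> (W c \<noteq> {0} \<longrightarrow> m > 0)"
    proof
      fix c assume c: "c \<in> L"
      show "\<exists>m. trace_on B (pact (e c)) = of_nat m \<and> (W c \<noteq> {0} \<longrightarrow> m > 0)"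
      proof (rule trace_on_projection[OF finite_B independent_B linear_pact subW])
        show "W c \<subseteq> span B" by (auto simp: W_def)
        show "pact (e c) u = u" if "u \<in> W c" for u using eW[OF c c that] by simp
        interpret ec: Vector_Spaces.linear scale scale "pact (e c)" by (rule linear_pact)
        have "pact (e c) v \<in> W c" if "v \<in> span (\<Union>c\<in>L. W c)" for v
          using that
        proof (induction rule: span_induct_alt)
          case base
          then show ?case using subspace_0[OF subW] by (simp add: ec.zero)
        next
          case (step r w v)
          then have "pact (e c) w \<in> W c"
            using eW[OF c] subspace_0[OF subW] by (auto split: if_splits)
          then show ?case using step by (auto simp: ec.add ec.scale intro!: subspace_add[OF subW] subspace_scale[OF subW])
        qed
        then show "pact (e c) ` span B \<subseteq> W c" using dec by auto
      qed
    qed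
    then obtain m where m: "\<And>c. c \<in> L \<Longrightarrow> trace_on B (pact (e c)) = of_nat (m c)"
      "\<And>c. c \<in> L \<Longrightarrow> W c \<noteq> {0} \<Longrightarrow> m c > (0::nat)" by metis
    \<comment> \<open>The part of \<open>A q(A)\<close> left after its scalar action on each
      \<open>W c\<close> is subtracted. On \<open>W d\<close> it is \<open>g d\<close> times
      \<open>A - d\<close>, so it is nilpotent and has trace zero.\<close>
    define T where "T v = pact ([:0, 1:] * q - (\<Sum>c\<in>L. Polynomial.smult (g c * c) (e c))) v" for v
    have pact_sum: "pact (\<Sum>i\<in>I. h i) v = (\<Sum>i\<in>I. pact (h i) v)" for h v and I :: "'a set"
      by (induction I rule: infinite_finite_induct) (simp_all add: pact_add)
    have T_eq: "T v = A (pact q v) - (\<Sum>c\<in>L. (g c * c) *s pact (e c) v)" for v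
      by (simp only: T_def pact_diff pact_sum pact_smult pact_mult) (simp add: pact_pCons)
    have T_W: "T v = g d *s pact [:- d, 1:] v" if "d \<in> L" "v \<in> W d" for d v
    proof -
      have "(\<Sum>c\<in>L. (g c * c) *s pact (e c) v) = (\<Sum>c\<in>L. if c = d then (g d * d) *s v else 0)"
        using that by (intro sum.cong refl) (auto simp: eW[OF _ that])
      then show ?thesis
        using that finL by (simp add: T_eq qW pact_linear_factor scale_right_diff_distrib A.scale)
    qed
    have lin_T: "Vector_Spaces.linear scale scale T" unfolding T_def by (rule linear_pact)
    interpret T: Vector_Spaces.linear scale scale T by (rule lin_T)
    have T_pow_W: "(T ^^ k) v = (g d) ^ k *s pact ([:- d, 1:] ^ k) v" if "d \<in> L" "v \<in> W d" for k d v
    proof (induction k)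
      case (Suc k)
      have "pact ([:- d, 1:] ^ k) v \<in> W d"
      proof -
        have "pact ([:- d, 1:] ^ N) v = 0" using that by (simp add: W_def gen_eigenspace_def)
        then have "pact ([:- d, 1:] ^ N * [:- d, 1:] ^ k) v = 0" by (rule pact_dvd_zero[rotated]) simp
        then show ?thesis
          using that by (simp add: W_def gen_eigenspace_def pact_mult pact_span)
      qed
      then show ?case
        using Suc that by (simp add: T.scale T_W pact_mult[symmetric] del: pact_linear_factor)
    qed simp
    have "(T ^^ N) v = 0" if "v \<in> span (\<Union>c\<in>L. W c)" for v
    proof -
      interpret E: endomorphism scale T by (intro endomorphism.intro endomorphism_axioms.intro vector_space_axioms lin_T)
      interpret TN: Vector_Spaces.linear scale scale "T ^^ N" by (rule E.linear_funpow)
      show ?thesis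
        using that
      proof (induction rule: span_induct_alt)
        case (step r w v)
        then show ?case by (auto simp: TN.add TN.scale T_pow_W W_def gen_eigenspace_def)
      qed (rule TN.zero)
    qed
    then have "trace_on B T = 0"
      using dec pact_span by (intro trace_on_nilpotent[OF finite_B independent_B lin_T, of N])
        (auto simp: T_def)
    moreover have "trace_on B T = trace_on B (\<lambda>v. A (pact q v)) - (\<Sum>c\<in>L. (g c * c) * trace_on B (pact (e c)))"
    proof -
      have sp: "A (pact q b) \<in> span B" "pact (e c) b \<in> span B" if "b \<in> B" for b c
        using that A_span pact_span span_base by blast+
      have "representation B (T b) b =
          representation B (A (pact q b)) b - (\<Sum>c\<in>L. (g c * c) * representation B (pact (e c) b) b)"
        if "b \<in> B" for b
        using sp[OF that] independent_B
        by (simp add: T_eq representation_diff representation_sum representation_scale span_sum span_scale)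
      then show ?thesis
        by (simp add: trace_on_def sum_subtractf sum_distrib_left sum.swap[of _ L])
    qed
    ultimately have "(\<Sum>c\<in>L. (g c * c) * of_nat (m c)) = 0" using tr0 m(1) by simp
    \<comment> \<open>\<open>f\<close> is linear over the rationals and \<open>g c\<close> is the
      image of the rational \<open>f c\<close>, so each term becomes \<open>m c\<close> times the
      square of \<open>f c\<close>.\<close>
    then have "f (\<Sum>c\<in>L. rat_emb (of_nat (m c) * f c) * c) = f 0"
      by (simp add: rat_emb_mult[OF char0] rat_emb_of_nat[OF char0] g_def ac_simps)
    moreover have "f 0 = 0" using f(2)[of 0 0] by simp
    moreover have "f (\<Sum>c\<in>I. h c) = (\<Sum>c\<in>I. f (h c))" for h and I :: "'a set"
      by (induction I rule: infinite_finite_induct) (simp_all add: f \<open>f 0 = 0\<close>)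
    ultimately have "(\<Sum>c\<in>L. of_nat (m c) * f c * f c) = 0" by (simp add: f(3))
    then have "(\<Sum>c\<in>L. of_nat (m c) * (f c * f c)) = 0" by (simp only: mult.assoc)
    then have "of_nat (m c0) * (f c0 * f c0) = 0"
      using c0(1) finL by (subst (asm) sum_nonneg_eq_0_iff) auto
    then show ?thesis using m(2)[OF c0(1,3)] f(1) by simp
  qed
qed

end

section \<open>Extension of scalars\<close>

lemma sum_fun_apply: "(\<Sum>i\<in>I. f i) x = (\<Sum>i\<in>I. f i x)"
  by (induction I rule: infinite_finite_induct) auto

definition fun_scale :: "'l::field \<Rightarrow> ('x \<Rightarrow> 'l) \<Rightarrow> 'x \<Rightarrow> 'l" where
  "fun_scale c u = (\<lambda>x. c * u x)"

interpretation fun_space: vector_space "fun_scale :: 'l::field \<Rightarrow> ('x \<Rightarrow> 'l) \<Rightarrow> _"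
  by unfold_locales (auto simp: fun_scale_def algebra_simps)

context fd_lie_algebra
begin

text \<open>\<open>ext\<close> maps a vector to its coordinates, seen in the algebraic closure. The functions supported
  on the basis are the extension of scalars of the Lie algebra; \<open>ext_map\<close> and \<open>ext_br\<close> extend the
  linear maps and the bracket.\<close>

abbreviation bas :: "'a set" where "bas \<equiv> extend_basis {}"

definition ext :: "'a \<Rightarrow> 'a \<Rightarrow> 'k alg_closure" where
  "ext v = (\<lambda>b. to_ac (representation bas v b))"

definition ext_map :: "('a \<Rightarrow> 'a) \<Rightarrow> ('a \<Rightarrow> 'k alg_closure) \<Rightarrow> 'a \<Rightarrow> 'k alg_closure" where
  "ext_map T u = (\<Sum>b\<in>bas. fun_scale (u b) (ext (T b)))"

definition ext_br :: "('a \<Rightarrow> 'k alg_closure) \<Rightarrow> ('a \<Rightarrow> 'k alg_closure) \<Rightarrow> 'a \<Rightarrow> 'k alg_closure" where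
  "ext_br u v = (\<Sum>b\<in>bas. \<Sum>c\<in>bas. fun_scale (u b * v c) (ext (br b c)))"

lemma ext_add: "ext (u + v) = ext u + ext v"
  by (auto simp: ext_def representation_add basis_independent basis_span)

lemma ext_diff: "ext (u - v) = ext u - ext v"
  by (auto simp: ext_def representation_diff basis_independent basis_span)

lemma ext_scale: "ext (c *s u) = fun_scale (to_ac c) (ext u)"
  by (auto simp: ext_def fun_scale_def representation_scale basis_independent basis_span)

lemma ext_0: "ext 0 = 0"
  using ext_diff[of 0 0] by simp

lemma ext_sum: "ext (\<Sum>i\<in>I. f i) = (\<Sum>i\<in>I. ext (f i))"
  by (induction I rule: infinite_finite_induct) (auto simp: ext_0 ext_add)

lemma expand: "(\<Sum>b\<in>bas. representation bas v b *s b) = v"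
  by (rule sum_representation_eq) (auto simp: basis_independent basis_span finite_basis)

lemma ext_eq_0: "ext v = 0 \<Longrightarrow> v = 0"
  using expand[of v] by (simp add: ext_def fun_eq_iff)

lemma ext_basis: "b \<in> bas \<Longrightarrow> ext b = (\<lambda>x. if x = b then 1 else 0)"
  by (auto simp: ext_def representation_basis basis_independent)

lemma ext_map_ext:
  assumes "Vector_Spaces.linear scale scale T"
  shows "ext_map T (ext v) = ext (T v)"
proof -
  interpret T: Vector_Spaces.linear scale scale T by fact
  have "ext (T v) = ext (T (\<Sum>b\<in>bas. representation bas v b *s b))" by (simp only: expand)
  also have "\<dots> = ext_map T (ext v)"
    by (simp add: T.sum T.scale ext_sum ext_scale ext_map_def) (simp add: ext_def)
  finally show ?thesis ..
qed

lemma ext_br_ext: "ext_br (ext u) (ext v) = ext (br u v)"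
proof -
  have "ext (br u v) = ext (br (\<Sum>b\<in>bas. representation bas u b *s b) (\<Sum>b\<in>bas. representation bas v b *s b))"
    by (simp only: expand)
  also have "\<dots> = ext_br (ext u) (ext v)"
    unfolding br_sum_left br_sum_right br_scale_left br_scale_right ext_sum ext_scale ext_br_def
    by (simp add: fun_space.scale_sum_right) (subst sum.swap, simp add: ext_def mult.commute)
  finally show ?thesis ..
qed

lemma linear_ext_map: "Vector_Spaces.linear fun_scale fun_scale (ext_map T)"
proof unfold_locales
  fix u v c
  show "ext_map T (u + v) = ext_map T u + ext_map T v"
    by (simp add: ext_map_def fun_space.scale_left_distrib sum.distrib)
  show "ext_map T (fun_scale c u) = fun_scale c (ext_map T u)"
    by (simp add: ext_map_def fun_space.scale_sum_right fun_scale_def[of c u])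
qed

lemma ext_br_add_left: "ext_br (u + v) w = ext_br u w + ext_br v w"
  by (simp add: ext_br_def distrib_right fun_space.scale_left_distrib sum.distrib)

lemma ext_br_add_right: "ext_br u (v + w) = ext_br u v + ext_br u w"
  by (simp add: ext_br_def distrib_left fun_space.scale_left_distrib sum.distrib)

lemma ext_br_scale_left: "ext_br (fun_scale c u) v = fun_scale c (ext_br u v)"
  by (simp add: ext_br_def fun_space.scale_sum_right fun_scale_def[of c u] mult.assoc)

lemma ext_br_scale_right: "ext_br u (fun_scale c v) = fun_scale c (ext_br u v)"
  by (simp add: ext_br_def fun_space.scale_sum_right fun_scale_def[of c v] mult.left_commute)

lemma ext_br_zero: "ext_br 0 v = 0" "ext_br v 0 = 0"
  using ext_br_scale_left[of 0 0 v] ext_br_scale_right[of v 0 0] by simp_all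

lemma ext_in_span: "ext v \<in> fun_space.span (ext ` bas)"
proof -
  have "ext v = (\<Sum>b\<in>bas. fun_scale (to_ac (representation bas v b)) (ext b))"
    by (subst expand[of v, symmetric]) (simp only: ext_sum ext_scale)
  also have "\<dots> \<in> fun_space.span (ext ` bas)"
    by (intro fun_space.span_sum fun_space.span_scale fun_space.span_base imageI)
  finally show ?thesis .
qed

lemma inj_ext: "inj_on ext bas"
  using ext_eq_0 ext_diff by (auto simp: inj_on_def) (metis eq_iff_diff_eq_0)

lemma eval_comb:
  assumes "b \<in> bas"
  shows "(\<Sum>v\<in>ext ` bas. fun_scale (u v) v) b = u (ext b)"
proof -
  have "(\<Sum>v\<in>ext ` bas. fun_scale (u v) v) b = (\<Sum>c\<in>bas. if c = b then u (ext b) else 0)"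
    unfolding sum.reindex[OF inj_ext] sum_fun_apply
    by (intro sum.cong refl) (auto simp: fun_scale_def ext_basis)
  then show ?thesis using assms finite_basis by simp
qed

lemma independent_ext: "fun_space.independent (ext ` bas)"
proof -
  have "\<forall>v\<in>ext ` bas. u v = 0" if "(\<Sum>v\<in>ext ` bas. fun_scale (u v) v) = 0" for u
    using that eval_comb[of _ u] by auto
  then show ?thesis using fun_space.dependent_finite[of "ext ` bas"] finite_basis by blast
qed

text \<open>On the basis, \<open>ext b\<close> is an indicator function, so the coordinate of a
  vector along \<open>ext b\<close> is its value at \<open>b\<close>.\<close>

lemma trace_ext:
  assumes "\<And>v. v \<in> fun_space.span (ext ` bas) \<Longrightarrow> T v \<in> fun_space.span (ext ` bas)"
  shows "fun_space.trace_on (ext ` bas) T = (\<Sum>b\<in>bas. T (ext b) b)"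
proof -
  have "fun_space.representation (ext ` bas) v (ext b) = v b"
    if "b \<in> bas" "v \<in> fun_space.span (ext ` bas)" for b v
  proof -
    have "(\<Sum>w\<in>ext ` bas. fun_scale (fun_space.representation (ext ` bas) v w) w) = v"
      by (rule fun_space.sum_representation_eq) (use that independent_ext finite_basis in auto)
    then show ?thesis using eval_comb[OF that(1)] by metis
  qed
  then show ?thesis
    using assms ext_in_span by (simp add: fun_space.trace_on_def sum.reindex[OF inj_ext])
qed

lemma derivation_ext: "derivation_on_span fun_scale (ext_map (br x)) (ext ` bas) ext_br"
proof -
  interpret E: endomorphism fun_scale "ext_map (br x)"
    by (intro endomorphism.intro endomorphism_axioms.intro fun_space.vector_space_axioms linear_ext_map)
  let ?W = "fun_space.span (ext ` bas)"
  let ?A = "ext_map (br x)"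
  \<comment> \<open>For vectors coming from the Lie algebra this is the Jacobi identity; the two
    span inductions extend it one argument at a time.\<close>
  have base: "?A (ext_br (ext b) (ext c)) = ext_br (?A (ext b)) (ext c) + ext_br (ext b) (?A (ext c))" for b c
    by (simp add: ext_map_ext[OF linear_br] ext_br_ext leibniz[of x b c] ext_add)
  note bil = ext_br_add_left ext_br_add_right ext_br_scale_left ext_br_scale_right ext_br_zero
    E.A.add E.A.scale E.A.zero fun_space.scale_right_distrib
  have one: "?A (ext_br (ext b) v) = ext_br (?A (ext b)) v + ext_br (ext b) (?A v)" if "v \<in> ?W" for b v
    using that
  proof (induction rule: fun_space.span_induct_alt)
    case (step c w v)
    from step(1) obtain d where d: "w = ext d" by blast
    show ?case by (simp only: d bil base step(2) ac_simps)
  qed (simp only: bil add_0_left)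
  have "?A (ext_br u v) = ext_br (?A u) v + ext_br u (?A v)" if "u \<in> ?W" "v \<in> ?W" for u v
    using that(1)
  proof (induction rule: fun_space.span_induct_alt)
    case (step c w u)
    from step(1) obtain d where d: "w = ext d" by blast
    show ?case by (simp only: d bil one[OF \<open>v \<in> ?W\<close>] step(2) ac_simps)
  qed (simp only: bil add_0_left)
  moreover have "ext_map T u \<in> ?W" "ext_br u v \<in> ?W" for T u v
    unfolding ext_map_def ext_br_def
    by (intro fun_space.span_sum fun_space.span_scale ext_in_span)+
  ultimately show ?thesis
    using independent_ext finite_basis
    by unfold_locales (auto simp: bil)
qed

section \<open>Cartan's criterion\<close>

lemma linear_funpow_br: "Vector_Spaces.linear scale scale (br x ^^ i)"
proof -
  interpret endomorphism scale "br x"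
    by (intro endomorphism.intro endomorphism_axioms.intro vector_space_axioms linear_br)
  show ?thesis by (rule linear_funpow)
qed

text \<open>Cyclicity turns \<open>ad [u, v]\<close> into a commutator with \<open>ad v\<close>. The
  term with \<open>(br x ^^ i) v\<close> has trace zero by assumption; it is inserted so that the
  argument of \<open>br u\<close> is the defect of \<open>br x ^^ i\<close> from being a
  derivation.\<close>

lemma trace_commutator_funpow:
  assumes "killing_form u ((br x ^^ i) v) = 0"
  shows "trace_endo (\<lambda>w. br (br u v) ((br x ^^ i) w)) =
    - trace_endo (\<lambda>w. br u ((br x ^^ i) (br v w) - br ((br x ^^ i) v) w - br v ((br x ^^ i) w)))"
proof -
  let ?a = "br x ^^ i"
  interpret a: Vector_Spaces.linear scale scale ?a by (rule linear_funpow_br)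
  have "trace_endo (\<lambda>w. br v (br u (?a w))) = trace_endo (\<lambda>w. br u (?a (br v w)))"
    by (rule trace_endo_commute[OF linear_br])
      (unfold_locales, auto simp: a.add a.scale br_add_right br_scale_right)
  then show ?thesis
    using assms by (simp add: br_br_left br_diff_right trace_endo_diff killing_form_def)
qed

text \<open>Each power of \<open>ad x\<close> alone has a defect, but for a polynomial
  \<open>q\<close> with the derivation property the defects weighted by its coefficients cancel.
  Hence the trace of \<open>ad y\<close> times \<open>q(ad x)\<close> vanishes for \<open>y\<close>
  a bracket in \<open>S\<close>, and by linearity for \<open>y = x\<close>.\<close>

lemma ad_nilpotent_on_commutator:
  assumes char0: "CHAR('k) = 0" and h: "subalgebra h" and S: "S \<subseteq> h"
    and orth: "\<And>u y. u \<in> S \<Longrightarrow> y \<in> h \<Longrightarrow> killing_form u y = 0"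
    and x: "x \<in> commutator S S"
  shows "\<exists>n. \<forall>v. (br x ^^ n) v = 0"
proof -
  interpret E: derivation_on_span fun_scale "ext_map (br x)" "ext ` bas" ext_br
    by (rule derivation_ext)
  have "{br u v | u v. u \<in> S \<and> v \<in> S} \<subseteq> h" using h S by (auto simp: subalgebra_def)
  then have "x \<in> h"
    using x h span_minimal unfolding commutator_def subalgebra_def by blast
  have pow_ext: "(ext_map (br x) ^^ i) (ext v) = ext ((br x ^^ i) v)" for i v
    by (induction i) (simp_all add: ext_map_ext[OF linear_br])
  have pow_h: "(br x ^^ i) v \<in> h" if "v \<in> h" for i v
    using that h \<open>x \<in> h\<close> by (induction i) (auto simp: subalgebra_def)
  have pact_ext: "E.pact q (ext v) = (\<Sum>i\<le>Polynomial.degree q. fun_scale (coeff q i) (ext ((br x ^^ i) v)))" for q v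
    by (simp add: E.pact_def pow_ext)
  have "\<exists>n. \<forall>v\<in>fun_space.span (ext ` bas). (ext_map (br x) ^^ n) v = 0"
  proof (rule E.nilpotent_if_traces_vanish)
    show "CHAR('k alg_closure) = 0" using char0 by simp
    fix q :: "'k alg_closure poly"
    assume der: "E.pact q (ext_br u v) = ext_br (E.pact q u) v + ext_br u (E.pact q v)"
      if "u \<in> fun_space.span (ext ` bas)" "v \<in> fun_space.span (ext ` bas)" for u v
    \<comment> \<open>The second factor keeps \<open>x\<close> fixed while \<open>y\<close> varies;
      this makes \<open>Z\<close> linear in \<open>y\<close> and reduces \<open>Z x\<close> to
      brackets.\<close>
    define Z where "Z y = (\<Sum>b\<in>bas. ext_map (br y) (E.pact q (ext b)) b)" for y
    \<comment> \<open>Only the coefficients of \<open>q\<close> leave the ground field; the traces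
      do not. Orthogonality for the original Killing form therefore suffices.\<close>
    have Z_eq: "Z y = (\<Sum>i\<le>Polynomial.degree q. coeff q i * to_ac (trace_endo (\<lambda>w. br y ((br x ^^ i) w))))" for y
    proof -
      interpret y: Vector_Spaces.linear fun_scale fun_scale "ext_map (br y)" by (rule linear_ext_map)
      have "Z y = (\<Sum>b\<in>bas. \<Sum>i\<le>Polynomial.degree q. coeff q i * ext (br y ((br x ^^ i) b)) b)"
        by (simp add: Z_def pact_ext y.sum y.scale ext_map_ext[OF linear_br] sum_fun_apply)
          (simp add: fun_scale_def)
      also have "\<dots> = (\<Sum>i\<le>Polynomial.degree q. coeff q i * to_ac (trace_endo (\<lambda>w. br y ((br x ^^ i) w))))"
        by (subst sum.swap) (simp add: trace_endo_def to_ac_sum ext_def sum_distrib_left)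
      finally show ?thesis .
    qed
    have Z_br: "Z (br u v) = 0" if "u \<in> S" "v \<in> S" for u v
    proof -
      let ?d = "\<lambda>i w. (br x ^^ i) (br v w) - br ((br x ^^ i) v) w - br v ((br x ^^ i) w)"
      \<comment> \<open>The derivation rule for \<open>q(ad x)\<close>, applied to \<open>v\<close>
        and \<open>w\<close> and sorted by powers of \<open>ad x\<close>.\<close>
      have comb: "(\<Sum>i\<le>Polynomial.degree q. fun_scale (coeff q i) (ext (?d i w))) = 0" for w
      proof -
        have "(\<Sum>i\<le>Polynomial.degree q. fun_scale (coeff q i) (ext (?d i w))) =
          E.pact q (ext (br v w)) - (\<Sum>i\<le>Polynomial.degree q. fun_scale (coeff q i) (ext (br ((br x ^^ i) v) w)))
            - (\<Sum>i\<le>Polynomial.degree q. fun_scale (coeff q i) (ext (br v ((br x ^^ i) w))))"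
          by (simp add: pact_ext ext_diff fun_space.scale_right_diff_distrib sum_subtractf)
        also have "(\<Sum>i\<le>Polynomial.degree q. fun_scale (coeff q i) (ext (br ((br x ^^ i) v) w))) = ext_br (E.pact q (ext v)) (ext w)"
        proof -
          interpret L: Vector_Spaces.linear fun_scale fun_scale "\<lambda>u. ext_br u (ext w)"
            by unfold_locales (auto simp: ext_br_add_left ext_br_scale_left)
          show ?thesis by (simp add: pact_ext L.sum L.scale ext_br_ext)
        qed
        also have "(\<Sum>i\<le>Polynomial.degree q. fun_scale (coeff q i) (ext (br v ((br x ^^ i) w)))) = ext_br (ext v) (E.pact q (ext w))"
        proof -
          interpret R: Vector_Spaces.linear fun_scale fun_scale "\<lambda>u. ext_br (ext v) u"
            by unfold_locales (auto simp: ext_br_add_right ext_br_scale_right)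
          show ?thesis by (simp add: pact_ext R.sum R.scale ext_br_ext)
        qed
        finally show ?thesis using der[OF ext_in_span ext_in_span, of v w] by (simp add: ext_br_ext fun_eq_iff)
      qed
      have "Z (br u v) = (\<Sum>i\<le>Polynomial.degree q. coeff q i * to_ac (- trace_endo (\<lambda>w. br u (?d i w))))"
        using trace_commutator_funpow[OF orth] that S pow_h by (simp add: Z_eq subsetD)
      also have "\<dots> = - (\<Sum>i\<le>Polynomial.degree q. \<Sum>b\<in>bas. coeff q i * ext (br u (?d i b)) b)"
        by (simp add: trace_endo_def to_ac_sum ext_def sum_distrib_left sum_negf)
      also have "(\<Sum>i\<le>Polynomial.degree q. \<Sum>b\<in>bas. coeff q i * ext (br u (?d i b)) b) =
          (\<Sum>b\<in>bas. (\<Sum>i\<le>Polynomial.degree q. fun_scale (coeff q i) (ext (br u (?d i b)))) b)"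
        by (subst sum.swap) (simp add: sum_fun_apply fun_scale_def)
      also have "\<dots> = (\<Sum>b\<in>bas. ext_br (ext u) (\<Sum>i\<le>Polynomial.degree q. fun_scale (coeff q i) (ext (?d i b))) b)"
      proof -
        interpret R: Vector_Spaces.linear fun_scale fun_scale "\<lambda>w. ext_br (ext u) w"
          by unfold_locales (auto simp: ext_br_add_right ext_br_scale_right)
        show ?thesis by (simp only: R.sum R.scale ext_br_ext)
      qed
      also have "\<dots> = 0" by (simp only: comb ext_br_zero) simp
      finally show ?thesis by simp
    qed
    have Z_add: "Z (y + z) = Z y + Z z" and Z_scale: "Z (c *s y) = to_ac c * Z y" for y z c
      unfolding Z_eq
      by (simp_all add: br_add_left br_scale_left trace_endo_add trace_endo_scale sum.distrib
          distrib_left sum_distrib_left ac_simps)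
    have "Z x = 0"
      using x unfolding commutator_def
    proof (induction rule: span_induct_alt)
      case base
      show ?case using Z_scale[of 0 0] by simp
    next
      case (step c y z)
      then show ?case using Z_br by (auto simp: Z_add Z_scale)
    qed
    moreover have "fun_space.trace_on (ext ` bas) (\<lambda>v. ext_map (br x) (E.pact q v)) = Z x"
      unfolding Z_def using E.A_span E.pact_span by (subst trace_ext) blast+
    ultimately show "fun_space.trace_on (ext ` bas) (\<lambda>v. ext_map (br x) (E.pact q v)) = 0" by simp
  qed
  then obtain n where n: "\<forall>v\<in>fun_space.span (ext ` bas). (ext_map (br x) ^^ n) v = 0" by blast
  have "(br x ^^ n) v = 0" for v
    using n ext_in_span[of v] pow_ext[of n v] by (intro ext_eq_0) simp
  then show ?thesis by blast
qed

end

section \<open>Engel's theorem\<close>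

context lie_algebra
begin

text \<open>Simultaneous strict triangularity without a flag: every word of \<open>n\<close>
  operators \<open>br m\<close> annihilates the whole algebra.\<close>

definition nilpotent_action :: "nat \<Rightarrow> 'a set \<Rightarrow> bool" where
  "nilpotent_action n M \<longleftrightarrow> (\<forall>xs v. set xs \<subseteq> M \<longrightarrow> length xs = n \<longrightarrow> foldr br xs v = 0)"

text \<open>Extending a subalgebra by one ad-nilpotent element that normalizes it: the spans of the words
  beginning with a power of \<open>x\<close> followed by \<open>j\<close> letters of \<open>M\<close> form a filtration which \<open>x\<close>
  preserves and \<open>M\<close> lowers.\<close>

lemma nilpotent_action_insert:
  assumes M: "subalgebra M" and n: "nilpotent_action n M"
    and norm: "\<And>m. m \<in> M \<Longrightarrow> br m x \<in> M" and nil: "\<And>v. (br x ^^ N) v = 0"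
  shows "\<exists>k. nilpotent_action k {m + scale c x | m c. m \<in> M}"
proof -
  have subM: "subspace M" using M by (simp add: subalgebra_def)
  define G where "G j = {(br x ^^ i) (foldr br ms v) | i ms v. set ms \<subseteq> M \<and> length ms = j}" for j
  define T where "T j = span (G j)" for j
  have lin_mem: "br y t \<in> span U" if "t \<in> span V" "\<And>g. g \<in> V \<Longrightarrow> br y g \<in> span U" for y t U V
    using that(1)
  proof (induction rule: span_induct_alt)
    case (step c g t)
    then show ?case using that(2) by (auto simp: br_add_right br_scale_right intro: span_add span_scale)
  qed (simp add: span_zero)
  have x_T: "br x t \<in> T j" if "t \<in> T j" for t j
  proof -
    have "br x g \<in> span (G j)" if gG: "g \<in> G j" for g
    proof -
      obtain i ms v where g: "g = (br x ^^ i) (foldr br ms v)" "set ms \<subseteq> M" "length ms = j"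
        using gG by (auto simp: G_def)
      have "br x g = (br x ^^ Suc i) (foldr br ms v)" by (simp add: g)
      then have "br x g \<in> G j" unfolding G_def using g by blast
      then show ?thesis by (rule span_base)
    qed
    then show ?thesis using that lin_mem unfolding T_def by blast
  qed
  have m_pow: "br m ((br x ^^ i) (foldr br ms v)) \<in> T (Suc j)"
    if "m \<in> M" "set ms \<subseteq> M" "length ms = j" for m i ms v j
    using that(1)
  proof (induction i arbitrary: m)
    case 0
    have "br m (foldr br ms v) = (br x ^^ 0) (foldr br (m # ms) v)" by simp
    moreover have "set (m # ms) \<subseteq> M" "length (m # ms) = Suc j" using that 0 by auto
    ultimately have "br m (foldr br ms v) \<in> G (Suc j)" unfolding G_def by blast
    then show ?case by (simp add: T_def span_base)
  next
    case (Suc i)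
    have "br m (br x u) = br x (br m u) + br (br m x) u" for u
      by (simp add: leibniz[of m x u] add.commute)
    then have "br m ((br x ^^ Suc i) (foldr br ms v)) =
        br x (br m ((br x ^^ i) (foldr br ms v))) + br (br m x) ((br x ^^ i) (foldr br ms v))"
      by simp
    then show ?case
      using x_T[OF Suc.IH[OF Suc.prems]] Suc.IH[OF norm[OF Suc.prems]] by (simp add: T_def span_add)
  qed
  have m_T: "br m t \<in> T (Suc j)" if "m \<in> M" "t \<in> T j" for m t j
    using that(2) unfolding T_def
  proof (rule lin_mem)
    fix g assume "g \<in> G j"
    then show "br m g \<in> span (G (Suc j))"
      using m_pow[OF that(1)] unfolding G_def T_def by blast
  qed
  have T_mono: "T (Suc j) \<subseteq> T j" for j
  proof -
    have "G (Suc j) \<subseteq> G j"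
    proof
      fix g assume "g \<in> G (Suc j)"
      then obtain i ms v where g: "g = (br x ^^ i) (foldr br ms v)" "set ms \<subseteq> M" "length ms = Suc j"
        by (auto simp: G_def)
      then have "ms \<noteq> []" by auto
      then have "foldr br ms v = foldr br (butlast ms) (br (last ms) v)"
        by (metis append_butlast_last_id foldr.simps foldr_append id_apply comp_apply)
      then have "g = (br x ^^ i) (foldr br (butlast ms) (br (last ms) v))" using g by simp
      moreover have "set (butlast ms) \<subseteq> M" "length (butlast ms) = j"
        using g by (auto dest: in_set_butlastD)
      ultimately show "g \<in> G j" unfolding G_def by blast
    qed
    then show ?thesis unfolding T_def by (rule span_mono)
  qed
  let ?M' = "{m + scale c x | m c. m \<in> M}"
  \<comment> \<open>Modulo the next level the elements of \<open>M\<close> act as zero, so a word in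
    the enlarged algebra acts as a multiple of a power of \<open>x\<close>.\<close>
  have word: "\<exists>c. foldr br ys t - scale c ((br x ^^ length ys) t) \<in> T (Suc j)"
    if "set ys \<subseteq> ?M'" "t \<in> T j" for ys t j
    using that(1)
  proof (induction ys)
    case Nil
    show ?case by (intro exI[of _ 1]) (simp add: T_def span_zero)
  next
    case (Cons y ys)
    then obtain c where c: "foldr br ys t - scale c ((br x ^^ length ys) t) \<in> T (Suc j)" by auto
    obtain m d where md: "y = m + scale d x" "m \<in> M" using Cons.prems by auto
    define w where "w = (br x ^^ length ys) t"
    define s where "s = foldr br ys t - scale c w"
    have s: "s \<in> T (Suc j)" using c by (simp add: s_def w_def)
    have "(br x ^^ k) t \<in> T j" for k using that(2) by (induction k) (auto intro: x_T)
    then have w: "w \<in> T j" by (simp add: w_def)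
    have fold: "foldr br ys t = s + scale c w" by (simp add: s_def)
    have "foldr br (y # ys) t - scale (c * d) ((br x ^^ length (y # ys)) t) =
        br m s + scale c (br m w) + scale d (br x s)"
      by (simp add: fold md br_add_left br_add_right br_scale_left br_scale_right w_def[symmetric]
          scale_right_distrib mult.commute)
    moreover have "br m s \<in> T (Suc j)" using m_T[OF md(2) s] T_mono by blast
    moreover have "scale c (br m w) \<in> T (Suc j)"
      using m_T[OF md(2) w] unfolding T_def by (rule span_scale)
    moreover have "scale d (br x s) \<in> T (Suc j)"
      using x_T[OF s] unfolding T_def by (rule span_scale)
    ultimately have "foldr br (y # ys) t - scale (c * d) ((br x ^^ length (y # ys)) t) \<in> T (Suc j)"
      unfolding T_def by (simp only: span_add)
    then show ?case by blast
  qed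
  \<comment> \<open>Since \<open>br x ^^ N\<close> is zero, each block of \<open>N\<close> letters
    descends one level of the filtration; level \<open>n\<close> is zero.\<close>
  have desc: "foldr br ys v \<in> T j" if "set ys \<subseteq> ?M'" "length ys = j * N" for ys v j
    using that
  proof (induction j arbitrary: ys)
    case 0
    have "v = (br x ^^ 0) (foldr br [] v)" by simp
    then have "v \<in> G 0" unfolding G_def by (metis (mono_tags, lifting) empty_subsetI list.set(1) list.size(3) mem_Collect_eq)
    then show ?case using 0 by (simp add: T_def span_base)
  next
    case (Suc j)
    define us where "us = take N ys"
    define ws where "ws = drop N ys"
    have ys: "ys = us @ ws" by (simp add: us_def ws_def)
    have len: "length us = N" "length ws = j * N" using Suc.prems by (auto simp: us_def ws_def)
    have "set us \<subseteq> ?M'" "set ws \<subseteq> ?M'" using Suc.prems(1) by (simp_all add: ys)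
    then show ?case
      using word[of us "foldr br ws v" j] Suc.IH[of ws] len by (simp add: ys nil)
  qed
  have "G n \<subseteq> {0}"
  proof
    fix g assume "g \<in> G n"
    then obtain i ms v where g: "g = (br x ^^ i) (foldr br ms v)" "set ms \<subseteq> M" "length ms = n"
      by (auto simp: G_def)
    then have "foldr br ms v = 0" using n by (simp add: nilpotent_action_def)
    moreover have "(br x ^^ i) 0 = 0" by (induction i) auto
    ultimately show "g \<in> {0}" using g by simp
  qed
  then have "T n \<subseteq> {0}" unfolding T_def using span_mono[of "G n" "{0}"] span_insert_0[of "{}"] by auto
  then have "nilpotent_action (n * N) ?M'" using desc by (fastforce simp: nilpotent_action_def)
  then show ?thesis by blast
qed

end

context fd_lie_algebra
begin

text \<open>A nilpotently acting subalgebra \<open>M\<close> of greatest dimension must be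
  \<open>P\<close>: otherwise some element of \<open>P\<close> outside \<open>M\<close> normalizes
  \<open>M\<close> and can be adjoined.\<close>

lemma engel:
  assumes P: "subalgebra P" and nil: "\<And>x. x \<in> P \<Longrightarrow> \<exists>n. \<forall>v. (br x ^^ n) v = 0"
  shows "\<exists>n. nilpotent_action n P"
proof -
  define Q where "Q M \<longleftrightarrow> subalgebra M \<and> M \<subseteq> P \<and> (\<exists>n. nilpotent_action n M)" for M
  have subP: "subspace P" using P by (simp add: subalgebra_def)
  have "nilpotent_action 1 {0}"
    by (auto simp: nilpotent_action_def length_Suc_conv)
  moreover have "subalgebra {0}" by (simp add: subalgebra_def subspace_0)
  ultimately have "Q {0}" using subspace_0[OF subP] by (auto simp: Q_def)
  moreover have "\<forall>M. Q M \<longrightarrow> dim M \<le> dim P" by (auto simp: Q_def intro: dim_subset)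
  ultimately obtain M where M: "Q M" and max: "\<And>M'. Q M' \<Longrightarrow> dim M' \<le> dim M"
    using ex_has_greatest_nat[of Q "{0}" dim "dim P + 1"] by (metis less_Suc_eq_le Suc_eq_plus1)
  obtain n where n: "nilpotent_action n M" using M by (auto simp: Q_def)
  have Msub: "subalgebra M" "subspace M" "M \<subseteq> P" using M by (auto simp: Q_def subalgebra_def)
  have "M = P"
  proof (rule ccontr)
    assume "M \<noteq> P"
    \<comment> \<open>Words of length \<open>n\<close> carry \<open>P\<close> to 0, hence into
      \<open>M\<close>. One letter below the least length that carries \<open>P\<close> into
      \<open>M\<close>, some word yields an element outside \<open>M\<close> which every
      \<open>br m\<close> sends into \<open>M\<close>.\<close>
    define K where "K k \<longleftrightarrow> (\<forall>ms y. set ms \<subseteq> M \<longrightarrow> length ms = k \<longrightarrow> y \<in> P \<longrightarrow> foldr br ms y \<in> M)" for k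
    have "K n" using n subspace_0[OF Msub(2)] by (simp add: K_def nilpotent_action_def)
    define k where "k = (LEAST k. K k)"
    have k: "K k" "\<And>j. j < k \<Longrightarrow> \<not> K j"
      unfolding k_def using \<open>K n\<close> by (auto intro: LeastI dest: not_less_Least)
    have "\<not> K 0" using \<open>M \<noteq> P\<close> Msub(3) by (auto simp: K_def)
    then obtain k' where k': "k = Suc k'" using k(1) by (cases k) auto
    then obtain ms y where my: "set ms \<subseteq> M" "length ms = k'" "y \<in> P" "foldr br ms y \<notin> M"
      using k(2)[of k'] by (auto simp: K_def)
    define x where "x = foldr br ms y"
    have "x \<in> P"
      unfolding x_def using my(1,3) Msub(3) P by (induction ms) (auto simp: subalgebra_def)
    have norm: "br m x \<in> M" if "m \<in> M" for m
    proof -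
      have "foldr br (m # ms) y \<in> M"
        using k(1) my that unfolding K_def k' by (metis insert_subset length_Cons list.simps(15))
      then show ?thesis by (simp add: x_def)
    qed
    let ?M' = "{m + c *s x | m c. m \<in> M}"
    obtain N where N: "\<And>v. (br x ^^ N) v = 0" using nil[OF \<open>x \<in> P\<close>] by blast
    have "?M' = {a + b | a b. a \<in> M \<and> b \<in> span {x}}" by (auto simp: span_singleton)
    then have sub': "subspace ?M'" using subspace_sums[OF Msub(2) subspace_span] by simp
    have MM': "M \<subseteq> ?M'"
    proof
      fix m assume "m \<in> M"
      moreover have "m = m + 0 *s x" by simp
      ultimately show "m \<in> ?M'" by blast
    qed
    have "br a b \<in> M" if ab': "a \<in> ?M'" "b \<in> ?M'" for a b
    proof -
      obtain m c m' c' where ab: "a = m + c *s x" "b = m' + c' *s x" "m \<in> M" "m' \<in> M" using ab' by blast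
      have "br a b = br m m' + c' *s br m x + (- c) *s br m' x"
        by (simp add: ab br_add_left br_add_right br_scale_left br_scale_right br_self br_anti[of x m'])
      moreover have "br m m' \<in> M" using Msub(1) ab by (simp add: subalgebra_def)
      ultimately show ?thesis
        using norm ab Msub(2) by (simp only: subspace_add subspace_scale)
    qed
    then have "\<forall>a\<in>?M'. \<forall>b\<in>?M'. br a b \<in> ?M'" using MM' by blast
    then have "subalgebra ?M'" using sub' unfolding subalgebra_def by blast
    moreover have "?M' \<subseteq> P"
      using Msub(3) \<open>x \<in> P\<close> subP by (auto intro!: subspace_add subspace_scale)
    ultimately have "Q ?M'"
      using nilpotent_action_insert[OF Msub(1) n norm N] by (simp add: Q_def)
    then have "dim ?M' \<le> dim M" by (rule max)
    then have "M = ?M'" by (rule subspace_dim_equal[OF Msub(2) sub' MM'])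
    moreover have "x \<in> ?M'"
    proof -
      have "x = 0 + 1 *s x" by simp
      then show ?thesis using subspace_0[OF Msub(2)] by blast
    qed
    ultimately show False using my(4) by (simp add: x_def)
  qed
  then show ?thesis using n by blast
qed

end

section \<open>Solvable ideals\<close>

context lie_algebra
begin

lemma commutator_mono: "u \<subseteq> u' \<Longrightarrow> v \<subseteq> v' \<Longrightarrow> commutator u v \<subseteq> commutator u' v'"
  unfolding commutator_def by (rule span_mono) auto

lemma derived_series_mono: "u \<subseteq> v \<Longrightarrow> derived_series u n \<subseteq> derived_series v n"
  by (induction n) (simp_all add: commutator_mono)

lemma derived_series_add: "derived_series h (m + n) = derived_series (derived_series h n) m"
  by (induction m) auto

lemma commutator_subset: "subspace w \<Longrightarrow> (\<And>x y. x \<in> u \<Longrightarrow> y \<in> v \<Longrightarrow> br x y \<in> w) \<Longrightarrow> commutator u v \<subseteq> w"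
  unfolding commutator_def by (rule span_minimal) auto

lemma br_in_commutator: "x \<in> u \<Longrightarrow> y \<in> v \<Longrightarrow> br x y \<in> commutator u v"
  unfolding commutator_def by (rule span_base) auto

lemma subspace_commutator: "subspace (commutator u v)"
  by (simp add: commutator_def)

lemma zero_in_derived_series: "0 \<in> h \<Longrightarrow> 0 \<in> derived_series h n"
  by (cases n) (auto simp: commutator_def span_zero)

lemma solvableI: "0 \<in> h \<Longrightarrow> derived_series h n \<subseteq> {0} \<Longrightarrow> solvable h"
  using zero_in_derived_series unfolding solvable_def by blast

lemma derived_series_subset: "subalgebra h \<Longrightarrow> derived_series h n \<subseteq> h"
proof (induction n)
  case (Suc n)
  have "commutator (derived_series h n) (derived_series h n) \<subseteq> commutator h h"
    using Suc by (intro commutator_mono) auto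
  also have "\<dots> \<subseteq> h" using Suc.prems by (intro commutator_subset) (auto simp: subalgebra_def)
  finally show ?case by simp
qed simp

lemma ideal_subalgebra: "ideal_of i h \<Longrightarrow> subalgebra i"
  by (auto simp: ideal_of_def subalgebra_def)

lemma ideal_br_left:
  assumes "ideal_of i h" "x \<in> i" "y \<in> h"
  shows "br x y \<in> i"
proof -
  have "br y x \<in> i" "subspace i" using assms by (auto simp: ideal_of_def)
  then show ?thesis using br_anti[of x y] subspace_neg[of i "br y x"] by simp
qed

lemma ideal_sum:
  assumes i: "ideal_of i h" and j: "ideal_of j h" and h: "subspace h"
  shows "ideal_of {a + b | a b. a \<in> i \<and> b \<in> j} h"
proof -
  have "{a + b | a b. a \<in> i \<and> b \<in> j} \<subseteq> h"
    using i j h by (auto simp: ideal_of_def intro!: subspace_add)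
  moreover have "br x (a + b) \<in> {a + b | a b. a \<in> i \<and> b \<in> j}" if "x \<in> h" "a \<in> i" "b \<in> j" for x a b
  proof -
    have "br x (a + b) = br x a + br x b" "br x a \<in> i" "br x b \<in> j"
      using that i j by (auto simp: ideal_of_def br_add_right)
    then show ?thesis by blast
  qed
  moreover have "subspace {a + b | a b. a \<in> i \<and> b \<in> j}"
    using i j by (intro subspace_sums) (auto simp: ideal_of_def)
  ultimately show ?thesis by (auto simp: ideal_of_def)
qed

text \<open>In place of the quotient by \<open>j\<close>, the derived series of the sum is tracked
  modulo \<open>j\<close>: once the contribution of \<open>i\<close> is exhausted it lies in
  \<open>j\<close> and dies there.\<close>

lemma solvable_sum:
  assumes i: "ideal_of i h" "solvable i" and j: "ideal_of j h" "solvable j"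
  shows "solvable {a + b | a b. a \<in> i \<and> b \<in> j}"
proof -
  let ?s = "{a + b | a b. a \<in> i \<and> b \<in> j}"
  have sub: "subspace i" "subspace j" "i \<subseteq> h" "j \<subseteq> h" using i j by (auto simp: ideal_of_def)
  have 1: "derived_series ?s n \<subseteq> {a + b | a b. a \<in> derived_series i n \<and> b \<in> j}" for n
  proof (induction n)
    case (Suc n)
    let ?D = "derived_series i n"
    have D: "?D \<subseteq> i" using derived_series_subset[OF ideal_subalgebra[OF i(1)]] .
    have "commutator {a + b | a b. a \<in> ?D \<and> b \<in> j} {a + b | a b. a \<in> ?D \<and> b \<in> j} \<subseteq>
        {a + b | a b. a \<in> commutator ?D ?D \<and> b \<in> j}"
    proof (rule commutator_subset)
      show "subspace {a + b | a b. a \<in> commutator ?D ?D \<and> b \<in> j}"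
        by (intro subspace_sums subspace_commutator sub)
      fix x y assume "x \<in> {a + b | a b. a \<in> ?D \<and> b \<in> j}" "y \<in> {a + b | a b. a \<in> ?D \<and> b \<in> j}"
      then obtain a b c d where xy: "x = a + b" "y = c + d" "a \<in> ?D" "b \<in> j" "c \<in> ?D" "d \<in> j" by blast
      then have "a \<in> h" "c \<in> h" "b \<in> h" using D sub by auto
      then have "br b c + (br b d + br a d) \<in> j"
        using j(1) xy sub ideal_br_left[OF j(1)]
        by (intro subspace_add) (auto simp: ideal_of_def)
      moreover have "br a c \<in> commutator ?D ?D" using xy by (intro br_in_commutator)
      moreover have "br x y = br a c + (br b c + (br b d + br a d))"
        by (simp add: xy br_add_left br_add_right algebra_simps)
      ultimately show "br x y \<in> {a + b | a b. a \<in> commutator ?D ?D \<and> b \<in> j}" by blast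
    qed
    then show ?case using commutator_mono[OF Suc Suc] by simp
  qed simp
  obtain m n where mn: "derived_series i m = {0}" "derived_series j n = {0}"
    using i(2) j(2) by (auto simp: solvable_def)
  have "derived_series ?s m \<subseteq> j" using 1[of m] by (auto simp: mn)
  then have "derived_series ?s (n + m) \<subseteq> {0}"
    using derived_series_mono[of "derived_series ?s m" j n] by (simp add: derived_series_add mn)
  moreover have "0 \<in> ?s" using sub subspace_0 by force
  ultimately show ?thesis by (intro solvableI)
qed

text \<open>The \<open>k\<close>-th derived algebra of the commutator is spanned by words with
  \<open>k\<close> letters, so it is zero at \<open>n\<close>; passing from \<open>S\<close> to its
  commutator costs one more step.\<close>

lemma solvable_if_commutator_nilpotent_action:
  assumes S: "subalgebra S" and n: "nilpotent_action n (commutator S S)"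
  shows "solvable S"
proof -
  let ?C = "commutator S S"
  have C: "subalgebra ?C"
  proof -
    have "?C \<subseteq> S" using S by (intro commutator_subset) (auto simp: subalgebra_def)
    then show ?thesis
      using subspace_commutator by (auto simp: subalgebra_def intro!: br_in_commutator)
  qed
  have "derived_series ?C k \<subseteq> span {foldr br xs v | xs v. set xs \<subseteq> ?C \<and> length xs = k}" for k
  proof (induction k)
    case 0
    show ?case by (auto intro!: span_base exI[of _ "[]"])
  next
    case (Suc k)
    have D: "derived_series ?C k \<subseteq> ?C" using derived_series_subset[OF C] .
    show ?case
      unfolding derived_series.simps
    proof (rule commutator_subset[OF subspace_span])
      fix x y assume x: "x \<in> derived_series ?C k" and y: "y \<in> derived_series ?C k"
      have "y \<in> span {foldr br xs v | xs v. set xs \<subseteq> ?C \<and> length xs = k}" using y Suc by auto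
      then show "br x y \<in> span {foldr br xs v | xs v. set xs \<subseteq> ?C \<and> length xs = Suc k}"
      proof (induction rule: span_induct_alt)
        case base
        show ?case by (simp add: span_zero)
      next
        case (step c g z)
        then obtain xs v where g: "g = foldr br xs v" "set xs \<subseteq> ?C" "length xs = k" by blast
        then have "br x g = foldr br (x # xs) v" "set (x # xs) \<subseteq> ?C" "length (x # xs) = Suc k"
          using x D by auto
        then have "br x g \<in> span {foldr br xs v | xs v. set xs \<subseteq> ?C \<and> length xs = Suc k}"
          by (intro span_base) blast
        then show ?case using step by (simp add: br_add_right br_scale_right span_add span_scale)
      qed
    qed
  qed
  from this[of n] have "derived_series ?C n \<subseteq> span {0}"
    by (rule order_trans[OF _ span_mono]) (use n in \<open>auto simp: nilpotent_action_def\<close>)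
  then have "derived_series S (n + 1) \<subseteq> {0}"
    unfolding derived_series_add using span_insert_0[of "{}"] by simp
  moreover have "0 \<in> S" using S by (simp add: subalgebra_def subspace_0)
  ultimately show ?thesis by (rule solvableI[rotated])
qed

end

context fd_lie_algebra
begin

text \<open>A solvable ideal of greatest dimension absorbs every other one, because their sum is
  again a solvable ideal. This gives the \<open>GREATEST\<close> in the definition a value.\<close>

lemma radical_greatest:
  assumes h: "subspace h"
  shows "ideal_of (radical h) h" and "solvable (radical h)"
    and "\<And>i. ideal_of i h \<Longrightarrow> solvable i \<Longrightarrow> i \<subseteq> radical h"
proof -
  let ?P = "\<lambda>i. ideal_of i h \<and> solvable i"
  have "derived_series {0} 0 = {0}" by simp
  then have "solvable {0}" unfolding solvable_def by blast
  then have "?P {0}" using subspace_0[OF h] by (auto simp: ideal_of_def)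
  moreover have "\<forall>i. ?P i \<longrightarrow> dim i \<le> dim h" by (auto simp: ideal_of_def intro: dim_subset)
  ultimately obtain R where R: "?P R" and max: "\<And>i. ?P i \<Longrightarrow> dim i \<le> dim R"
    using ex_has_greatest_nat[of ?P "{0}" dim "dim h + 1"] by (metis less_Suc_eq_le Suc_eq_plus1)
  have great: "i \<subseteq> R" if i: "?P i" for i
  proof -
    let ?s = "{a + b | a b. a \<in> R \<and> b \<in> i}"
    have s: "?P ?s" using ideal_sum[OF _ _ h] solvable_sum R i by blast
    have sub: "subspace R" "subspace i" "subspace ?s" using R i s by (auto simp: ideal_of_def)
    have "x \<in> ?s" if "x \<in> R" for x
      using that subspace_0[OF sub(2)] add_0_right[of x] by (metis (mono_tags, lifting) mem_Collect_eq)
    then have "R = ?s" using max[OF s] by (intro subspace_dim_equal[OF sub(1,3)]) auto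
    moreover have "x \<in> ?s" if "x \<in> i" for x
      using that subspace_0[OF sub(1)] add_0_left[of x] by (metis (mono_tags, lifting) mem_Collect_eq)
    ultimately show ?thesis by auto
  qed
  have "radical h = R"
    unfolding radical_def using R great by (intro Greatest_equality) auto
  then show "ideal_of (radical h) h" "solvable (radical h)" "\<And>i. ideal_of i h \<Longrightarrow> solvable i \<Longrightarrow> i \<subseteq> radical h"
    using R great by auto
qed

lemma self_normalizing_central_radical:
  assumes h: "subalgebra h" and char0: "CHAR('k) = 0" and rad: "radical h \<subseteq> center"
  shows "self_normalizing (normalizer h)"
proof (rule self_normalizing_if_generated[OF h])
  have sub: "subspace h" and hh: "\<And>x y. x \<in> h \<Longrightarrow> y \<in> h \<Longrightarrow> br x y \<in> h"
    using h by (auto simp: subalgebra_def)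
  note R = radical_greatest[OF sub]
  note K = killing_form_add_left killing_form_add_right killing_form_scale_left killing_form_scale_right
  \<comment> \<open>The radical of the restricted form, an ideal of \<open>h\<close> by invariance.
    Cartan's criterion makes it solvable, so it lies in the radical of \<open>h\<close> and is
    central.\<close>
  define S where "S = {x\<in>h. \<forall>y\<in>h. killing_form x y = 0}"
  have K0: "killing_form 0 y = 0" for y using killing_form_scale_left[of 0 0 y] by simp
  have inv: "killing_form (br u v) w = - killing_form v (br u w)" for u v w
    using killing_form_invariant[of u v w] by (simp add: eq_neg_iff_add_eq_0)
  have S_ideal: "ideal_of S h"
    using sub hh by (auto simp: ideal_of_def S_def subspace_def K K0 inv)
  have S: "subalgebra S" using ideal_subalgebra[OF S_ideal] .
  have SS: "commutator S S \<subseteq> S" using S by (intro commutator_subset) (auto simp: subalgebra_def)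
  have "subalgebra (commutator S S)"
    using subspace_commutator SS by (auto simp: subalgebra_def intro!: br_in_commutator)
  then have "\<exists>n. nilpotent_action n (commutator S S)"
  proof (rule engel)
    fix x assume "x \<in> commutator S S"
    then show "\<exists>n. \<forall>v. (br x ^^ n) v = 0"
      by (rule ad_nilpotent_on_commutator[OF char0 h, rotated 2]) (auto simp: S_def)
  qed
  then have "solvable S" using solvable_if_commutator_nilpotent_action[OF S] by blast
  then have S_center: "S \<subseteq> radical h" "S \<subseteq> center" using R(3)[OF S_ideal] rad by auto
  let ?U = "span ({br x y | x y. x \<in> h \<and> y \<in> h} \<union> center)"
  show "h \<subseteq> ?U"
  proof (rule ccontr)
    assume "\<not> h \<subseteq> ?U"
    then obtain x where x: "x \<in> h" "x \<notin> ?U" by blast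
    obtain l where l: "Vector_Spaces.linear scale (*) l" "\<And>u. u \<in> ?U \<Longrightarrow> l u = 0" "l x = 1"
      using separating_functional[OF subspace_span x(2)] by blast
    obtain C where C: "C \<subseteq> h" "independent C" "h \<subseteq> span C"
      using maximal_independent_subset[of h] by auto
    have fin: "finite C" using C(2) by (rule finiteI_independent)
    have lin: "Vector_Spaces.linear scale (*) (killing_form c)" for c
      by unfold_locales (auto simp: K)
    have "\<exists>a. \<forall>z\<in>h. l z = (\<Sum>c\<in>C. a c * killing_form c z)"
    proof (rule functional_in_span_of_functionals[OF fin sub lin l(1)])
      fix z assume z: "z \<in> h" "\<And>c. c \<in> C \<Longrightarrow> killing_form c z = 0"
      have "killing_form z w = 0" if "w \<in> span C" for w
        using that
      proof (induction rule: span_induct_alt)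
        case base
        then show ?case using killing_form_scale_right[of z 0 0] by simp
      next
        case (step c u v)
        then show ?case using z(2)[of u] by (simp add: K killing_form_commute[of z u])
      qed
      then have "z \<in> S" using z C(3) by (auto simp: S_def)
      then show "l z = 0" using S_center by (intro l(2) span_base) auto
    qed
    then obtain a where a: "\<And>z. z \<in> h \<Longrightarrow> l z = (\<Sum>c\<in>C. a c * killing_form c z)" by blast
    \<comment> \<open>The vector that represents \<open>l\<close> on \<open>h\<close>. It exists
      because \<open>l\<close> vanishes on \<open>S\<close>, the only degeneracy of the form
      there.\<close>
    define y where "y = (\<Sum>c\<in>C. a c *s c)"
    have y: "y \<in> h" unfolding y_def using C(1) sub by (intro subspace_sum subspace_scale) auto
    have ly: "l z = killing_form y z" if "z \<in> h" for z
    proof -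
      interpret k: Vector_Spaces.linear scale "(*)" "\<lambda>c. killing_form c z"
        by unfold_locales (auto simp: K)
      show ?thesis using a[OF that] by (simp add: y_def k.sum k.scale)
    qed
    \<comment> \<open>By invariance, pairing \<open>br u y\<close> with \<open>v\<close> gives
      \<open>- l (br u v)\<close>, and \<open>l\<close> is zero on brackets.\<close>
    have brS: "br u y \<in> S" if u: "u \<in> h" for u
    proof -
      have "killing_form (br u y) v = 0" if v: "v \<in> h" for v
      proof -
        have "l (br u v) = 0" by (rule l(2)) (use u v in \<open>auto intro!: span_base\<close>)
        then show ?thesis using ly[OF hh[OF u v]] inv[of u y v] by simp
      qed
      then show ?thesis using hh[OF u y] by (simp add: S_def)
    qed
    \<comment> \<open>An ideal because \<open>[h, y]\<close> lies in \<open>S\<close>, and abelian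
      because the radical is central and \<open>y\<close> commutes with itself. Maximality of the
      radical makes \<open>y\<close> central, which contradicts \<open>l x = 1\<close>.\<close>
    let ?J = "{r + b | r b. r \<in> radical h \<and> b \<in> span {y}}"
    have subR: "subspace (radical h)" and Rh: "radical h \<subseteq> h" using R(1) by (auto simp: ideal_of_def)
    have subJ: "subspace ?J" by (intro subspace_sums subR subspace_span)
    have J_form: "\<exists>r c. z = r + c *s y \<and> r \<in> radical h" if "z \<in> ?J" for z
      using that by (auto simp: span_singleton)
    have ce: "br r z = 0" "br z r = 0" if "r \<in> radical h" for r z
      using rad that br_anti[of z r] by (auto simp: center_def)
    have RJ: "radical h \<subseteq> ?J"
    proof
      fix r assume "r \<in> radical h"
      moreover have "r = r + 0" by simp
      ultimately show "r \<in> ?J" using span_zero[of "{y}"] by blast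
    qed
    have "ideal_of ?J h"
      unfolding ideal_of_def
    proof (intro conjI subJ ballI)
      show "?J \<subseteq> h" using Rh y sub by (auto simp: span_singleton intro!: subspace_add subspace_scale)
      fix u z assume u: "u \<in> h" and "z \<in> ?J"
      then obtain r c where z: "z = r + c *s y" "r \<in> radical h" using J_form by blast
      have "br u z = c *s br u y" using ce[OF z(2)] by (simp add: z br_add_right br_scale_right)
      then have "br u z \<in> radical h" using brS[OF u] S_center subR by (auto intro: subspace_scale)
      then show "br u z \<in> ?J" using RJ by blast
    qed
    moreover have "solvable ?J"
    proof (rule solvableI)
      show "0 \<in> ?J" using subJ by (rule subspace_0)
      have "br z w = 0" if zw: "z \<in> ?J" "w \<in> ?J" for z w
      proof -
        obtain r c where z: "z = r + c *s y" "r \<in> radical h" using J_form[OF zw(1)] by blast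
        obtain r' c' where w: "w = r' + c' *s y" "r' \<in> radical h" using J_form[OF zw(2)] by blast
        show ?thesis
          by (simp add: z w ce br_add_left br_add_right br_scale_left br_scale_right br_self)
      qed
      then have "commutator ?J ?J \<subseteq> {0}" by (intro commutator_subset) (auto simp: subspace_def)
      then show "derived_series ?J 1 \<subseteq> {0}" by simp
    qed
    ultimately have "?J \<subseteq> radical h" by (rule R(3))
    moreover have "y \<in> ?J"
    proof -
      have "y = 0 + y" by simp
      then show ?thesis using subspace_0[OF subR] span_base[of y "{y}"] by blast
    qed
    ultimately have "br y v = 0" for v using ce by blast
    then have "killing_form y x = 0"
      by (simp add: killing_form_def) (simp add: trace_endo_def representation_zero)
    then show False using ly[OF x(1)] l(3) by simp
  qed
qed

end

section \<open>Calculus of smooth functions\<close>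

abbreviation fder :: "('a::real_normed_vector \<Rightarrow> 'b::real_normed_vector) \<Rightarrow> 'a \<Rightarrow> 'a \<Rightarrow> 'b" where
  "fder f x \<equiv> frechet_derivative f (at x)"

lemma Ck_on_subset: "Ck_on k s f \<Longrightarrow> t \<subseteq> s \<Longrightarrow> Ck_on k t f"
  by (induction k arbitrary: f) (auto intro: continuous_on_subset)

lemma Ck_on_Suc_imp: "Ck_on (Suc k) s f \<Longrightarrow> Ck_on k s f"
proof (induction k arbitrary: f)
  case 0
  then show ?case
    by (auto intro!: continuous_at_imp_continuous_on differentiable_imp_continuous_within)
next
  case (Suc k)
  then show ?case by (metis Ck_on.simps(2))
qed

lemma Ck_on_le: "Ck_on n s f \<Longrightarrow> k \<le> n \<Longrightarrow> Ck_on k s f"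
  by (induction n) (auto simp: le_Suc_eq dest: Ck_on_Suc_imp simp del: Ck_on.simps)

lemma frechet_derivative_cong_open:
  assumes "open s" "x \<in> s" "\<And>y. y \<in> s \<Longrightarrow> f y = g y"
  shows "fder f x = fder g x"
    and "f differentiable at x \<longleftrightarrow> g differentiable at x"
proof -
  have *: "(f has_derivative D) (at x) \<longleftrightarrow> (g has_derivative D) (at x)" for D
    using assms has_derivative_transform_within_open[of f D x UNIV s g]
      has_derivative_transform_within_open[of g D x UNIV s f] by auto
  then show "fder f x = fder g x"
    by (simp add: frechet_derivative_def)
  show "f differentiable at x \<longleftrightarrow> g differentiable at x"
    using * by (simp add: differentiable_def)
qed

lemma Ck_on_cong:
  assumes "open s" "\<And>x. x \<in> s \<Longrightarrow> f x = g x" "Ck_on k s f"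
  shows "Ck_on k s g"
  using assms(2,3)
proof (induction k arbitrary: f g)
  case 0
  then show ?case by (simp cong: continuous_on_cong)
next
  case (Suc k)
  have d: "fder f x = fder g x"
    "f differentiable at x \<longleftrightarrow> g differentiable at x" if "x \<in> s" for x
    using frechet_derivative_cong_open[OF assms(1) that Suc.prems(1)] by auto
  have "Ck_on k s (\<lambda>x. fder g x v)" for v
    by (rule Suc.IH[of "\<lambda>x. fder f x v"]) (use Suc.prems d in auto)
  then show ?case using Suc.prems d by auto
qed

lemma Ck_on_local:
  assumes "\<And>x. x \<in> s \<Longrightarrow> \<exists>t. open t \<and> x \<in> t \<and> Ck_on k t f"
  shows "Ck_on k s f"
  using assms
proof (induction k arbitrary: f)
  case 0
  have "isCont f x" if x: "x \<in> s" for x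
  proof -
    obtain t where "open t" "x \<in> t" "continuous_on t f" using 0[OF x] by auto
    then show ?thesis using continuous_on_eq_continuous_at by blast
  qed
  then show ?case by (simp add: continuous_at_imp_continuous_on)
next
  case (Suc k)
  have "f differentiable at x" if "x \<in> s" for x using Suc.prems[OF that] by auto
  moreover have "Ck_on k s (\<lambda>x. fder f x v)" for v
  proof (rule Suc.IH)
    fix x assume "x \<in> s"
    then obtain t where "open t" "x \<in> t" "Ck_on (Suc k) t f" using Suc.prems by blast
    then show "\<exists>t. open t \<and> x \<in> t \<and> Ck_on k t (\<lambda>x. fder f x v)" by auto
  qed
  ultimately show ?case by simp
qed

lemma Ck_on_const: "Ck_on k s (\<lambda>x. c)"
  by (induction k arbitrary: c) (auto simp: frechet_derivative_const)

lemma frechet_derivative_eqI: "(f has_derivative D) (at x) \<Longrightarrow> fder f x = D"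
  by (metis frechet_derivative_at)

lemma has_frechet_derivative: "f differentiable at x \<Longrightarrow> (f has_derivative fder f x) (at x)"
  by (simp add: frechet_derivative_works)

text \<open>By uniqueness of derivatives an explicit formula may replace
  \<open>frechet_derivative\<close>, but only on an open set, where the lower orders can be
  transferred.\<close>

lemma Ck_on_SucI:
  assumes "\<And>x. x \<in> s \<Longrightarrow> (f has_derivative D x) (at x)" "open s" "\<And>v. Ck_on k s (\<lambda>x. D x v)"
  shows "Ck_on (Suc k) s f"
proof -
  have "Ck_on k s (\<lambda>x. fder f x v)" for v
    by (rule Ck_on_cong[OF assms(2) _ assms(3)[of v]]) (use assms(1) frechet_derivative_eqI in metis)
  then show ?thesis using assms(1) by (auto simp: differentiable_def)
qed

lemma Ck_on_bounded_linear: "bounded_linear L \<Longrightarrow> open s \<Longrightarrow> Ck_on k s L"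
proof (cases k)
  case 0
  then show "bounded_linear L \<Longrightarrow> ?thesis" by (simp add: linear_continuous_on)
next
  case (Suc n)
  assume "bounded_linear L" "open s"
  then show ?thesis unfolding Suc
    by (intro Ck_on_SucI[where D="\<lambda>x. L"]) (auto intro: bounded_linear_imp_has_derivative Ck_on_const)
qed

lemma Ck_on_linear_compose:
  assumes "bounded_linear L" "open s" "Ck_on k s f"
  shows "Ck_on k s (\<lambda>x. L (f x))"
  using assms(3)
proof (induction k arbitrary: f)
  case 0
  then show ?case using assms(1) by (simp add: bounded_linear.continuous_on)
next
  case (Suc k)
  have "((\<lambda>x. L (f x)) has_derivative (\<lambda>v. L (fder f x v))) (at x)" if "x \<in> s" for x
    using Suc.prems that by (intro bounded_linear.has_derivative[OF assms(1)] has_frechet_derivative) auto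
  moreover have "Ck_on k s (\<lambda>x. L (fder f x v))" for v
    using Suc.prems by (intro Suc.IH) auto
  ultimately show ?case by (rule Ck_on_SucI[OF _ assms(2)])
qed

lemma Ck_on_add:
  assumes "open s" "Ck_on k s f" "Ck_on k s g"
  shows "Ck_on k s (\<lambda>x. f x + g x)"
  using assms(2,3)
proof (induction k arbitrary: f g)
  case 0
  then show ?case by (simp add: continuous_on_add)
next
  case (Suc k)
  have "((\<lambda>x. f x + g x) has_derivative
      (\<lambda>v. fder f x v + fder g x v)) (at x)" if "x \<in> s" for x
    using Suc.prems that by (intro has_derivative_add has_frechet_derivative) auto
  moreover have "Ck_on k s (\<lambda>x. fder f x v + fder g x v)" for v
    using Suc.prems by (intro Suc.IH) auto
  ultimately show ?case by (rule Ck_on_SucI[OF _ assms(1)])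
qed

lemma Ck_on_sum: "open s \<Longrightarrow> (\<And>i. i \<in> I \<Longrightarrow> Ck_on k s (f i)) \<Longrightarrow> Ck_on k s (\<lambda>x. \<Sum>i\<in>I. f i x)"
  by (induction I rule: infinite_finite_induct) (auto intro: Ck_on_const Ck_on_add)

lemma Ck_on_scaleR:
  assumes "open s" "Ck_on k s f" "Ck_on k s g"
  shows "Ck_on k s (\<lambda>x. f x *\<^sub>R g x)"
  using assms(2,3)
proof (induction k arbitrary: f g)
  case 0
  then show ?case by (simp add: continuous_on_scaleR)
next
  case (Suc k)
  have "((\<lambda>x. f x *\<^sub>R g x) has_derivative
      (\<lambda>v. f x *\<^sub>R fder g x v + fder f x v *\<^sub>R g x)) (at x)"
    if "x \<in> s" for x
    using Suc.prems that by (intro has_derivative_scaleR has_frechet_derivative) auto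
  then have der: "\<And>x. x \<in> s \<Longrightarrow> ((\<lambda>x. f x *\<^sub>R g x) has_derivative
      (\<lambda>v. f x *\<^sub>R fder g x v + fder f x v *\<^sub>R g x)) (at x)" .
  have "Ck_on k s f" "Ck_on k s g" using Suc.prems by (blast dest: Ck_on_Suc_imp)+
  then have sm: "Ck_on k s (\<lambda>x. f x *\<^sub>R fder g x v + fder f x v *\<^sub>R g x)" for v
    using Suc.prems by (intro Ck_on_add assms(1) Suc.IH) auto
  show ?case by (rule Ck_on_SucI[OF der assms(1) sm])
qed

lemma Ck_on_mult:
  fixes f g :: "'a::real_normed_vector \<Rightarrow> real"
  shows "open s \<Longrightarrow> Ck_on k s f \<Longrightarrow> Ck_on k s g \<Longrightarrow> Ck_on k s (\<lambda>x. f x * g x)"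
  using Ck_on_scaleR[of s k f g] by simp

text \<open>\<open>Ck_on\<close> controls derivatives in fixed directions, whereas the chain rule
  differentiates \<open>f\<close> in a direction that moves with \<open>x\<close>. Expanding that
  direction in a basis of the finite-dimensional middle space resolves this.\<close>

lemma Ck_on_compose:
  fixes g :: "'a::real_normed_vector \<Rightarrow> 'b::euclidean_space"
  assumes "open s" "open t" "g ` s \<subseteq> t" "Ck_on k s g" "Ck_on k t f"
  shows "Ck_on k s (\<lambda>x. f (g x))"
  using assms(4,5)
proof (induction k arbitrary: f)
  case 0
  then show ?case using assms(3) by (auto intro: continuous_on_compose2)
next
  case (Suc k)
  let ?F = "\<lambda>x. fder f x" and ?G = "\<lambda>x. fder g x"
  have "((\<lambda>x. f (g x)) has_derivative (\<lambda>v. \<Sum>i\<in>Basis. (?G x v \<bullet> i) *\<^sub>R ?F (g x) i)) (at x)"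
    if "x \<in> s" for x
  proof -
    have f: "(f has_derivative ?F (g x)) (at (g x))" and g: "(g has_derivative ?G x) (at x)"
      using Suc.prems that assms(3) by (auto intro!: has_frechet_derivative)
    interpret F: linear "?F (g x)" using f by (rule has_derivative_linear)
    have rep: "?F (g x) w = (\<Sum>i\<in>Basis. (w \<bullet> i) *\<^sub>R ?F (g x) i)" for w
    proof -
      have "?F (g x) w = ?F (g x) (\<Sum>i\<in>Basis. (w \<bullet> i) *\<^sub>R i)" by (simp only: euclidean_representation)
      also have "\<dots> = (\<Sum>i\<in>Basis. (w \<bullet> i) *\<^sub>R ?F (g x) i)" by (simp only: F.sum F.scaleR)
      finally show ?thesis .
    qed
    show ?thesis unfolding rep[symmetric] by (rule has_derivative_compose[OF g f])
  qed
  moreover have "Ck_on k s (\<lambda>x. \<Sum>i\<in>Basis. (?G x v \<bullet> i) *\<^sub>R ?F (g x) i)" for v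
  proof (rule Ck_on_sum[OF assms(1)], rule Ck_on_scaleR[OF assms(1)])
    fix i :: 'b
    show "Ck_on k s (\<lambda>x. ?G x v \<bullet> i)"
      using Suc.prems by (intro Ck_on_linear_compose[OF bounded_linear_inner_left] assms(1)) auto
    have "Ck_on k s g" using Suc.prems by (blast dest: Ck_on_Suc_imp)
    then show "Ck_on k s (\<lambda>x. ?F (g x) i)"
      using Suc.prems by (intro Suc.IH) auto
  qed
  ultimately show ?case by (rule Ck_on_SucI[OF _ assms(1)])
qed

lemma Ck_on_Pair:
  assumes "open s" "Ck_on k s f" "Ck_on k s g"
  shows "Ck_on k s (\<lambda>x. (f x, g x))"
  using assms(2,3)
proof (induction k arbitrary: f g)
  case 0
  then show ?case by (simp add: continuous_on_Pair)
next
  case (Suc k)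
  have "((\<lambda>x. (f x, g x)) has_derivative
      (\<lambda>v. (fder f x v, fder g x v))) (at x)" if "x \<in> s" for x
    using Suc.prems that by (intro has_derivative_Pair has_frechet_derivative) auto
  moreover have "Ck_on k s (\<lambda>x. (fder f x v, fder g x v))" for v
    using Suc.prems by (intro Suc.IH) auto
  ultimately show ?case by (rule Ck_on_SucI[OF _ assms(1)])
qed

lemma smooth_on_subset: "smooth_on s f \<Longrightarrow> t \<subseteq> s \<Longrightarrow> smooth_on t f"
  by (auto simp: smooth_on_def intro: Ck_on_subset)

lemma smooth_on_cong: "open s \<Longrightarrow> (\<And>x. x \<in> s \<Longrightarrow> f x = g x) \<Longrightarrow> smooth_on s f \<Longrightarrow> smooth_on s g"
  unfolding smooth_on_def by (blast intro: Ck_on_cong)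

lemma smooth_on_local:
  assumes "\<And>x. x \<in> s \<Longrightarrow> \<exists>t. open t \<and> x \<in> t \<and> smooth_on t f"
  shows "smooth_on s f"
  unfolding smooth_on_def
proof (intro allI Ck_on_local)
  fix k x assume "x \<in> s"
  then show "\<exists>t. open t \<and> x \<in> t \<and> Ck_on k t f" using assms by (auto simp: smooth_on_def)
qed

lemma smooth_on_const: "smooth_on s (\<lambda>x. c)"
  by (auto simp: smooth_on_def intro: Ck_on_const)

lemma smooth_on_bounded_linear: "bounded_linear L \<Longrightarrow> open s \<Longrightarrow> smooth_on s L"
  by (auto simp: smooth_on_def intro: Ck_on_bounded_linear)

lemma smooth_on_add: "open s \<Longrightarrow> smooth_on s f \<Longrightarrow> smooth_on s g \<Longrightarrow> smooth_on s (\<lambda>x. f x + g x)"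
  by (auto simp: smooth_on_def intro: Ck_on_add)

lemma smooth_on_mult:
  fixes f g :: "'a::real_normed_vector \<Rightarrow> real"
  shows "open s \<Longrightarrow> smooth_on s f \<Longrightarrow> smooth_on s g \<Longrightarrow> smooth_on s (\<lambda>x. f x * g x)"
  by (auto simp: smooth_on_def intro: Ck_on_mult)

lemma smooth_on_compose:
  fixes g :: "'a::real_normed_vector \<Rightarrow> 'b::euclidean_space"
  shows "open s \<Longrightarrow> open t \<Longrightarrow> g ` s \<subseteq> t \<Longrightarrow> smooth_on s g \<Longrightarrow> smooth_on t f \<Longrightarrow> smooth_on s (\<lambda>x. f (g x))"
  by (auto simp: smooth_on_def intro: Ck_on_compose)

lemma smooth_on_Pair: "open s \<Longrightarrow> smooth_on s f \<Longrightarrow> smooth_on s g \<Longrightarrow> smooth_on s (\<lambda>x. (f x, g x))"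
  by (auto simp: smooth_on_def intro: Ck_on_Pair)

lemma smooth_on_deriv: "smooth_on s f \<Longrightarrow> smooth_on s (\<lambda>x. fder f x v)"
  unfolding smooth_on_def by (metis Ck_on.simps(2))

lemma smooth_on_has_derivative:
  "smooth_on s f \<Longrightarrow> x \<in> s \<Longrightarrow> (f has_derivative fder f x) (at x)"
  unfolding smooth_on_def by (metis Ck_on.simps(2) has_frechet_derivative)

lemma smooth_on_continuous: "smooth_on s f \<Longrightarrow> continuous_on s f"
  unfolding smooth_on_def by (metis Ck_on.simps(1))

subsection \<open>A bump function\<close>

text \<open>A family closed under differentiation: with \<open>u = 1 / x\<close>, the derivative of
  \<open>p(u) exp(-u)\<close> is \<open>u^2 (p(u) - p'(u)) exp(-u)\<close>. Smoothness is proved for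
  all \<open>p\<close> at once.\<close>

definition bump :: "real poly \<Rightarrow> real \<Rightarrow> real" where
  "bump p x = (if x > 0 then poly p (1 / x) * exp (- (1 / x)) else 0)"

lemma poly_exp_tendsto_0: "((\<lambda>u. poly p u * exp (- u)) \<longlongrightarrow> (0::real)) at_top"
proof -
  have "((\<lambda>u. \<Sum>i\<le>degree p. coeff p i * (u ^ i / exp u)) \<longlongrightarrow> (\<Sum>i\<le>degree p. coeff p i * 0)) at_top"
    by (intro tendsto_sum tendsto_mult tendsto_const tendsto_power_div_exp_0)
  then show ?thesis by (simp add: poly_altdef exp_minus divide_inverse sum_distrib_right mult.assoc)
qed

lemma bump_has_derivative:
  "(bump p has_real_derivative bump (monom 1 2 * (p - pderiv p)) x) (at x)"
proof -
  consider "x > 0" | "x < 0" | "x = 0" by linarith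
  then show ?thesis
  proof cases
    case 1
    have "((\<lambda>x. poly p (1 / x) * exp (- (1 / x))) has_real_derivative
        bump (monom 1 2 * (p - pderiv p)) x) (at x)"
      using 1 by (auto intro!: derivative_eq_intros simp: bump_def poly_monom field_simps power2_eq_square)
    then show ?thesis
      by (rule has_field_derivative_transform_within_open[where S="{0<..}"]) (use 1 in \<open>auto simp: bump_def\<close>)
  next
    case 2
    have "((\<lambda>x. 0) has_real_derivative bump (monom 1 2 * (p - pderiv p)) x) (at x)"
      using 2 by (simp add: bump_def)
    then show ?thesis
      by (rule has_field_derivative_transform_within_open[where S="{..<0}"]) (use 2 in \<open>auto simp: bump_def\<close>)
  next
    case 3
    have inv: "filterlim (\<lambda>h::real. 1 / h) at_top (at_right 0)"
      using filterlim_inverse_at_top_right by (simp add: divide_inverse)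
    \<comment> \<open>Dividing by \<open>h\<close> multiplies the polynomial by the variable, which
      is the \<open>pCons 0\<close>.\<close>
    have "((\<lambda>h. poly (pCons 0 p) (1 / h) * exp (- (1 / h))) \<longlongrightarrow> (0::real)) (at_right 0)"
      using filterlim_compose[OF poly_exp_tendsto_0 inv] .
    then have "((\<lambda>h. bump p h / h) \<longlongrightarrow> 0) (at_right 0)"
      by (rule Lim_transform_eventually)
        (auto simp: eventually_at_right_field bump_def intro!: exI[of _ 1])
    moreover have "((\<lambda>h. bump p h / h) \<longlongrightarrow> 0) (at_left 0)"
      by (rule Lim_transform_eventually[OF tendsto_const])
        (auto simp: eventually_at_left_field bump_def intro!: exI[of _ "-1"])
    ultimately have "((\<lambda>h. bump p h / h) \<longlongrightarrow> 0) (at 0)"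
      using filterlim_split_at_real by blast
    then show ?thesis using 3 by (simp add: DERIV_def bump_def)
  qed
qed

lemma smooth_on_bump: "smooth_on UNIV (bump p)"
proof -
  have "Ck_on k UNIV (bump p)" for k
  proof (induction k arbitrary: p)
    case 0
    show ?case using bump_has_derivative by (auto intro!: continuous_at_imp_continuous_on DERIV_isCont)
  next
    case (Suc k)
    show ?case
    proof (rule Ck_on_SucI[where D="\<lambda>x v. bump (monom 1 2 * (p - pderiv p)) x * v"])
      show "(bump p has_derivative (*) (bump (monom 1 2 * (p - pderiv p)) x)) (at x)" for x
        using bump_has_derivative[of p x] by (simp add: has_field_derivative_def)
      show "Ck_on k UNIV (\<lambda>x. bump (monom 1 2 * (p - pderiv p)) x * v)" for v
        by (intro Ck_on_mult Suc Ck_on_const) auto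
    qed auto
  qed
  then show ?thesis by (simp add: smooth_on_def)
qed

subsection \<open>Hadamard's lemma\<close>

lemma segment_in_ball:
  fixes x z :: "'e::real_normed_vector"
  assumes "x \<in> ball z r" "t \<in> {0..1}"
  shows "z + t *\<^sub>R (x - z) \<in> ball z r"
proof -
  have "norm (t *\<^sub>R (x - z)) \<le> norm (x - z)" using assms(2) by (simp add: mult_left_le_one_le)
  then show ?thesis using assms(1) by (simp add: dist_norm norm_minus_commute)
qed

text \<open>Differentiating under the integral sign brings out a factor \<open>t\<close> from the
  inner map, so the weight \<open>t ^ m\<close> has to be general in the induction on
  \<open>k\<close>.\<close>

lemma Ck_on_radial_integral:
  fixes h :: "'e::euclidean_space \<Rightarrow> real"
  assumes "Ck_on k (ball z r) h"
  shows "Ck_on k (ball z r) (\<lambda>x. integral {0..1} (\<lambda>t. t ^ m * h (z + t *\<^sub>R (x - z))))"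
  using assms
proof (induction k arbitrary: h m)
  case (0 h m)
  have "continuous_on (ball z r \<times> cbox 0 1) (\<lambda>(x, t). t ^ m * h (z + t *\<^sub>R (x - z)))"
    using 0 unfolding split_beta
    by (auto intro!: continuous_intros continuous_on_compose2[of "ball z r" h] segment_in_ball simp del: mem_ball)
  then have "continuous_on (ball z r) (\<lambda>x. integral (cbox 0 1) (\<lambda>t. t ^ m * h (z + t *\<^sub>R (x - z))))"
    by (rule integral_continuous_on_param)
  then show ?case by simp
next
  case (Suc k h m)
  let ?D = "\<lambda>x. fder h x"
  have hD: "(h has_derivative ?D x) (at x)" if "x \<in> ball z r" for x
    using Suc.prems that by (intro has_frechet_derivative) auto
  have contD: "continuous_on (ball z r) (\<lambda>x. ?D x v)" for v
  proof -
    have "Ck_on k (ball z r) (\<lambda>x. ?D x v)" using Suc.prems by simp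
    from Ck_on_le[OF this, of 0] show ?thesis by simp
  qed
  have conth: "continuous_on (ball z r) h"
    using Ck_on_le[OF Suc.prems, of 0] by simp
  define G where "G x t = Blinfun (\<lambda>v. t ^ Suc m * ?D (z + t *\<^sub>R (x - z)) v)" for x t
  have G: "blinfun_apply (G x t) = (\<lambda>v. t ^ Suc m * ?D (z + t *\<^sub>R (x - z)) v)"
    if "x \<in> ball z r" "t \<in> {0..1}" for x t
    unfolding G_def
    by (intro bounded_linear_Blinfun_apply bounded_linear_const_mult has_derivative_bounded_linear[OF hD[OF segment_in_ball[OF that]]])
  have GC: "continuous_on (ball z r \<times> cbox 0 1) (\<lambda>(x, t). G x t)"
  proof (rule continuous_on_blinfun_componentwise)
    fix i :: 'e assume "i \<in> Basis"
    have "continuous_on (ball z r \<times> cbox 0 1) (\<lambda>p. snd p ^ Suc m * ?D (z + snd p *\<^sub>R (fst p - z)) i)"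
      by (auto intro!: continuous_intros continuous_on_compose2[OF contD] segment_in_ball simp del: mem_ball)
    then show "continuous_on (ball z r \<times> cbox 0 1) (\<lambda>p. blinfun_apply (case p of (x, t) \<Rightarrow> G x t) i)"
      by (rule continuous_on_cong[THEN iffD1, rotated -1]) (auto simp: G split_beta simp del: mem_ball)
  qed
  have der: "((\<lambda>x. integral (cbox 0 1) (\<lambda>t. t ^ m * h (z + t *\<^sub>R (x - z)))) has_derivative
      blinfun_apply (integral (cbox 0 1) (G x))) (at x)" if x: "x \<in> ball z r" for x
  proof -
    have "((\<lambda>x. integral (cbox 0 1) (\<lambda>t. t ^ m * h (z + t *\<^sub>R (x - z)))) has_derivative
      blinfun_apply (integral (cbox 0 1) (G x))) (at x within ball z r)"
    proof (rule leibniz_rule[OF _ _ GC x convex_ball])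
      fix y :: 'e and t :: real assume y: "y \<in> ball z r" and t: "t \<in> cbox 0 1"
      have "((\<lambda>y. z + t *\<^sub>R (y - z)) has_derivative (\<lambda>v. t *\<^sub>R v)) (at y)"
        by (auto intro!: derivative_eq_intros)
      from has_derivative_compose[OF this hD[OF segment_in_ball[OF y]]] t
      have c: "((\<lambda>y. h (z + t *\<^sub>R (y - z))) has_derivative (\<lambda>v. ?D (z + t *\<^sub>R (y - z)) (t *\<^sub>R v))) (at y)"
        by simp
      have lin: "?D (z + t *\<^sub>R (y - z)) (t *\<^sub>R v) = t * ?D (z + t *\<^sub>R (y - z)) v" for v
        using linear_scale[OF has_derivative_linear[OF hD[OF segment_in_ball[OF y]]]] t by simp
      have "((\<lambda>y. t ^ m * h (z + t *\<^sub>R (y - z))) has_derivative blinfun_apply (G y t)) (at y)"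
        using has_derivative_mult_right[OF c, of "t ^ m"] t y by (simp add: G lin ac_simps)
      then show "((\<lambda>y. t ^ m * h (z + t *\<^sub>R (y - z))) has_derivative blinfun_apply (G y t)) (at y within ball z r)"
        by (rule has_derivative_at_withinI)
    next
      fix y assume "y \<in> ball z r"
      then show "(\<lambda>t. t ^ m * h (z + t *\<^sub>R (y - z))) integrable_on cbox 0 1"
        by (intro integrable_continuous)
          (auto intro!: continuous_intros continuous_on_compose2[OF conth] segment_in_ball simp del: mem_ball)
    qed
    then show ?thesis using at_within_open[OF x open_ball] by simp
  qed
  have val: "blinfun_apply (integral (cbox 0 1) (G x)) v =
      integral {0..1} (\<lambda>t. t ^ Suc m * ?D (z + t *\<^sub>R (x - z)) v)" if x: "x \<in> ball z r" for x v
  proof -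
    have "continuous_on (cbox 0 1) (G x)"
    proof -
      have "continuous_on (cbox 0 1) (Pair x)" by (intro continuous_intros)
      then have "continuous_on (cbox 0 1) (\<lambda>t. case (x, t) of (x, t) \<Rightarrow> G x t)"
        by (rule continuous_on_compose2[OF GC]) (use x in auto)
      then show ?thesis by simp
    qed
    then have "G x integrable_on cbox 0 1" by (rule integrable_continuous)
    from integral_linear[OF this, of "\<lambda>b. blinfun_apply b v"]
    have "blinfun_apply (integral (cbox 0 1) (G x)) v = integral (cbox 0 1) (\<lambda>t. blinfun_apply (G x t) v)"
      by (simp add: o_def blinfun.bounded_linear_left)
    also have "\<dots> = integral (cbox 0 1) (\<lambda>t. t ^ Suc m * ?D (z + t *\<^sub>R (x - z)) v)"
      by (intro integral_cong) (use x in \<open>auto simp: G simp del: mem_ball\<close>)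
    finally show ?thesis by simp
  qed
  show ?case
  proof (rule Ck_on_SucI)
    show "((\<lambda>x. integral {0..1} (\<lambda>t. t ^ m * h (z + t *\<^sub>R (x - z)))) has_derivative
      blinfun_apply (integral (cbox 0 1) (G x))) (at x)" if "x \<in> ball z r" for x
      using der[OF that] by simp
    show "Ck_on k (ball z r) (\<lambda>x. blinfun_apply (integral (cbox 0 1) (G x)) v)" for v
    proof -
      have "Ck_on k (ball z r) (\<lambda>x. ?D x v)" using Suc.prems by simp
      note c = Suc.IH[OF this, of "Suc m"]
      show ?thesis by (rule Ck_on_cong[OF open_ball _ c]) (rule val[symmetric])
    qed
  qed simp
qed

lemma hadamard:
  fixes f :: "'e::euclidean_space \<Rightarrow> real"
  assumes "smooth_on (ball z r) f" "r > 0"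
  shows "\<exists>g. (\<forall>i\<in>Basis. smooth_on (ball z r) (g i) \<and> g i z = fder f z i) \<and>
    (\<forall>x\<in>ball z r. f x = f z + (\<Sum>i\<in>Basis. ((x - z) \<bullet> i) * g i x))"
proof -
  let ?D = "\<lambda>x. fder f x"
  \<comment> \<open>The averaged partial derivative along the segment from \<open>z\<close>; the
    weight \<open>t ^ 0\<close> matches the radial integral lemma.\<close>
  define g where "g i x = integral {0..1} (\<lambda>t. t ^ 0 * ?D (z + t *\<^sub>R (x - z)) i)" for i x
  have "smooth_on (ball z r) (g i)" for i
    using smooth_on_deriv[OF assms(1), of i] unfolding smooth_on_def g_def
    by (intro allI Ck_on_radial_integral) blast
  moreover have "g i z = ?D z i" for i by (simp add: g_def)
  moreover have "f x = f z + (\<Sum>i\<in>Basis. ((x - z) \<bullet> i) * g i x)" if x: "x \<in> ball z r" for x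
  proof -
    note in_ball = segment_in_ball[OF x]
    have "((\<lambda>t. f (z + t *\<^sub>R (x - z))) has_vector_derivative ?D (z + t *\<^sub>R (x - z)) (x - z)) (at t within {0..1})"
      if "t \<in> {0..1}" for t
    proof -
      have fd: "(f has_derivative ?D (z + t *\<^sub>R (x - z))) (at (z + t *\<^sub>R (x - z)))"
        by (rule smooth_on_has_derivative[OF assms(1) in_ball[OF that]])
      have "((\<lambda>t. z + t *\<^sub>R (x - z)) has_derivative (\<lambda>s. s *\<^sub>R (x - z))) (at t)"
        by (auto intro!: derivative_eq_intros)
      from has_derivative_compose[OF this fd] show ?thesis
        by (simp add: has_vector_derivative_def linear_scale[OF has_derivative_linear[OF fd]] has_derivative_at_withinI)
    qed
    then have ftc: "((\<lambda>t. ?D (z + t *\<^sub>R (x - z)) (x - z)) has_integral f x - f z) {0..1}"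
      using fundamental_theorem_of_calculus[of 0 1 "\<lambda>t. f (z + t *\<^sub>R (x - z))"] by simp
    have "f x - f z = integral {0..1} (\<lambda>t. ?D (z + t *\<^sub>R (x - z)) (x - z))"
      using ftc by (simp add: integral_unique)
    also have "\<dots> = integral {0..1} (\<lambda>t. \<Sum>i\<in>Basis. ((x - z) \<bullet> i) * (t ^ 0 * ?D (z + t *\<^sub>R (x - z)) i))"
    proof (intro integral_cong)
      fix t :: real assume "t \<in> {0..1}"
      then have lin: "linear (?D (z + t *\<^sub>R (x - z)))"
        by (intro has_derivative_linear[OF smooth_on_has_derivative[OF assms(1)]] in_ball)
      have "?D (z + t *\<^sub>R (x - z)) (x - z) = ?D (z + t *\<^sub>R (x - z)) (\<Sum>i\<in>Basis. ((x - z) \<bullet> i) *\<^sub>R i)"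
        by (simp only: euclidean_representation)
      also have "\<dots> = (\<Sum>i\<in>Basis. ((x - z) \<bullet> i) * ?D (z + t *\<^sub>R (x - z)) i)"
        by (simp only: linear_sum[OF lin] linear_scale[OF lin] real_scaleR_def)
      finally show "?D (z + t *\<^sub>R (x - z)) (x - z) = (\<Sum>i\<in>Basis. ((x - z) \<bullet> i) * (t ^ 0 * ?D (z + t *\<^sub>R (x - z)) i))"
        by simp
    qed
    also have "\<dots> = (\<Sum>i\<in>Basis. ((x - z) \<bullet> i) * g i x)"
      unfolding g_def
    proof (subst integral_sum)
      have "continuous_on {0..1} (\<lambda>t. ?D (z + t *\<^sub>R (x - z)) i)" for i
        by (rule continuous_on_compose2[OF smooth_on_continuous[OF smooth_on_deriv[OF assms(1)]]])
          (auto intro!: continuous_intros in_ball simp del: mem_ball)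
      then show "(\<lambda>t. ((x - z) \<bullet> i) * (t ^ 0 * ?D (z + t *\<^sub>R (x - z)) i)) integrable_on {0..1}" for i
        by (intro integrable_continuous_interval continuous_intros) auto
    qed auto
    finally show ?thesis by simp
  qed
  ultimately show ?thesis by blast
qed

subsection \<open>Symmetry of second derivatives\<close>

text \<open>Two mean value theorems: in direction \<open>a\<close> for the increment along
  \<open>h *\<^sub>R b\<close>, then in direction \<open>b\<close> for the derivative
  obtained.\<close>

lemma mixed_difference:
  fixes J :: "'e::real_normed_vector \<Rightarrow> real"
  assumes J: "smooth_on (ball p r) J" and h: "h > 0" and small: "h * (norm a + norm b) < r"
  shows "\<exists>q\<in>ball p r. norm (q - p) \<le> h * (norm a + norm b) \<and>
     J (p + h *\<^sub>R a + h *\<^sub>R b) - J (p + h *\<^sub>R a) - J (p + h *\<^sub>R b) + J p =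
     h * h * fder (\<lambda>x. fder J x a) q b"
proof -
  let ?D = "\<lambda>x. fder J x"
  have bound: "norm (s *\<^sub>R a + t *\<^sub>R b) \<le> h * (norm a + norm b)" if "s \<in> {0..h}" "t \<in> {0..h}" for s t
  proof -
    have "norm (s *\<^sub>R a + t *\<^sub>R b) \<le> s * norm a + t * norm b"
      using that by (intro order_trans[OF norm_triangle_ineq]) simp
    also have "\<dots> \<le> h * norm a + h * norm b" using that by (intro add_mono mult_right_mono) auto
    finally show ?thesis by (simp add: distrib_left)
  qed
  have mem: "p + s *\<^sub>R a + t *\<^sub>R b \<in> ball p r" if "s \<in> {0..h}" "t \<in> {0..h}" for s t
    using bound[OF that] small by (simp add: dist_norm add.assoc norm_minus_commute)
      (metis add.commute norm_minus_cancel minus_add_distrib le_less_trans)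
  have dir: "((\<lambda>s. F (c + s *\<^sub>R d)) has_real_derivative fder F (c + s *\<^sub>R d) d) (at s)"
    if "smooth_on (ball p r) F" "c + s *\<^sub>R d \<in> ball p r" for F :: "'e \<Rightarrow> real" and c d s
  proof -
    have fd: "(F has_derivative fder F (c + s *\<^sub>R d)) (at (c + s *\<^sub>R d))"
      using smooth_on_has_derivative[OF that] .
    have "((\<lambda>s. c + s *\<^sub>R d) has_derivative (\<lambda>s. s *\<^sub>R d)) (at s)"
      by (auto intro!: derivative_eq_intros)
    from has_derivative_compose[OF this fd] show ?thesis
      by (simp add: has_field_derivative_def linear_scale[OF has_derivative_linear[OF fd]] mult.commute[of _ "frechet_derivative F _ d"])
  qed
  define u where "u s = J (p + s *\<^sub>R a + h *\<^sub>R b) - J (p + s *\<^sub>R a)" for s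
  have u': "(u has_real_derivative (?D (p + s *\<^sub>R a + h *\<^sub>R b) a - ?D (p + s *\<^sub>R a) a)) (at s)"
    if "0 \<le> s" "s \<le> h" for s
  proof -
    have "((\<lambda>s. J (p + h *\<^sub>R b + s *\<^sub>R a)) has_real_derivative ?D (p + h *\<^sub>R b + s *\<^sub>R a) a) (at s)"
      using mem[of s h] that h by (intro dir[OF J]) (simp add: ac_simps)
    moreover have "((\<lambda>s. J (p + s *\<^sub>R a)) has_real_derivative ?D (p + s *\<^sub>R a) a) (at s)"
      using mem[of s 0] that h by (intro dir[OF J]) simp
    ultimately show ?thesis
      unfolding u_def by (intro DERIV_diff) (simp_all add: ac_simps)
  qed
  obtain s where s: "0 < s" "s < h" "u h - u 0 = (h - 0) * (?D (p + s *\<^sub>R a + h *\<^sub>R b) a - ?D (p + s *\<^sub>R a) a)"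
    using MVT2[OF h u'] by blast
  let ?w = "\<lambda>t. ?D (p + s *\<^sub>R a + t *\<^sub>R b) a"
  have w': "(?w has_real_derivative fder (\<lambda>x. ?D x a) (p + s *\<^sub>R a + t *\<^sub>R b) b) (at t)"
    if "0 \<le> t" "t \<le> h" for t
    using mem[of s t] s that by (intro dir[OF smooth_on_deriv[OF J]]) auto
  obtain t where t: "0 < t" "t < h"
    "?w h - ?w 0 = (h - 0) * fder (\<lambda>x. ?D x a) (p + s *\<^sub>R a + t *\<^sub>R b) b"
    using MVT2[OF h w'] by blast
  let ?q = "p + s *\<^sub>R a + t *\<^sub>R b"
  have "?q \<in> ball p r" using mem s t by simp
  moreover have "norm (?q - p) \<le> h * (norm a + norm b)"
    using bound[of s t] s t by (simp add: add.assoc)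
  moreover have "J (p + h *\<^sub>R a + h *\<^sub>R b) - J (p + h *\<^sub>R a) - J (p + h *\<^sub>R b) + J p = u h - u 0"
    by (simp add: u_def)
  ultimately show ?thesis using s(3) t(3) by (intro bexI[of _ ?q]) auto
qed

text \<open>The second difference is symmetric in \<open>a\<close> and \<open>b\<close>, so both
  mixed derivatives take a common value at points close to \<open>p\<close>; continuity does the
  rest.\<close>

lemma symmetric_second_derivative:
  fixes J :: "'e::real_normed_vector \<Rightarrow> real"
  assumes "smooth_on s J" "open s" "p \<in> s"
  shows "fder (\<lambda>x. fder J x a) p b =
    fder (\<lambda>x. fder J x b) p a"
proof (rule ccontr)
  let ?F = "\<lambda>a b q. fder (\<lambda>x. fder J x a) q b"
  assume ne: "?F a b p \<noteq> ?F b a p"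
  obtain r where r: "r > 0" "ball p r \<subseteq> s" using assms openE by blast
  have J: "smooth_on (ball p r) J" using assms(1) r(2) by (rule smooth_on_subset)
  \<comment> \<open>Half the gap: two errors strictly below \<open>e\<close> cannot bridge
    it.\<close>
  define e where "e = \<bar>?F a b p - ?F b a p\<bar> / 2"
  have e: "e > 0" using ne by (simp add: e_def)
  have "continuous_on (ball p r) (?F a b)" "continuous_on (ball p r) (?F b a)"
    using J by (auto intro!: smooth_on_continuous smooth_on_deriv)
  then have "isCont (?F a b) p" "isCont (?F b a) p"
    using r(1) by (auto simp: continuous_on_eq_continuous_at)
  then obtain d1 d2 where d: "d1 > 0" "\<And>q. norm (q - p) < d1 \<Longrightarrow> \<bar>?F a b q - ?F a b p\<bar> < e"
    "d2 > 0" "\<And>q. norm (q - p) < d2 \<Longrightarrow> \<bar>?F b a q - ?F b a p\<bar> < e"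
    using e unfolding continuous_at_eps_delta by (metis dist_norm real_norm_def)
  define m where "m = Min {r, d1, d2}"
  have m: "m > 0" "m \<le> r" "m \<le> d1" "m \<le> d2" using r d by (auto simp: m_def)
  \<comment> \<open>The summand 1 guards against \<open>a = b = 0\<close> and makes
    \<open>h * (norm a + norm b)\<close> strictly smaller than \<open>m\<close>.\<close>
  define h where "h = m / (norm a + norm b + 1)"
  have pos: "norm a + norm b + 1 > 0" by (meson add_nonneg_pos norm_ge_zero add_nonneg_nonneg zero_less_one)
  have h: "h > 0" using m pos by (simp add: h_def)
  have hm: "h * (norm a + norm b) < m" using m(1) pos by (simp add: h_def field_simps)
  obtain q1 where q1: "norm (q1 - p) \<le> h * (norm a + norm b)"
    "J (p + h *\<^sub>R a + h *\<^sub>R b) - J (p + h *\<^sub>R a) - J (p + h *\<^sub>R b) + J p = h * h * ?F a b q1"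
    using mixed_difference[OF J h, of a b] hm m by auto
  obtain q2 where q2: "norm (q2 - p) \<le> h * (norm b + norm a)"
    "J (p + h *\<^sub>R b + h *\<^sub>R a) - J (p + h *\<^sub>R b) - J (p + h *\<^sub>R a) + J p = h * h * ?F b a q2"
    using mixed_difference[OF J h, of b a] hm m by (auto simp: add.commute)
  have "p + h *\<^sub>R b + h *\<^sub>R a = p + h *\<^sub>R a + h *\<^sub>R b" by simp
  then have "h * h * ?F a b q1 = h * h * ?F b a q2" using q1(2) q2(2) by (simp only:)
  then have eq: "?F a b q1 = ?F b a q2" using h by simp
  have "\<bar>?F a b q1 - ?F a b p\<bar> < e" "\<bar>?F b a q2 - ?F b a p\<bar> < e"
    using q1(1) q2(1) hm m d by (auto simp: add.commute)
  then show False using eq by (simp add: e_def abs_if split: if_splits)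
qed

section \<open>Left-invariant vector fields\<close>

context smooth_atlas
begin

lemma chart_inv: "(U, \<phi>) \<in> \<A> \<Longrightarrow> x \<in> U \<Longrightarrow> inv_into U \<phi> (\<phi> x) = x"
  using chart_homeo by (auto simp: homeomorphism_def)

lemma chart_inv_mem: "(U, \<phi>) \<in> \<A> \<Longrightarrow> s \<in> \<phi> ` U \<Longrightarrow> inv_into U \<phi> s \<in> U"
  by (rule inv_into_into)

lemma chart_inv_right: "(U, \<phi>) \<in> \<A> \<Longrightarrow> s \<in> \<phi> ` U \<Longrightarrow> \<phi> (inv_into U \<phi> s) = s"
  by (rule f_inv_into_f)

lemma chart_inv_continuous: "(U, \<phi>) \<in> \<A> \<Longrightarrow> continuous_on (\<phi> ` U) (inv_into U \<phi>)"
  using chart_homeo by (auto simp: homeomorphism_def)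

lemma chart_image_open:
  assumes "(U, \<phi>) \<in> \<A>" "open V"
  shows "open (\<phi> ` (U \<inter> V))"
proof -
  have "\<phi> ` (U \<inter> V) = \<phi> ` U \<inter> inv_into U \<phi> -` V"
    using chart_inv[OF assms(1)] by force
  then show ?thesis
    using continuous_open_preimage[OF chart_inv_continuous[OF assms(1)]] chart_open[OF assms(1)] assms(2) by simp
qed

lemma obtain_chart: obtains U \<phi> where "(U, \<phi>) \<in> \<A>" "p \<in> U"
proof -
  have "p \<in> (\<Union>(U, \<phi>)\<in>\<A>. U)" by (simp add: charts_cover)
  then obtain U \<phi> where "(U, \<phi>) \<in> \<A>" "p \<in> U" by auto
  then show thesis by (rule that)
qed

text \<open>One suitable chart is enough as a witness. Cut-off functions and translates are easiest
  to check point by point, each time in a convenient chart.\<close>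

definition smooth_at :: "('g \<Rightarrow> real) \<Rightarrow> 'g \<Rightarrow> bool" where
  "smooth_at f p \<longleftrightarrow> (\<exists>U \<phi> S. (U, \<phi>) \<in> \<A> \<and> p \<in> U \<and> open S \<and> S \<subseteq> \<phi> ` U \<and> \<phi> p \<in> S \<and>
     smooth_on S (\<lambda>s. f (inv_into U \<phi> s)))"

lemma smooth_atI:
  "(U, \<phi>) \<in> \<A> \<Longrightarrow> p \<in> U \<Longrightarrow> open S \<Longrightarrow> S \<subseteq> \<phi> ` U \<Longrightarrow> \<phi> p \<in> S \<Longrightarrow>
   smooth_on S (\<lambda>s. f (inv_into U \<phi> s)) \<Longrightarrow> smooth_at f p"
  unfolding smooth_at_def by blast

lemma smooth_functions_chart:
  "f \<in> smooth_functions \<Longrightarrow> (U, \<phi>) \<in> \<A> \<Longrightarrow> smooth_on (\<phi> ` U) (\<lambda>s. f (inv_into U \<phi> s))"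
  by (auto simp: smooth_functions_def o_def)

lemma smooth_at_chart:
  assumes "smooth_at f p" and V: "(V, \<psi>) \<in> \<A>" "p \<in> V"
  shows "\<exists>T. open T \<and> T \<subseteq> \<psi> ` V \<and> \<psi> p \<in> T \<and> smooth_on T (\<lambda>t. f (inv_into V \<psi> t))"
proof -
  obtain U \<phi> S where U: "(U, \<phi>) \<in> \<A>" "p \<in> U" and S: "open S" "S \<subseteq> \<phi> ` U" "\<phi> p \<in> S"
    "smooth_on S (\<lambda>s. f (inv_into U \<phi> s))"
    using assms(1) unfolding smooth_at_def by blast
  let ?tr = "\<lambda>t. \<phi> (inv_into V \<psi> t)"
  have op: "open (\<psi> ` (V \<inter> U))" using chart_image_open[OF V(1)] chart_open[OF U(1)] by simp
  have tr: "smooth_on (\<psi> ` (V \<inter> U)) ?tr" using transition_smooth[OF V(1) U(1)] by (simp add: o_def)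
  define T where "T = \<psi> ` (V \<inter> U) \<inter> ?tr -` S"
  have T: "open T" unfolding T_def
    using continuous_open_preimage[OF smooth_on_continuous[OF tr] op S(1)] .
  have "smooth_on T (\<lambda>t. f (inv_into U \<phi> (?tr t)))"
    using T S by (intro smooth_on_compose[OF T S(1) _ smooth_on_subset[OF tr] S(4)]) (auto simp: T_def)
  then have "smooth_on T (\<lambda>t. f (inv_into V \<psi> t))"
    by (rule smooth_on_cong[OF T, rotated]) (auto simp: T_def chart_inv[OF V(1)] chart_inv[OF U(1)])
  moreover have "\<psi> p \<in> T" using U V S by (auto simp: T_def chart_inv[OF V(1)])
  ultimately show ?thesis using T by (intro exI[of _ T]) (auto simp: T_def)
qed

lemma smooth_functions_iff: "f \<in> smooth_functions \<longleftrightarrow> (\<forall>p. smooth_at f p)"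
proof
  assume f: "f \<in> smooth_functions"
  show "\<forall>p. smooth_at f p"
  proof
    fix p
    obtain U \<phi> where "(U, \<phi>) \<in> \<A>" "p \<in> U" by (rule obtain_chart)
    then show "smooth_at f p"
      using chart_open smooth_functions_chart[OF f] by (intro smooth_atI[where S="\<phi> ` U"]) auto
  qed
next
  assume f: "\<forall>p. smooth_at f p"
  have "smooth_on (\<psi> ` V) (f \<circ> inv_into V \<psi>)" if V: "(V, \<psi>) \<in> \<A>" for V \<psi>
  proof (rule smooth_on_local)
    fix t assume "t \<in> \<psi> ` V"
    then obtain p where "t = \<psi> p" "p \<in> V" by auto
    then show "\<exists>T. open T \<and> t \<in> T \<and> smooth_on T (f \<circ> inv_into V \<psi>)"
      using smooth_at_chart[OF _ V] f by (force simp: o_def)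
  qed
  then show "f \<in> smooth_functions" by (auto simp: smooth_functions_def)
qed

lemma smooth_functions_const: "(\<lambda>x. c) \<in> smooth_functions"
  by (auto simp: smooth_functions_def o_def smooth_on_const)

lemma smooth_functions_add:
  "f \<in> smooth_functions \<Longrightarrow> g \<in> smooth_functions \<Longrightarrow> (\<lambda>x. f x + g x) \<in> smooth_functions"
  using chart_open by (auto simp: smooth_functions_def o_def intro!: smooth_on_add)

lemma smooth_functions_mult:
  "f \<in> smooth_functions \<Longrightarrow> g \<in> smooth_functions \<Longrightarrow> (\<lambda>x. f x * g x) \<in> smooth_functions"
  using chart_open by (auto simp: smooth_functions_def o_def intro!: smooth_on_mult)

lemma smooth_functions_sum:
  "(\<And>i. i \<in> I \<Longrightarrow> f i \<in> smooth_functions) \<Longrightarrow> (\<lambda>x. \<Sum>i\<in>I. f i x) \<in> smooth_functions"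
  by (induction I rule: infinite_finite_induct) (auto intro: smooth_functions_const smooth_functions_add)

lemma smooth_functions_continuous:
  assumes "f \<in> smooth_functions"
  shows "continuous_on UNIV f"
proof -
  have "isCont f p" for p
  proof -
    obtain U \<phi> where U: "(U, \<phi>) \<in> \<A>" "p \<in> U" by (rule obtain_chart)
    have "continuous_on U \<phi>" using chart_homeo[OF U(1)] by (auto simp: homeomorphism_def)
    then have "continuous_on U (\<lambda>x. f (inv_into U \<phi> (\<phi> x)))"
      by (rule continuous_on_compose2[OF smooth_on_continuous[OF smooth_functions_chart[OF assms U(1)]]]) auto
    then have "continuous_on U f" by (simp add: chart_inv[OF U(1)] cong: continuous_on_cong)
    then show ?thesis using U chart_open[OF U(1)] by (auto simp: continuous_on_eq_continuous_at)
  qed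
  then show ?thesis by (simp add: continuous_at_imp_continuous_on)
qed

lemma vector_field_smooth: "D \<in> vector_fields \<Longrightarrow> f \<in> smooth_functions \<Longrightarrow> D f \<in> smooth_functions"
  and vector_field_add: "D \<in> vector_fields \<Longrightarrow> f \<in> smooth_functions \<Longrightarrow> g \<in> smooth_functions \<Longrightarrow>
    D (\<lambda>x. f x + g x) = (\<lambda>x. D f x + D g x)"
  and vector_field_scale: "D \<in> vector_fields \<Longrightarrow> f \<in> smooth_functions \<Longrightarrow>
    D (\<lambda>x. c * f x) = (\<lambda>x. c * D f x)"
  and vector_field_mult: "D \<in> vector_fields \<Longrightarrow> f \<in> smooth_functions \<Longrightarrow> g \<in> smooth_functions \<Longrightarrow>
    D (\<lambda>x. f x * g x) = (\<lambda>x. f x * D g x + D f x * g x)"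
  by (auto simp: vector_fields_def)

lemma vector_field_const:
  assumes D: "D \<in> vector_fields"
  shows "D (\<lambda>x. c) = (\<lambda>x. 0)"
proof -
  have "D (\<lambda>x. 1 * 1) = (\<lambda>x. 1 * D (\<lambda>x. 1) x + D (\<lambda>x. 1) x * 1)"
    by (rule vector_field_mult[OF D]) (rule smooth_functions_const)+
  then have "D (\<lambda>x. 1) = (\<lambda>x. 0)" by (simp add: fun_eq_iff)
  then show ?thesis using vector_field_scale[OF D smooth_functions_const, of c 1] by simp
qed

lemma vector_field_sum:
  assumes D: "D \<in> vector_fields"
  shows "(\<And>i. i \<in> I \<Longrightarrow> f i \<in> smooth_functions) \<Longrightarrow> D (\<lambda>x. \<Sum>i\<in>I. f i x) = (\<lambda>x. \<Sum>i\<in>I. D (f i) x)"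
  by (induction I rule: infinite_finite_induct)
    (auto simp: vector_field_const[OF D] vector_field_add[OF D] smooth_functions_sum)

end

section \<open>Partial derivatives of functions of two variables\<close>

lemma derivative_along_graph:
  fixes K :: "'e::real_normed_vector \<times> 'e \<Rightarrow> real"
  assumes "K differentiable at (z, z)" "\<iota> differentiable at z" "\<iota> z = z"
  shows "fder (\<lambda>t. K (t, \<iota> t)) z y =
    fder (\<lambda>t. K (t, z)) z y + fder (\<lambda>t. K (z, \<iota> t)) z y"
proof -
  let ?K = "fder K (z, z)" and ?i = "fder \<iota> z"
  have K: "(K has_derivative ?K) (at (z, z))" and i: "(\<iota> has_derivative ?i) (at z)"
    using assms by (auto intro: has_frechet_derivative)
  have 1: "((\<lambda>t. K (t, \<iota> t)) has_derivative (\<lambda>y. ?K (y, ?i y))) (at z)"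
    using has_derivative_compose[OF has_derivative_Pair[OF has_derivative_ident i], of K ?K] K assms(3) by simp
  have 2: "((\<lambda>t. K (t, z)) has_derivative (\<lambda>y. ?K (y, 0))) (at z)"
    using has_derivative_compose[OF has_derivative_Pair[OF has_derivative_ident has_derivative_const], of K ?K] K by simp
  have 3: "((\<lambda>t. K (z, \<iota> t)) has_derivative (\<lambda>y. ?K (0, ?i y))) (at z)"
    using has_derivative_compose[OF has_derivative_Pair[OF has_derivative_const i], of K ?K] K assms(3) by simp
  have "?K (y, ?i y) = ?K (y, 0) + ?K (0, ?i y)"
    using linear_add[OF has_derivative_linear[OF K], of "(y, 0)" "(0, ?i y)"] by simp
  then show ?thesis
    by (simp add: frechet_derivative_eqI[OF 1] frechet_derivative_eqI[OF 2] frechet_derivative_eqI[OF 3])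
qed

lemma partial_derivative:
  fixes Q :: "'e::real_normed_vector \<times> 'e \<Rightarrow> real"
  assumes "smooth_on S Q" "(s, t) \<in> S"
  shows "fder (\<lambda>t. Q (s, t)) t v = fder Q (s, t) (0, v)"
    and "fder (\<lambda>s. Q (s, t)) s v = fder Q (s, t) (v, 0)"
proof -
  note Q = smooth_on_has_derivative[OF assms]
  have "((\<lambda>t. Q (s, t)) has_derivative (\<lambda>v. fder Q (s, t) (0, v))) (at t)"
    using has_derivative_compose[OF has_derivative_Pair[OF has_derivative_const has_derivative_ident] Q] by simp
  then show "fder (\<lambda>t. Q (s, t)) t v = fder Q (s, t) (0, v)"
    by (simp add: frechet_derivative_eqI)
  have "((\<lambda>s. Q (s, t)) has_derivative (\<lambda>v. fder Q (s, t) (v, 0))) (at s)"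
    using has_derivative_compose[OF has_derivative_Pair[OF has_derivative_ident has_derivative_const] Q] by simp
  then show "fder (\<lambda>s. Q (s, t)) s v = fder Q (s, t) (v, 0)"
    by (simp add: frechet_derivative_eqI)
qed

lemma open_slice: "open S \<Longrightarrow> open {s. (s, t) \<in> S}" "open S \<Longrightarrow> open {t. (s, t) \<in> S}"
proof -
  assume S: "open S"
  have "continuous_on UNIV (\<lambda>s. (s, t))" "continuous_on UNIV (Pair s)" by (intro continuous_intros)+
  then show "open {s. (s, t) \<in> S}" "open {t. (s, t) \<in> S}"
    using open_vimage[OF S] by (auto simp: vimage_def)
qed

lemma smooth_partial_derivative:
  fixes Q :: "'e::euclidean_space \<times> 'e \<Rightarrow> real"
  assumes "open S" "smooth_on S Q"
  shows "smooth_on {s. (s, t) \<in> S} (\<lambda>s. fder (\<lambda>t. Q (s, t)) t v)"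
proof -
  have op: "open {s. (s, t) \<in> S}" using assms(1) by (rule open_slice)
  have "smooth_on {s. (s, t) \<in> S} (\<lambda>s. (s, t))"
    using op by (intro smooth_on_Pair smooth_on_const) (auto intro: smooth_on_bounded_linear bounded_linear_ident)
  then have "smooth_on {s. (s, t) \<in> S} (\<lambda>s. fder Q (s, t) (0, v))"
    by (rule smooth_on_compose[OF op assms(1) _ _ smooth_on_deriv[OF assms(2)], rotated]) auto
  then show ?thesis
    by (rule smooth_on_cong[OF op, rotated]) (use partial_derivative(1)[OF assms(2)] in auto)
qed

lemma smooth_partial_derivative':
  fixes Q :: "'e::euclidean_space \<times> 'e \<Rightarrow> real"
  assumes "open S" "smooth_on S Q"
  shows "smooth_on {t. (s, t) \<in> S} (\<lambda>t. fder (\<lambda>s. Q (s, t)) s v)"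
proof -
  have op: "open {t. (s, t) \<in> S}" using assms(1) by (rule open_slice)
  have "smooth_on {t. (s, t) \<in> S} (\<lambda>t. (s, t))"
    using op by (intro smooth_on_Pair smooth_on_const) (auto intro: smooth_on_bounded_linear bounded_linear_ident)
  then have "smooth_on {t. (s, t) \<in> S} (\<lambda>t. fder Q (s, t) (v, 0))"
    by (rule smooth_on_compose[OF op assms(1) _ _ smooth_on_deriv[OF assms(2)], rotated]) auto
  then show ?thesis
    by (rule smooth_on_cong[OF op, rotated]) (use partial_derivative(2)[OF assms(2)] in auto)
qed

lemma partial_derivatives_commute:
  fixes Q :: "'e::euclidean_space \<times> 'e \<Rightarrow> real"
  assumes S: "open S" "smooth_on S Q" "(s0, t0) \<in> S"
  shows "fder (\<lambda>s. fder (\<lambda>t. Q (s, t)) t0 v) s0 y =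
    fder (\<lambda>t. fder (\<lambda>s. Q (s, t)) s0 y) t0 v"
proof -
  let ?Q = "\<lambda>p. fder Q p"
  have "fder (\<lambda>s. fder (\<lambda>t. Q (s, t)) t0 v) s0 y =
      fder (\<lambda>s. ?Q (s, t0) (0, v)) s0 y"
    by (subst frechet_derivative_cong_open(1)[of "{s. (s, t0) \<in> S}" s0 _ "\<lambda>s. ?Q (s, t0) (0, v)"])
      (use S open_slice partial_derivative[OF S(2)] in auto)
  also have "\<dots> = fder (\<lambda>p. ?Q p (0, v)) (s0, t0) (y, 0)"
    by (rule partial_derivative(2)[OF smooth_on_deriv[OF S(2)] S(3)])
  also have "\<dots> = fder (\<lambda>p. ?Q p (y, 0)) (s0, t0) (0, v)"
    by (rule symmetric_second_derivative[OF S(2,1,3)])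
  also have "\<dots> = fder (\<lambda>t. ?Q (s0, t) (y, 0)) t0 v"
    by (rule partial_derivative(1)[OF smooth_on_deriv[OF S(2)] S(3), symmetric])
  also have "\<dots> = fder (\<lambda>t. fder (\<lambda>s. Q (s, t)) s0 y) t0 v"
    by (subst frechet_derivative_cong_open(1)[of "{t. (s0, t) \<in> S}" t0 _ "\<lambda>t. fder (\<lambda>s. Q (s, t)) s0 y"])
      (use S open_slice partial_derivative[OF S(2)] in auto)
  finally show ?thesis .
qed

section \<open>Smoothness of translations\<close>

context lie_group
begin

lemma open_mult_domain:
  assumes "(U, \<phi>) \<in> \<A>" "(V, \<psi>) \<in> \<A>" "open W"
  shows "open {(\<phi> x, \<psi> y) | x y. x \<in> U \<and> y \<in> V \<and> x + y \<in> W}"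
proof -
  have "continuous_on (\<phi> ` U \<times> \<psi> ` V) (\<lambda>p. inv_into U \<phi> (fst p) + inv_into V \<psi> (snd p))"
    by (intro continuous_on_add)
      (auto intro!: continuous_on_compose2[OF chart_inv_continuous[OF assms(1)]]
        continuous_on_compose2[OF chart_inv_continuous[OF assms(2)]] continuous_intros)
  then have "open (\<phi> ` U \<times> \<psi> ` V \<inter> (\<lambda>p. inv_into U \<phi> (fst p) + inv_into V \<psi> (snd p)) -` W)"
    using chart_open assms by (intro continuous_open_preimage open_Times) auto
  moreover have "\<phi> ` U \<times> \<psi> ` V \<inter> (\<lambda>p. inv_into U \<phi> (fst p) + inv_into V \<psi> (snd p)) -` W =
      {(\<phi> x, \<psi> y) | x y. x \<in> U \<and> y \<in> V \<and> x + y \<in> W}"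
    using chart_inv[OF assms(1)] chart_inv[OF assms(2)] by force
  ultimately show ?thesis by simp
qed

lemma smooth_at_compose:
  assumes f: "smooth_at f (F p)" and U: "(U, \<phi>) \<in> \<A>" "p \<in> U" and W: "(W, \<xi>) \<in> \<A>" "F p \<in> W"
    and S0: "open S0" "S0 \<subseteq> \<phi> ` U" "\<phi> p \<in> S0" "\<And>t. t \<in> S0 \<Longrightarrow> F (inv_into U \<phi> t) \<in> W"
      "smooth_on S0 (\<lambda>t. \<xi> (F (inv_into U \<phi> t)))"
  shows "smooth_at (\<lambda>x. f (F x)) p"
proof -
  obtain T where T: "open T" "T \<subseteq> \<xi> ` W" "\<xi> (F p) \<in> T" "smooth_on T (\<lambda>t. f (inv_into W \<xi> t))"
    using smooth_at_chart[OF f W] by blast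
  let ?g = "\<lambda>t. \<xi> (F (inv_into U \<phi> t))"
  define S where "S = S0 \<inter> ?g -` T"
  have S: "open S" unfolding S_def
    by (rule continuous_open_preimage[OF smooth_on_continuous[OF S0(5)] S0(1) T(1)])
  have "smooth_on S (\<lambda>t. f (inv_into W \<xi> (?g t)))"
    by (rule smooth_on_compose[OF S T(1) _ smooth_on_subset[OF S0(5)] T(4)]) (auto simp: S_def)
  then have "smooth_on S (\<lambda>t. f (F (inv_into U \<phi> t)))"
    by (rule smooth_on_cong[OF S, rotated]) (simp add: S_def chart_inv[OF W(1)] S0(4))
  then show ?thesis
    using S0(2,3) T(3) by (intro smooth_atI[OF U S]) (auto simp: S_def chart_inv[OF U])
qed

text \<open>Freezing one coordinate of the smooth multiplication map gives the translation on a
  slice of its open domain.\<close>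

lemma smooth_at_translate:
  shows "smooth_at f (a + p) \<Longrightarrow> smooth_at (\<lambda>x. f (a + x)) p"
    and "smooth_at f (p + a) \<Longrightarrow> smooth_at (\<lambda>x. f (x + a)) p"
proof -
  obtain U \<phi> where U: "(U, \<phi>) \<in> \<A>" "p \<in> U" by (rule obtain_chart)
  obtain V \<psi> where V: "(V, \<psi>) \<in> \<A>" "a \<in> V" by (rule obtain_chart)
  have inj: "x = y" if "x \<in> V" "y \<in> V" "\<psi> x = \<psi> y" for x y
    using chart_inv[OF V(1)] that by metis
  note simps = chart_inv[OF V(1)] chart_inv[OF U(1)]
  {
    assume f: "smooth_at f (a + p)"
    obtain W \<xi> where W: "(W, \<xi>) \<in> \<A>" "a + p \<in> W" by (rule obtain_chart)
    let ?O = "{(\<psi> x, \<phi> y) | x y. x \<in> V \<and> y \<in> U \<and> x + y \<in> W}"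
    have O: "open ?O" using chart_open[OF W(1)] by (intro open_mult_domain V U) auto
    define S where "S = {t. (\<psi> a, t) \<in> ?O}"
    have S: "open S" unfolding S_def by (rule open_slice(2)[OF O])
    have "smooth_on S (\<lambda>t. (\<psi> a, t))"
      using S by (intro smooth_on_Pair smooth_on_const) (auto intro: smooth_on_bounded_linear bounded_linear_ident)
    then have "smooth_on S (\<lambda>t. (\<lambda>(s, t). \<xi> (inv_into V \<psi> s + inv_into U \<phi> t)) (\<psi> a, t))"
      by (rule smooth_on_compose[OF S O _ _ mult_smooth[OF V(1) U(1) W(1)], rotated]) (auto simp: S_def)
    then show "smooth_at (\<lambda>x. f (a + x)) p"
      using U V W by (intro smooth_at_compose[where F="\<lambda>x. a + x", OF f U W S]) (auto simp: S_def simps dest: inj[OF V(2)])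
  }
  {
    assume f: "smooth_at f (p + a)"
    obtain W \<xi> where W: "(W, \<xi>) \<in> \<A>" "p + a \<in> W" by (rule obtain_chart)
    let ?O = "{(\<phi> x, \<psi> y) | x y. x \<in> U \<and> y \<in> V \<and> x + y \<in> W}"
    have O: "open ?O" using chart_open[OF W(1)] by (intro open_mult_domain V U) auto
    define S where "S = {t. (t, \<psi> a) \<in> ?O}"
    have S: "open S" unfolding S_def by (rule open_slice(1)[OF O])
    have "smooth_on S (\<lambda>t. (t, \<psi> a))"
      using S by (intro smooth_on_Pair smooth_on_const) (auto intro: smooth_on_bounded_linear bounded_linear_ident)
    then have "smooth_on S (\<lambda>t. (\<lambda>(s, t). \<xi> (inv_into U \<phi> s + inv_into V \<psi> t)) (t, \<psi> a))"
      by (rule smooth_on_compose[OF S O _ _ mult_smooth[OF U(1) V(1) W(1)], rotated]) (auto simp: S_def)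
    then show "smooth_at (\<lambda>x. f (x + a)) p"
      using U V W by (intro smooth_at_compose[where F="\<lambda>x. x + a", OF f U W S]) (auto simp: S_def simps dest: inj[OF V(2)])
  }
qed

lemma smooth_functions_translate:
  assumes "f \<in> smooth_functions"
  shows "(\<lambda>x. f (a + x)) \<in> smooth_functions" and "(\<lambda>x. f (x + a)) \<in> smooth_functions"
  using assms smooth_at_translate by (auto simp: smooth_functions_iff)

lemma left_invariant_at:
  assumes "D \<in> left_invariant_fields" "f \<in> smooth_functions"
  shows "D f a = D (\<lambda>x. f (a + x)) 0"
  using assms by (simp add: left_invariant_fields_def)

end

text \<open>A single chart around the identity suffices: left invariance and conjugation move every
  computation there.\<close>

locale lie_group_chart = lie_group \<A>
  for \<A> :: "('g::{topological_group_add, t2_space, second_countable_topology} set \<times>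
              ('g \<Rightarrow> 'e::euclidean_space)) set" +
  fixes U :: "'g set" and \<phi> :: "'g \<Rightarrow> 'e"
  assumes chart0: "(U, \<phi>) \<in> \<A>" and zero_U: "0 \<in> U"
begin

abbreviation P :: "'e \<Rightarrow> 'g" where "P \<equiv> inv_into U \<phi>"
abbreviation z :: 'e where "z \<equiv> \<phi> 0"
abbreviation \<Omega> :: "'e set" where "\<Omega> \<equiv> \<phi> ` U"

abbreviation der_z :: "('e \<Rightarrow> real) \<Rightarrow> 'e \<Rightarrow> real" where
  "der_z F \<equiv> fder F z"

definition dir :: "'e \<Rightarrow> ('g \<Rightarrow> real) \<Rightarrow> real" where
  "dir y g = der_z (\<lambda>t. g (P t)) y"

lemma P_z [simp]: "P z = 0"
  by (rule chart_inv[OF chart0 zero_U])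

lemma z_\<Omega> [simp]: "z \<in> \<Omega>"
  using zero_U by simp

lemma open_\<Omega>: "open \<Omega>" and open_U: "open U"
  using chart_open[OF chart0] by auto

lemma smooth_on_P: "f \<in> smooth_functions \<Longrightarrow> smooth_on \<Omega> (\<lambda>t. f (P t))"
  using smooth_functions_chart[OF _ chart0] .

subsection \<open>Derivations at the identity are directional derivatives\<close>

lemma smooth_on_coordinate:
  fixes i c :: "'v::euclidean_space"
  shows "open S \<Longrightarrow> smooth_on S (\<lambda>x. (x - c) \<bullet> i)"
proof -
  assume S: "open S"
  have "smooth_on S (\<lambda>x. x \<bullet> i + (- c) \<bullet> i)"
    by (intro smooth_on_add smooth_on_const smooth_on_bounded_linear bounded_linear_inner_left S)
  then show ?thesis by (simp add: inner_diff_left)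
qed

text \<open>Hadamard's lemma writes \<open>f - f 0\<close> near the identity as a sum of coordinates
  times smooth factors, and the product rule evaluates it. A derivation takes global functions, so
  coordinates and factors are first multiplied by a bump.\<close>

lemma vector_field_dir:
  assumes D: "D \<in> vector_fields"
  shows "\<exists>y. \<forall>f\<in>smooth_functions. D f 0 = dir y f"
proof -
  obtain r where r: "r > 0" "ball z r \<subseteq> \<Omega>" using openE[OF open_\<Omega> z_\<Omega>] .
  define \<rho> where "\<rho> = r / 2"
  have \<rho>: "\<rho> > 0" "\<rho> < r" using r by (auto simp: \<rho>_def)
  \<comment> \<open>Supported in the closed ball of radius \<open>\<rho>\<close>, strictly inside
    the chart. Its image in the group is compact, hence closed, so extension by zero stays
    smooth.\<close>
  define \<beta> where "\<beta> x = bump 1 (\<rho>\<^sup>2 - (\<Sum>i\<in>Basis. ((x - z) \<bullet> i) * ((x - z) \<bullet> i)))" for x :: 'e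
  have norm: "(\<Sum>i\<in>Basis. ((x - z) \<bullet> i) * ((x - z) \<bullet> i)) = (dist z x)\<^sup>2" for x
    by (simp add: dist_norm norm_minus_commute power2_norm_eq_inner euclidean_inner[of "x - z" "x - z", symmetric])
  have \<beta>0: "\<beta> x = 0" if "x \<notin> cball z \<rho>" for x
  proof -
    have "\<rho>\<^sup>2 \<le> (dist z x)\<^sup>2" using that \<rho> by (intro power_mono) auto
    then show ?thesis by (simp add: \<beta>_def norm bump_def)
  qed
  have \<beta>z: "\<beta> z \<noteq> 0" using \<rho> by (simp add: \<beta>_def bump_def)
  have smooth_\<beta>: "smooth_on S \<beta>" if "open S" for S
  proof -
    have "smooth_on S (\<lambda>x. \<Sum>i\<in>Basis. ((x - z) \<bullet> i) * ((x - z) \<bullet> i))"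
      unfolding smooth_on_def
    proof (intro allI Ck_on_sum[OF that])
      fix k and i :: 'e
      have "smooth_on S (\<lambda>x. ((x - z) \<bullet> i) * ((x - z) \<bullet> i))"
        by (intro smooth_on_mult smooth_on_coordinate that)
      then show "Ck_on k S (\<lambda>x. ((x - z) \<bullet> i) * ((x - z) \<bullet> i))" by (simp add: smooth_on_def)
    qed
    then have "smooth_on S (\<lambda>x. (-1) * (\<Sum>i\<in>Basis. ((x - z) \<bullet> i) * ((x - z) \<bullet> i)))"
      by (intro smooth_on_mult smooth_on_const that)
    then have "smooth_on S (\<lambda>x. \<rho>\<^sup>2 + (-1) * (\<Sum>i\<in>Basis. ((x - z) \<bullet> i) * ((x - z) \<bullet> i)))"
      by (intro smooth_on_add smooth_on_const that)
    then have "smooth_on S (\<lambda>x. \<rho>\<^sup>2 - (\<Sum>i\<in>Basis. ((x - z) \<bullet> i) * ((x - z) \<bullet> i)))" by simp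
    then show ?thesis unfolding \<beta>_def
      by (rule smooth_on_compose[OF that open_UNIV _ _ smooth_on_bump, rotated]) auto
  qed
  define cut where "cut g p = (if p \<in> U then \<beta> (\<phi> p) * g (\<phi> p) else 0)" for g p
  have cut_smooth: "cut g \<in> smooth_functions" if g: "smooth_on (ball z r) g" for g
    unfolding smooth_functions_iff
  proof
    fix p
    have "compact (P ` cball z \<rho>)"
      using r \<rho> by (intro compact_continuous_image continuous_on_subset[OF chart_inv_continuous[OF chart0]]) auto
    then have op: "open (- P ` cball z \<rho>)" using compact_imp_closed by blast
    show "smooth_at (cut g) p"
    proof (cases "p \<in> P ` cball z \<rho>")
      case True
      then obtain x where x: "p = P x" "x \<in> ball z r" using \<rho> by auto
      have "smooth_on (ball z r) (\<lambda>x. \<beta> x * g x)" by (intro smooth_on_mult smooth_\<beta> g) auto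
      then have "smooth_on (ball z r) (\<lambda>x. cut g (P x))"
      proof (rule smooth_on_cong[OF open_ball, rotated])
        fix x assume "x \<in> ball z r"
        then have "x \<in> \<Omega>" using r by auto
        then show "\<beta> x * g x = cut g (P x)"
          using chart_inv_mem[OF chart0] chart_inv_right[OF chart0] by (simp add: cut_def)
      qed
      then show ?thesis
        using x r chart_inv_mem[OF chart0] chart_inv_right[OF chart0]
        by (intro smooth_atI[OF chart0 _ open_ball r(2)]) auto
    next
      case False
      obtain V \<psi> where V: "(V, \<psi>) \<in> \<A>" "p \<in> V" by (rule obtain_chart)
      define S where "S = \<psi> ` (V \<inter> - P ` cball z \<rho>)"
      have S: "open S" unfolding S_def by (rule chart_image_open[OF V(1) op])
      have "cut g q = 0" if "q \<notin> P ` cball z \<rho>" for q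
      proof (cases "q \<in> U")
        case True
        then have "\<phi> q \<notin> cball z \<rho>" using that chart_inv[OF chart0 True] by (metis imageI)
        then show ?thesis by (simp add: cut_def \<beta>0)
      qed (simp add: cut_def)
      then have "0 = cut g (inv_into V \<psi> s)" if "s \<in> S" for s
        using that chart_inv[OF V(1)] by (auto simp: S_def)
      then have "smooth_on S (\<lambda>s. cut g (inv_into V \<psi> s))"
        by (rule smooth_on_cong[OF S _ smooth_on_const[of S 0]])
      then show ?thesis
        using V False S by (intro smooth_atI[OF V S]) (auto simp: S_def)
    qed
  qed
  define co where "co i = cut (\<lambda>x. (x - z) \<bullet> i)" for i
  have co: "co i \<in> smooth_functions" for i unfolding co_def by (intro cut_smooth smooth_on_coordinate open_ball)
  define B where "B = cut (\<lambda>x. 1)"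
  have B: "B \<in> smooth_functions" unfolding B_def by (intro cut_smooth smooth_on_const)
  have B0: "B 0 = \<beta> z" by (simp add: B_def cut_def zero_U)
  \<comment> \<open>The components are the values of \<open>D\<close> on the cut-off coordinates;
    division by \<open>\<beta> z\<close> undoes the bump.\<close>
  define y where "y = (\<Sum>i\<in>Basis. (D (co i) 0 / \<beta> z) *\<^sub>R i)"
  have "D f 0 = dir y f" if f: "f \<in> smooth_functions" for f
  proof -
    let ?f = "\<lambda>t. f (P t)"
    have fs: "smooth_on (ball z r) ?f" using smooth_on_P[OF f] r(2) by (rule smooth_on_subset)
    obtain g where g: "\<And>i. i \<in> Basis \<Longrightarrow> smooth_on (ball z r) (g i)"
      "\<And>i. i \<in> Basis \<Longrightarrow> g i z = der_z ?f i"
      "\<And>x. x \<in> ball z r \<Longrightarrow> ?f x = ?f z + (\<Sum>i\<in>Basis. ((x - z) \<bullet> i) * g i x)"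
      using hadamard[OF fs r(1)] by blast
    have G: "cut (g i) \<in> smooth_functions" if "i \<in> Basis" for i using g(1)[OF that] by (rule cut_smooth)
    have BB: "(\<lambda>p. B p * B p) \<in> smooth_functions" by (intro smooth_functions_mult B)
    have f0: "(\<lambda>p. f p + - f 0) \<in> smooth_functions" by (intro smooth_functions_add f smooth_functions_const)
    \<comment> \<open>Each product on the right carries two bumps, which is why \<open>B\<close>
      appears twice on the left; outside the ball both sides are zero.\<close>
    have eq: "(\<lambda>p. B p * B p * (f p + - f 0)) = (\<lambda>p. \<Sum>i\<in>Basis. co i p * cut (g i) p)"
    proof
      fix p
      show "B p * B p * (f p + - f 0) = (\<Sum>i\<in>Basis. co i p * cut (g i) p)"
      proof (cases "p \<in> U \<and> \<phi> p \<in> ball z r")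
        case True
        then have "f p = f 0 + (\<Sum>i\<in>Basis. ((\<phi> p - z) \<bullet> i) * g i (\<phi> p))"
          using g(3)[of "\<phi> p"] chart_inv[OF chart0] by simp
        then show ?thesis using True by (simp add: B_def co_def cut_def sum_distrib_left ac_simps)
      next
        case False
        then have "B p = 0 \<and> (\<forall>i. co i p = 0)"
          using \<beta>0[of "\<phi> p"] \<rho> by (auto simp: B_def co_def cut_def)
        then show ?thesis by simp
      qed
    qed
    have "D (\<lambda>p. B p * B p * (f p + - f 0)) 0 = (\<beta> z)\<^sup>2 * D f 0"
      using vector_field_mult[OF D BB f0] vector_field_add[OF D f smooth_functions_const, of "- f 0"]
      by (simp add: vector_field_const[OF D] B0 power2_eq_square)
    moreover have "D (\<lambda>p. \<Sum>i\<in>Basis. co i p * cut (g i) p) 0 = (\<Sum>i\<in>Basis. D (co i) 0 * (\<beta> z * g i z))"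
    proof -
      have co0: "co i 0 = 0" for i by (simp add: co_def cut_def)
      have "D (\<lambda>p. \<Sum>i\<in>Basis. co i p * cut (g i) p) = (\<lambda>p. \<Sum>i\<in>Basis. D (\<lambda>p. co i p * cut (g i) p) p)"
        by (intro vector_field_sum[OF D] smooth_functions_mult co G)
      then have "D (\<lambda>p. \<Sum>i\<in>Basis. co i p * cut (g i) p) 0 = (\<Sum>i\<in>Basis. D (\<lambda>p. co i p * cut (g i) p) 0)"
        by simp
      also have "\<dots> = (\<Sum>i\<in>Basis. D (co i) 0 * (\<beta> z * g i z))"
        by (intro sum.cong refl) (simp add: vector_field_mult[OF D co G] co0, simp add: cut_def zero_U)
      finally show ?thesis .
    qed
    ultimately have "(\<beta> z)\<^sup>2 * D f 0 = (\<Sum>i\<in>Basis. D (co i) 0 * (\<beta> z * g i z))" by (simp only: eq)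
    then have "D f 0 = (\<Sum>i\<in>Basis. D (co i) 0 * (\<beta> z * g i z)) / (\<beta> z)\<^sup>2"
      using \<beta>z by (simp add: eq_divide_eq mult.commute)
    also have "\<dots> = (\<Sum>i\<in>Basis. (D (co i) 0 / \<beta> z) * g i z)"
      unfolding sum_divide_distrib using \<beta>z by (intro sum.cong refl) (simp add: power2_eq_square)
    also have "\<dots> = (\<Sum>i\<in>Basis. (D (co i) 0 / \<beta> z) * der_z ?f i)"
      by (intro sum.cong refl) (simp add: g(2))
    also have "\<dots> = der_z ?f y"
    proof -
      have lin: "linear (der_z ?f)"
        by (rule has_derivative_linear[OF smooth_on_has_derivative[OF smooth_on_P[OF f] z_\<Omega>]])
      show ?thesis by (simp add: y_def linear_sum[OF lin] linear_scale[OF lin])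
    qed
    finally show ?thesis by (simp add: dir_def)
  qed
  then show ?thesis by blast
qed

subsection \<open>The adjoint action on functions\<close>

definition mul :: "'e \<times> 'e \<Rightarrow> 'e" where "mul = (\<lambda>(s, t). \<phi> (P s + P t))"
definition mul_dom :: "('e \<times> 'e) set" where
  "mul_dom = {(\<phi> x, \<phi> y) | x y. x \<in> U \<and> y \<in> U \<and> x + y \<in> U}"
definition neg :: "'e \<Rightarrow> 'e" where "neg t = \<phi> (- P t)"
definition neg_dom :: "'e set" where "neg_dom = {\<phi> x | x. x \<in> U \<and> - x \<in> U}"

lemma mul_dom_iff: "(s, t) \<in> mul_dom \<longleftrightarrow> s \<in> \<Omega> \<and> t \<in> \<Omega> \<and> P s + P t \<in> U"
  using chart_inv[OF chart0] by (force simp: mul_dom_def)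

lemma neg_dom_iff: "t \<in> neg_dom \<longleftrightarrow> t \<in> \<Omega> \<and> - P t \<in> U"
  using chart_inv[OF chart0] by (force simp: neg_dom_def)

lemma open_mul_dom: "open mul_dom"
  unfolding mul_dom_def by (rule open_mult_domain[OF chart0 chart0 open_U])

lemma open_neg_dom: "open neg_dom"
proof -
  have "open (\<Omega> \<inter> (\<lambda>t. - P t) -` U)"
    by (intro continuous_open_preimage open_\<Omega> open_U continuous_on_minus chart_inv_continuous[OF chart0])
  moreover have "\<Omega> \<inter> (\<lambda>t. - P t) -` U = neg_dom" using neg_dom_iff by blast
  ultimately show ?thesis by simp
qed

lemma smooth_mul: "smooth_on mul_dom mul"
  unfolding mul_dom_def mul_def by (rule mult_smooth[OF chart0 chart0 chart0])

lemma smooth_neg: "smooth_on neg_dom neg"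
  unfolding neg_dom_def neg_def using inverse_smooth[OF chart0 chart0] .

lemma P_mul: "(s, t) \<in> mul_dom \<Longrightarrow> P (mul (s, t)) = P s + P t"
  by (simp add: mul_dom_iff mul_def chart_inv[OF chart0])

lemma P_neg: "t \<in> neg_dom \<Longrightarrow> P (neg t) = - P t"
  by (simp add: neg_dom_iff neg_def chart_inv[OF chart0])

lemma mul_in: "p \<in> mul_dom \<Longrightarrow> mul p \<in> \<Omega>"
  by (cases p) (auto simp: mul_dom_iff mul_def)

lemma neg_z [simp]: "neg z = z"
  by (simp add: neg_def)

lemma z_neg_dom [simp]: "z \<in> neg_dom"
  using zero_U by (simp add: neg_dom_iff)

lemma mul_z_right: "s \<in> \<Omega> \<Longrightarrow> (s, z) \<in> mul_dom" "s \<in> \<Omega> \<Longrightarrow> mul (s, z) = s"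
  using chart_inv_mem[OF chart0] chart_inv_right[OF chart0] by (auto simp: mul_dom_iff mul_def)

lemma mul_z_left: "s \<in> \<Omega> \<Longrightarrow> (z, s) \<in> mul_dom" "s \<in> \<Omega> \<Longrightarrow> mul (z, s) = s"
  using chart_inv_mem[OF chart0] chart_inv_right[OF chart0] by (auto simp: mul_dom_iff mul_def)

text \<open>Three independent factors allow the two occurrences of the conjugating element to be
  differentiated separately.\<close>

definition mul3_dom :: "('e \<times> 'e \<times> 'e) set" where
  "mul3_dom = {(b, c, d). (b, c) \<in> mul_dom \<and> (mul (b, c), d) \<in> mul_dom}"

lemma mul3_smooth:
  shows "open mul3_dom"
    and "f \<in> smooth_functions \<Longrightarrow> smooth_on mul3_dom (\<lambda>(b, c, d). f (P b + P c + P d))"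
proof -
  let ?O1 = "(\<lambda>p. (fst p, fst (snd p))) -` mul_dom :: ('e \<times> 'e \<times> 'e) set"
  let ?G = "\<lambda>p. (mul (fst p, fst (snd p)), snd (snd p))"
  have O1: "open ?O1" by (intro open_vimage open_mul_dom continuous_intros)
  have bl: "bounded_linear (\<lambda>p::'e \<times> 'e \<times> 'e. (fst p, fst (snd p)))" "bounded_linear (\<lambda>p::'e \<times> 'e \<times> 'e. snd (snd p))"
    by (intro bounded_linear_intros)+
  have "smooth_on ?O1 (\<lambda>p. mul (fst p, fst (snd p)))"
    by (rule smooth_on_compose[OF O1 open_mul_dom _ smooth_on_bounded_linear[OF bl(1) O1] smooth_mul]) auto
  then have G: "smooth_on ?O1 ?G"
    by (intro smooth_on_Pair O1 smooth_on_bounded_linear[OF bl(2)])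
  have dom: "mul3_dom = ?O1 \<inter> ?G -` mul_dom" by (auto simp: mul3_dom_def)
  show op: "open mul3_dom"
    unfolding dom by (rule continuous_open_preimage[OF smooth_on_continuous[OF G] O1 open_mul_dom])
  assume f: "f \<in> smooth_functions"
  have "smooth_on mul3_dom (\<lambda>p. mul (?G p))"
    by (rule smooth_on_compose[OF op open_mul_dom _ smooth_on_subset[OF G] smooth_mul]) (auto simp: dom)
  then have "smooth_on mul3_dom (\<lambda>p. f (P (mul (?G p))))"
    by (rule smooth_on_compose[OF op open_\<Omega> _ _ smooth_on_P[OF f], rotated]) (auto simp: dom intro: mul_in)
  then show "smooth_on mul3_dom (\<lambda>(b, c, d). f (P b + P c + P d))"
    by (rule smooth_on_cong[OF op, rotated]) (auto simp: mul3_dom_def P_mul)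
qed

lemma mul3_dom_z: "c \<in> \<Omega> \<Longrightarrow> (z, c, z) \<in> mul3_dom"
  by (simp add: mul3_dom_def mul_z_left mul_z_right)

lemma smooth_sum2:
  assumes "f \<in> smooth_functions"
  shows "smooth_on mul_dom (\<lambda>(s, t). f (P s + P t))"
proof -
  have "smooth_on mul_dom (\<lambda>p. f (P (mul p)))"
    by (rule smooth_on_compose[OF open_mul_dom open_\<Omega> _ smooth_mul smooth_on_P[OF assms]]) (auto intro: mul_in)
  then show ?thesis
    by (rule smooth_on_cong[OF open_mul_dom, rotated]) (auto simp: P_mul)
qed

lemma neg_differentiable: "neg differentiable at z"
  using smooth_on_has_derivative[OF smooth_neg z_neg_dom] by (auto simp: differentiable_def)

lemma dir_cong_neg_dom:
  assumes "\<And>t. t \<in> neg_dom \<Longrightarrow> F t = G t"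
  shows "der_z F = der_z G"
  by (rule frechet_derivative_cong_open(1)[OF open_neg_dom z_neg_dom assms])

text \<open>The function \<open>f (P t + P (neg t))\<close> is constant near \<open>z\<close>, so
  its two partial contributions cancel.\<close>

lemma dir_inverse:
  assumes f: "f \<in> smooth_functions"
  shows "der_z (\<lambda>t. f (- P t)) y = - der_z (\<lambda>t. f (P t)) y"
proof -
  let ?K = "\<lambda>(s, t). f (P s + P t)"
  have K: "?K differentiable at (z, z)"
    using smooth_on_has_derivative[OF smooth_sum2[OF f] mul_z_left(1)[OF z_\<Omega>]] by (auto simp: differentiable_def)
  have "der_z (\<lambda>t. ?K (t, neg t)) y =
      der_z (\<lambda>t. ?K (t, z)) y + der_z (\<lambda>t. ?K (z, neg t)) y"
    by (rule derivative_along_graph[OF K neg_differentiable neg_z])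
  moreover have "der_z (\<lambda>t. ?K (t, neg t)) = der_z (\<lambda>t. f 0)"
    by (rule dir_cong_neg_dom) (simp add: P_neg)
  moreover have "der_z (\<lambda>t. ?K (z, neg t)) = der_z (\<lambda>t. f (- P t))"
    by (rule dir_cong_neg_dom) (simp add: P_neg)
  ultimately show ?thesis by (simp add: frechet_derivative_const)
qed

text \<open>The adjoint transform by \<open>a\<close> of the tangent vector \<open>x\<close>,
  applied to \<open>f\<close>; conjugation is written additively.\<close>

definition adjoint_fun :: "'e \<Rightarrow> ('g \<Rightarrow> real) \<Rightarrow> 'g \<Rightarrow> real" where
  "adjoint_fun x f a = dir x (\<lambda>c. f (a + c - a))"

definition conj_dom :: "('e \<times> 'e) set" where
  "conj_dom = {(t, s). t \<in> neg_dom \<and> (t, s, neg t) \<in> mul3_dom}"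

lemma conj_smooth:
  shows "open conj_dom"
    and "f \<in> smooth_functions \<Longrightarrow> smooth_on conj_dom (\<lambda>(t, s). f (P t + P s - P t))"
proof -
  let ?O1 = "fst -` neg_dom :: ('e \<times> 'e) set"
  let ?G = "\<lambda>p::'e \<times> 'e. (fst p, snd p, neg (fst p))"
  have O1: "open ?O1" by (intro open_vimage open_neg_dom continuous_intros)
  have "smooth_on ?O1 (\<lambda>p. neg (fst p))"
    by (rule smooth_on_compose[OF O1 open_neg_dom _ smooth_on_bounded_linear[OF bounded_linear_fst O1] smooth_neg]) auto
  then have G: "smooth_on ?O1 ?G"
    by (intro smooth_on_Pair O1 smooth_on_bounded_linear[OF bounded_linear_fst] smooth_on_bounded_linear[OF bounded_linear_snd])
  have dom: "conj_dom = ?O1 \<inter> ?G -` mul3_dom" by (auto simp: conj_dom_def)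
  show op: "open conj_dom"
    unfolding dom by (rule continuous_open_preimage[OF smooth_on_continuous[OF G] O1 mul3_smooth(1)])
  assume f: "f \<in> smooth_functions"
  have "smooth_on conj_dom (\<lambda>p. (\<lambda>(b, c, d). f (P b + P c + P d)) (?G p))"
    by (rule smooth_on_compose[OF op mul3_smooth(1) _ smooth_on_subset[OF G] mul3_smooth(2)[OF f]]) (auto simp: dom)
  then show "smooth_on conj_dom (\<lambda>(t, s). f (P t + P s - P t))"
    by (rule smooth_on_cong[OF op, rotated]) (auto simp: conj_dom_def P_neg)
qed

lemma conj_dom_z: "s \<in> \<Omega> \<Longrightarrow> (z, s) \<in> conj_dom"
  by (simp add: conj_dom_def mul3_dom_z)

lemma left_invariant_dir:
  assumes "D \<in> left_invariant_fields"
  shows "\<exists>y. \<forall>f\<in>smooth_functions. \<forall>a. D f a = der_z (\<lambda>t. f (a + P t)) y"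
proof -
  have "D \<in> vector_fields" using assms by (simp add: left_invariant_fields_def)
  then obtain y where y: "\<And>f. f \<in> smooth_functions \<Longrightarrow> D f 0 = dir y f" using vector_field_dir by blast
  have "D f a = der_z (\<lambda>t. f (a + P t)) y" if f: "f \<in> smooth_functions" for f a
  proof -
    have "D f a = D (\<lambda>x. f (a + x)) 0" by (rule left_invariant_at[OF assms f])
    also have "\<dots> = dir y (\<lambda>x. f (a + x))" by (rule y[OF smooth_functions_translate(1)[OF f]])
    finally show ?thesis by (simp add: dir_def)
  qed
  then show ?thesis by blast
qed

text \<open>Conjugation by \<open>p + b\<close> is conjugation by \<open>b\<close> followed by
  conjugation by \<open>p\<close>. A statement at any point thus becomes one at the identity about a
  conjugated function.\<close>

lemma adjoint_fun_shift: "adjoint_fun x f (p + b) = adjoint_fun x (\<lambda>q. f (p + q - p)) b"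
proof -
  have "p + b + c - (p + b) = p + (b + c - b) - p" for c
    by (simp add: diff_conv_add_uminus minus_add add.assoc del: add_uminus_conv_diff)
  then show ?thesis by (simp add: adjoint_fun_def)
qed

lemma conj_smooth_functions:
  assumes "f \<in> smooth_functions"
  shows "(\<lambda>q. f (p + q - p)) \<in> smooth_functions"
  using smooth_functions_translate(1)[OF smooth_functions_translate(2)[OF assms, of "- p"], of p] by simp

lemma adjoint_fun_smooth:
  assumes "f \<in> smooth_functions"
  shows "adjoint_fun x f \<in> smooth_functions"
proof -
  have at0: "smooth_at (adjoint_fun x g) 0" if g: "g \<in> smooth_functions" for g
  proof -
    let ?S = "{t. (t, z) \<in> conj_dom}"
    have S: "open ?S" by (rule open_slice(1)[OF conj_smooth(1)])
    have "smooth_on ?S (\<lambda>t. der_z (\<lambda>s. (\<lambda>(t, s). g (P t + P s - P t)) (t, s)) x)"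
      by (rule smooth_partial_derivative[OF conj_smooth(1) conj_smooth(2)[OF g]])
    then have "smooth_on ?S (\<lambda>t. adjoint_fun x g (P t))" by (simp add: adjoint_fun_def dir_def)
    moreover have "?S \<subseteq> \<Omega>" by (auto simp: conj_dom_def neg_dom_iff)
    ultimately show ?thesis
      using conj_dom_z[OF z_\<Omega>] by (intro smooth_atI[OF chart0 zero_U S]) auto
  qed
  show ?thesis
    unfolding smooth_functions_iff
  proof
    fix p
    have "smooth_at (\<lambda>a. adjoint_fun x (\<lambda>q. f (p + q - p)) (- p + a)) p"
      using at0[OF conj_smooth_functions[OF assms]] by (intro smooth_at_translate(1)) simp
    then show "smooth_at (adjoint_fun x f) p" by (simp add: adjoint_fun_shift[symmetric] add.assoc[symmetric])
  qed
qed

text \<open>The derivative of \<open>Ad\<close> at the identity is \<open>ad\<close>, obtained from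
  mixed second derivatives of \<open>f (P t + P s - P t)\<close>.\<close>

lemma dir_adjoint_fun:
  assumes f: "f \<in> smooth_functions"
    and V: "V \<in> left_invariant_fields" "\<And>f a. f \<in> smooth_functions \<Longrightarrow> V f a = der_z (\<lambda>t. f (a + P t)) x"
    and Y: "Y \<in> left_invariant_fields" "\<And>f a. f \<in> smooth_functions \<Longrightarrow> Y f a = der_z (\<lambda>t. f (a + P t)) y"
  shows "Y (adjoint_fun x f) 0 = Y (V f) 0 - V (Y f) 0"
proof -
  let ?Q = "\<lambda>(t, s). f (P t + P s - P t)"
  let ?R = "\<lambda>(t, s). f (P t + P s)"
  have vf: "V \<in> vector_fields" "Y \<in> vector_fields" using V(1) Y(1) by (auto simp: left_invariant_fields_def)
  have Vf: "V f \<in> smooth_functions" and Yf: "Y f \<in> smooth_functions"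
    using vf f by (auto intro: vector_field_smooth)
  \<comment> \<open>For fixed \<open>s\<close> the variable \<open>t\<close> occurs twice; the right
    occurrence is an inverse and contributes with the opposite sign.\<close>
  have inner: "der_z (\<lambda>t. ?Q (t, s)) y =
      der_z (\<lambda>t. ?R (t, s)) y - Y f (P s)" if s: "s \<in> \<Omega>" for s
  proof -
    let ?K = "\<lambda>(b, d). f (P b + P s + P d)"
    have "((\<lambda>p::'e \<times> 'e. (fst p, s, snd p)) has_derivative (\<lambda>p. (fst p, 0, snd p))) (at (z, z))"
      by (auto intro!: derivative_eq_intros)
    from has_derivative_compose[OF this, of "\<lambda>(b, c, d). f (P b + P c + P d)"]
      smooth_on_has_derivative[OF mul3_smooth(2)[OF f] mul3_dom_z[OF s]]
    obtain D where "((\<lambda>p. f (P (fst p) + P s + P (snd p))) has_derivative D) (at (z, z))"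
      by simp blast
    then have "?K differentiable at (z, z)"
      unfolding differentiable_def case_prod_unfold by blast
    from derivative_along_graph[OF this neg_differentiable neg_z, of y]
    have "der_z (\<lambda>t. f (P t + P s + P (neg t))) y =
        der_z (\<lambda>t. f (P t + P s)) y + der_z (\<lambda>t. f (P s + P (neg t))) y"
      by simp
    moreover have "der_z (\<lambda>t. f (P t + P s + P (neg t))) = der_z (\<lambda>t. ?Q (t, s))"
      by (rule dir_cong_neg_dom) (simp add: P_neg)
    moreover have "der_z (\<lambda>t. f (P s + P (neg t))) = der_z (\<lambda>t. f (P s + - P t))"
      by (rule dir_cong_neg_dom) (simp add: P_neg)
    moreover have "der_z (\<lambda>t. f (P s + - P t)) y = - Y f (P s)"
      using dir_inverse[OF smooth_functions_translate(1)[OF f, of "P s"]] by (simp add: Y(2)[OF f])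
    ultimately show ?thesis by simp
  qed
  have "Y (adjoint_fun x f) 0 = der_z (\<lambda>t. der_z (\<lambda>s. ?Q (t, s)) x) y"
    using Y(2)[OF adjoint_fun_smooth[OF f]] by (simp add: adjoint_fun_def dir_def)
  \<comment> \<open>The order is exchanged so that the derivative in \<open>t\<close> is taken at
    fixed \<open>s\<close>; for the part with \<open>?R\<close> it is exchanged back below.\<close>
  also have "\<dots> = der_z (\<lambda>s. der_z (\<lambda>t. ?Q (t, s)) y) x"
    by (rule partial_derivatives_commute[OF conj_smooth(1) conj_smooth(2)[OF f] conj_dom_z[OF z_\<Omega>]])
  also have "\<dots> = der_z (\<lambda>s. der_z (\<lambda>t. ?R (t, s)) y - Y f (P s)) x"
    by (rule fun_cong[OF frechet_derivative_cong_open(1)[OF open_\<Omega> z_\<Omega> inner]])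
  also have "\<dots> = der_z (\<lambda>s. der_z (\<lambda>t. ?R (t, s)) y) x - V (Y f) 0"
  proof -
    have "((\<lambda>s. der_z (\<lambda>t. ?R (t, s)) y) has_derivative
        der_z (\<lambda>s. der_z (\<lambda>t. ?R (t, s)) y)) (at z)"
      by (rule smooth_on_has_derivative[OF smooth_partial_derivative'[OF open_mul_dom smooth_sum2[OF f]]])
        (simp add: mul_z_left)
    moreover have "((\<lambda>s. Y f (P s)) has_derivative der_z (\<lambda>s. Y f (P s))) (at z)"
      by (rule smooth_on_has_derivative[OF smooth_on_P[OF Yf] z_\<Omega>])
    ultimately have "der_z (\<lambda>s. der_z (\<lambda>t. ?R (t, s)) y - Y f (P s)) =
      (\<lambda>v. der_z (\<lambda>s. der_z (\<lambda>t. ?R (t, s)) y) v -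
        der_z (\<lambda>s. Y f (P s)) v)"
      by (rule frechet_derivative_eqI[OF has_derivative_diff])
    then show ?thesis using V(2)[OF Yf, of 0] by simp
  qed
  also have "der_z (\<lambda>s. der_z (\<lambda>t. ?R (t, s)) y) x =
      der_z (\<lambda>t. der_z (\<lambda>s. ?R (t, s)) x) y"
    by (rule partial_derivatives_commute[OF open_mul_dom smooth_sum2[OF f] mul_z_left(1)[OF z_\<Omega>], symmetric])
  also have "\<dots> = Y (V f) 0"
    using Y(2)[OF Vf, of 0] V(2)[OF f] by simp
  finally show ?thesis .
qed

lemma derivation_at_maximum:
  assumes D: "D \<in> left_invariant_fields" and f: "f \<in> smooth_functions" and max: "\<And>q. f q \<le> f p"
  shows "D f p = 0"
proof -
  obtain y where y: "D f p = der_z (\<lambda>t. f (p + P t)) y"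
    using left_invariant_dir[OF D] f by blast
  have "((\<lambda>t. f (p + P t)) has_derivative der_z (\<lambda>t. f (p + P t))) (at z)"
    by (rule smooth_on_has_derivative[OF smooth_on_P[OF smooth_functions_translate(1)[OF f]] z_\<Omega>])
  then have "der_z (\<lambda>t. f (p + P t)) = (\<lambda>v. 0)"
    by (rule differential_zero_maxmin[OF z_\<Omega> open_\<Omega>]) (use max in auto)
  then show ?thesis using y by simp
qed

text \<open>The maximum principle replaces the integral curve of \<open>Y\<close>, along which \<open>adjoint_fun x f\<close> is affine.\<close>

lemma compact_bracket_zero:
  assumes comp: "compact (UNIV :: 'g set)"
    and V: "V \<in> left_invariant_fields" and Y: "Y \<in> left_invariant_fields" and W: "W \<in> left_invariant_fields"
    and YV: "\<And>f p. f \<in> smooth_functions \<Longrightarrow> W f p = Y (V f) p - V (Y f) p"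
    and YW: "\<And>f p. f \<in> smooth_functions \<Longrightarrow> Y (W f) p - W (Y f) p = 0"
    and f: "f \<in> smooth_functions"
  shows "W f p = 0"
proof -
  obtain x where x: "\<And>f a. f \<in> smooth_functions \<Longrightarrow> V f a = der_z (\<lambda>t. f (a + P t)) x"
    using left_invariant_dir[OF V] by blast
  obtain y where y: "\<And>f a. f \<in> smooth_functions \<Longrightarrow> Y f a = der_z (\<lambda>t. f (a + P t)) y"
    using left_invariant_dir[OF Y] by blast
  obtain w where w: "\<And>f a. f \<in> smooth_functions \<Longrightarrow> W f a = der_z (\<lambda>t. f (a + P t)) w"
    using left_invariant_dir[OF W] by blast
  have Yvf: "Y \<in> vector_fields" using Y by (simp add: left_invariant_fields_def)
  have shift: "Y (adjoint_fun v g) a = Y (adjoint_fun v (\<lambda>q. g (a + q - a))) 0" if "g \<in> smooth_functions" for v g a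
    by (subst left_invariant_at[OF Y adjoint_fun_smooth[OF that]]) (simp only: adjoint_fun_shift)
  have W0: "W g 0 = dir w g" if "g \<in> smooth_functions" for g
    using w[OF that, of 0] by (simp add: dir_def)
  have zero: "W g 0 = 0" if g: "g \<in> smooth_functions" for g
  proof -
    let ?F = "adjoint_fun x g" and ?G = "adjoint_fun w g"
    have F: "?F \<in> smooth_functions" and G: "?G \<in> smooth_functions" using g by (auto intro: adjoint_fun_smooth)
    have YF: "Y ?F a = ?G a" for a
    proof -
      let ?g = "\<lambda>q. g (a + q - a)"
      have cg: "?g \<in> smooth_functions" by (rule conj_smooth_functions[OF g])
      have "Y ?F a = Y (V ?g) 0 - V (Y ?g) 0"
        unfolding shift[OF g] by (rule dir_adjoint_fun[OF cg V x Y y])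
      also have "\<dots> = ?G a" using YV[OF cg] W0[OF cg] by (simp add: adjoint_fun_def)
      finally show ?thesis .
    qed
    have YG: "Y ?G a = 0" for a
    proof -
      let ?g = "\<lambda>q. g (a + q - a)"
      have cg: "?g \<in> smooth_functions" by (rule conj_smooth_functions[OF g])
      have "Y ?G a = Y (W ?g) 0 - W (Y ?g) 0"
        unfolding shift[OF g] by (rule dir_adjoint_fun[OF cg W w Y y])
      then show ?thesis using YW[OF cg] by simp
    qed
    obtain M where M: "\<And>a. ?F a \<le> M"
      using continuous_attains_sup[OF comp _ smooth_functions_continuous[OF F]] by auto
    have bound: "?F a + k * ?G a \<le> M" for a k
    proof -
      let ?H = "\<lambda>a. ?F a + k * ?G a"
      have kG: "(\<lambda>a. k * ?G a) \<in> smooth_functions" by (intro smooth_functions_mult smooth_functions_const G)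
      have H: "?H \<in> smooth_functions" by (intro smooth_functions_add F kG)
      obtain p where p: "\<And>a. ?H a \<le> ?H p"
        using continuous_attains_sup[OF comp _ smooth_functions_continuous[OF H]] by auto
      have "Y ?H p = 0" by (rule derivation_at_maximum[OF Y H p])
      moreover have "Y ?H p = ?G p"
        by (simp add: vector_field_add[OF Yvf F kG] vector_field_scale[OF Yvf G] YF YG)
      ultimately have "?H p \<le> M" using M[of p] by simp
      then show ?thesis using p[of a] by linarith
    qed
    have "?G 0 = 0"
    proof (rule ccontr)
      assume ne: "?G 0 \<noteq> 0"
      \<comment> \<open>This choice of \<open>k\<close> turns the bound into
        \<open>M + 1 \<le> M\<close>.\<close>
      have "?F 0 + (M - ?F 0 + 1) / ?G 0 * ?G 0 \<le> M" by (rule bound)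
      then show False using ne by simp
    qed
    then show ?thesis using W0[OF g] by (simp add: adjoint_fun_def)
  qed
  have "W f p = W (\<lambda>x. f (p + x)) 0" by (rule left_invariant_at[OF W f])
  then show ?thesis using zero smooth_functions_translate(1)[OF f] by simp
qed

end

context lie_group
begin

lemma compact_ad_square_zero:
  assumes comp: "compact (UNIV :: 'g set)" and iso: "lie_algebra_iso br \<Phi>"
    and zero: "br y (br y v) = 0"
  shows "br y v = 0"
proof -
  have bij: "bij_betw \<Phi> UNIV left_invariant_fields"
    and add: "\<And>x y. \<Phi> (x + y) = (\<lambda>f p. \<Phi> x f p + \<Phi> y f p)"
    and brk: "\<And>x y. \<Phi> (br x y) = (\<lambda>f p. \<Phi> x (\<Phi> y f) p - \<Phi> y (\<Phi> x f) p)"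
    using iso by (auto simp: lie_algebra_iso_def)
  have L: "\<Phi> x \<in> left_invariant_fields" for x using bij by (auto simp: bij_betw_def)
  have \<Phi>0: "\<Phi> 0 f p = 0" for f p using fun_cong[OF fun_cong[OF add[of 0 0]], of f p] by simp
  obtain U \<phi> where "(U, \<phi>) \<in> \<A>" "0 \<in> U" by (rule obtain_chart)
  then interpret lie_group_chart \<A> U \<phi> by unfold_locales
  \<comment> \<open>Injectivity of \<open>\<Phi>\<close> needs equality of total operators; on
    functions that are not smooth the value 0 is fixed by convention.\<close>
  have "\<Phi> (br y v) f p = 0" for f p
  proof (cases "f \<in> smooth_functions")
    case True
    show ?thesis
    proof (rule compact_bracket_zero[OF comp L L L _ _ True])
      show "\<Phi> (br y v) f p = \<Phi> y (\<Phi> v f) p - \<Phi> v (\<Phi> y f) p" for f p by (simp only: brk)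
      show "\<Phi> y (\<Phi> (br y v) f) p - \<Phi> (br y v) (\<Phi> y f) p = 0" for f p
        using fun_cong[OF fun_cong[OF brk[of y "br y v"]], of f p] by (simp only: zero \<Phi>0)
    qed
  next
    case False
    then show ?thesis using L[of "br y v"] by (auto simp: left_invariant_fields_def vector_fields_def)
  qed
  then have "\<Phi> (br y v) = \<Phi> 0" by (simp add: fun_eq_iff \<Phi>0)
  then show ?thesis using bij by (auto simp: bij_betw_def dest: injD)
qed

end

section \<open>Self-normalizing normalizers\<close>

context fd_lie_algebra
begin

lemma image_eq_if_inj_on:
  assumes f: "Vector_Spaces.linear scale scale f" and T: "subspace T" "f ` T \<subseteq> T" "inj_on f T"
  shows "f ` T = T"
proof -
  have span: "span T = T" using T(1) by (simp only: span_eq_iff)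
  interpret f: Vector_Spaces.linear scale scale f by fact
  interpret p: finite_dimensional_vector_space_pair scale bas scale bas by unfold_locales
  have "dim (f ` T) = dim T"
    using T(3) by (intro p.dim_image_eq[OF f]) (simp add: span)
  then show ?thesis
    using T by (intro subspace_dim_equal f.subspace_image) auto
qed

text \<open>If no \<open>ad y\<close> has a nilpotent Jordan block of size two, then \<open>h\<close> is the sum of the kernel and
  the image of \<open>ad y\<close> on \<open>h\<close>, so that \<open>x\<close> may be corrected by an element of \<open>h\<close> to lie in the kernel
  of \<open>ad y\<close>.\<close>

lemma self_normalizing_if_ad_square_zero:
  assumes h: "subalgebra h" and ker: "\<And>y v. br y (br y v) = 0 \<Longrightarrow> br y v = 0"
  shows "self_normalizing (normalizer h)"
proof (rule self_normalizing_normalizerI[OF h])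
  fix x y assume x: "x \<in> normalizer (normalizer h)" and y: "y \<in> h"
  have sub: "subspace h" and hh: "\<And>a b. a \<in> h \<Longrightarrow> b \<in> h \<Longrightarrow> br a b \<in> h"
    using h by (auto simp: subalgebra_def)
  interpret A: Vector_Spaces.linear scale scale "br y" by (rule linear_br)
  define w where "w = br y (br y x)"
  have "br x y \<in> normalizer h"
    using x y subset_normalizer[OF h] by (auto simp: normalizer_def[of "normalizer h"])
  then have "br (br x y) y \<in> h" using y by (simp add: normalizer_def)
  moreover have "w = br (br x y) y" unfolding w_def by (subst br_anti) (simp add: br_anti[of y x])
  ultimately have w: "w \<in> h" by simp
  define T where "T = br y ` h"
  have T: "subspace T" unfolding T_def by (rule A.subspace_image[OF sub])
  have Th: "T \<subseteq> h" using hh y by (auto simp: T_def)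
  \<comment> \<open>On the image of \<open>br y\<close> the assumption \<open>ker\<close> excludes a
    kernel, so by dimension \<open>br y\<close> maps \<open>T\<close> onto itself.\<close>
  have "inj_on (br y) T"
  proof (rule inj_onI)
    fix a b assume "a \<in> T" "b \<in> T" and eq: "br y a = br y b"
    then have "a - b \<in> T" using T by (auto intro: subspace_diff)
    then obtain c where c: "a - b = br y c" by (auto simp: T_def)
    have "br y (br y c) = 0" using eq by (simp add: c[symmetric] br_diff_right)
    then have "br y c = 0" by (rule ker)
    then show "a = b" using c by simp
  qed
  then have AT: "br y ` T = T" using Th by (intro image_eq_if_inj_on linear_br T) (auto simp: T_def)
  \<comment> \<open>The aim is \<open>w = br y (br y u')\<close> with \<open>u'\<close> in
    \<open>h\<close>. This is first known only after one more \<open>br y\<close>;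
    \<open>ker\<close> removes the surplus factor, and \<open>T\<close> being its own image restores
    the second one.\<close>
  have "br y w \<in> br y ` T" using w unfolding AT by (simp add: T_def)
  then obtain u where u: "u \<in> h" "br y w = br y (br y u)" by (auto simp: T_def)
  have "br y (br y (br y x - u)) = 0" using u(2) by (simp add: br_diff_right w_def)
  then have "br y (br y x - u) = 0" by (rule ker)
  then have "w = br y u" by (simp add: w_def br_diff_right)
  then have "w \<in> br y ` T" using u(1) AT by (auto simp: T_def)
  then obtain u' where u': "u' \<in> h" "w = br y (br y u')" by (auto simp: T_def)
  then have "br y (br y (x - u')) = 0" by (simp add: br_diff_right w_def)
  then have "br y (x - u') = 0" by (rule ker)
  then have "br x y = - br y u'" by (subst br_anti) (simp add: br_diff_right)
  then show "br x y \<in> h" using hh[OF y u'(1)] subspace_neg[OF sub] by simp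
qed

end

text \<open>Any finite basis bounds the size of independent sets, in particular of
  \<open>extend_basis {}\<close>.\<close>

lemma fd_lie_algebraI:
  fixes scale :: "'k::field \<Rightarrow> 'a::ab_group_add \<Rightarrow> 'a"
  assumes "lie_algebra scale br" "finite_dimensional_vector_space scale basis"
  shows "fd_lie_algebra scale br"
proof -
  interpret lie_algebra scale br by fact
  interpret F: finite_dimensional_vector_space scale basis by fact
  show ?thesis
    by unfold_locales
      (rule F.finiteI_independent, rule independent_extend_basis[OF independent_empty])
qed

lemma linear_real_functional:
  assumes "linear f"
  shows "Vector_Spaces.linear (*\<^sub>R) (*) f"
  using linear_add[OF assms] linear_scale[OF assms]
  by unfold_locales (auto simp: algebra_simps)

lemma self_normalizing_invariant_bilinear_form:
  fixes br :: "'b::real_vector \<Rightarrow> 'b \<Rightarrow> 'b"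
  assumes "real_fd_lie_algebra (*\<^sub>R) br" "lie_algebra.subalgebra (*\<^sub>R) br h"
    and B: "symmetric_bilinear B" and nondeg: "nondegenerate_on h B"
    and pos: "positive_definite_on (orthogonal_compl B h) B" and skew: "ad_skew_on br h B"
  shows "lie_algebra.self_normalizing br (lie_algebra.normalizer br h)"
proof -
  interpret real_fd_lie_algebra "(*\<^sub>R)" br by fact
  show ?thesis
  proof (rule self_normalizing_invariant_form[of h B])
    show "Vector_Spaces.linear (*\<^sub>R) (*) (B x)" for x
      using B by (intro linear_real_functional) (simp add: symmetric_bilinear_def bilinear_def)
    show "B x y = B y x" for x y using B by (simp add: symmetric_bilinear_def)
  qed (use assms nondeg pos skew in \<open>auto simp: nondegenerate_on_def positive_definite_on_def
      orthogonal_compl_def ad_skew_on_def\<close>)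
qed

lemma inner_product_nondegenerate: "inner_product B \<Longrightarrow> nondegenerate_on h B"
  by (auto simp: inner_product_def nondegenerate_on_def positive_definite_on_def)

theorem theorem4p1:
  fixes scale :: "'k::field \<Rightarrow> 'a::ab_group_add \<Rightarrow> 'a"
    and br :: "'a \<Rightarrow> 'a \<Rightarrow> 'a" and h :: "'a set"
    and brR :: "'b::real_vector \<Rightarrow> 'b \<Rightarrow> 'b" and hR :: "'b set"
  shows
    "(lie_algebra scale br \<and> lie_algebra.subalgebra scale br h \<and>
      (lie_algebra.perfect scale br h
       \<or> ((\<exists>basis. finite_dimensional_vector_space scale basis) \<and> CHAR('k) = 0 \<and>
          lie_algebra.radical scale br h \<subseteq> lie_algebra.center br)
      ) \<longrightarrow>
      lie_algebra.subalgebra scale br (lie_algebra.normalizer br h) \<and>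
      lie_algebra.self_normalizing br (lie_algebra.normalizer br h))
     \<and>
     (lie_algebra (*\<^sub>R) brR \<and> lie_algebra.subalgebra (*\<^sub>R) brR hR \<and>
      (\<exists>basis :: 'b set. finite_dimensional_vector_space (*\<^sub>R) basis) \<and>
      ((\<exists>B. symmetric_bilinear B \<and> nondegenerate_on hR B \<and>
            positive_definite_on (orthogonal_compl B hR) B \<and> ad_skew_on brR hR B)
       \<or> compact_lie_algebra TYPE('g::{topological_group_add, t2_space, second_countable_topology})
           TYPE('e::euclidean_space) brR
       \<or> compactly_embedded brR hR
       \<or> (lie_algebra.semisimple (*\<^sub>R) brR \<and>
          (\<exists>\<theta>. cartan_involution brR \<theta> \<and> ({x. \<theta> x = x} \<subseteq> hR \<or> {x. \<theta> x = - x} \<subseteq> hR)))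
      ) \<longrightarrow>
      lie_algebra.subalgebra (*\<^sub>R) brR (lie_algebra.normalizer brR hR) \<and>
      lie_algebra.self_normalizing brR (lie_algebra.normalizer brR hR))"
proof (intro conjI impI; elim conjE exE)
  assume L: "lie_algebra scale br" and h: "lie_algebra.subalgebra scale br h"
    and cases: "lie_algebra.perfect scale br h
       \<or> ((\<exists>basis. finite_dimensional_vector_space scale basis) \<and> CHAR('k) = 0 \<and>
          lie_algebra.radical scale br h \<subseteq> lie_algebra.center br)"
  interpret lie_algebra scale br by fact
  show "subalgebra (normalizer h)" by (rule subalgebra_normalizer[OF h])
  show "self_normalizing (normalizer h)"
    using cases
  proof (elim disjE conjE exE)
    assume "perfect h"
    then show ?thesis by (rule self_normalizing_perfect[OF h])
  next
    fix basis
    assume fd: "finite_dimensional_vector_space scale basis" and char0: "CHAR('k) = 0"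
      and rad: "radical h \<subseteq> center"
    interpret fd_lie_algebra scale br by (rule fd_lie_algebraI[OF L fd])
    show ?thesis by (rule self_normalizing_central_radical[OF h char0 rad])
  qed
next
  fix basis :: "'b set"
  assume L: "lie_algebra (*\<^sub>R) brR" and h: "lie_algebra.subalgebra (*\<^sub>R) brR hR"
    and fd: "finite_dimensional_vector_space (*\<^sub>R) basis"
    and cases: "(\<exists>B. symmetric_bilinear B \<and> nondegenerate_on hR B \<and>
            positive_definite_on (orthogonal_compl B hR) B \<and> ad_skew_on brR hR B)
       \<or> compact_lie_algebra TYPE('g) TYPE('e) brR
       \<or> compactly_embedded brR hR
       \<or> (lie_algebra.semisimple (*\<^sub>R) brR \<and>
          (\<exists>\<theta>. cartan_involution brR \<theta> \<and> ({x. \<theta> x = x} \<subseteq> hR \<or> {x. \<theta> x = - x} \<subseteq> hR)))"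
  have R: "real_fd_lie_algebra (*\<^sub>R) brR"
    using fd_lie_algebraI[OF L fd] by (simp add: real_fd_lie_algebra_def)
  interpret real_fd_lie_algebra "(*\<^sub>R)" brR by (rule R)
  show "subalgebra (normalizer hR)" by (rule subalgebra_normalizer[OF h])
  show "self_normalizing (normalizer hR)"
    using cases
  proof (elim disjE)
    assume "\<exists>B. symmetric_bilinear B \<and> nondegenerate_on hR B \<and>
        positive_definite_on (orthogonal_compl B hR) B \<and> ad_skew_on brR hR B"
    then show ?thesis using self_normalizing_invariant_bilinear_form[OF R h] by blast
  next
    assume compact: "compact_lie_algebra TYPE('g) TYPE('e) brR"
    show ?thesis
    proof (rule self_normalizing_if_ad_square_zero[OF h])
      \<comment> \<open>If the Lie algebra is zero there is nothing to show; the final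
        \<open>blast\<close> disposes of that disjunct.\<close>
      fix y v assume zero: "brR y (brR y v) = 0"
      show "brR y v = 0"
        using compact unfolding compact_lie_algebra_def
      proof (elim disjE conjE exE)
        fix \<A> :: "('g set \<times> ('g \<Rightarrow> 'e)) set" and \<Phi>
        assume comp: "compact (UNIV :: 'g set)" and G: "lie_group \<A>"
          and iso: "lie_group.lie_algebra_iso \<A> brR \<Phi>"
        show ?thesis by (rule lie_group.compact_ad_square_zero[OF G comp iso zero])
      qed blast
    qed
  next
    assume "compactly_embedded brR hR"
    then obtain B where B: "inner_product B" "ad_skew_on brR hR B" by (auto simp: compactly_embedded_def)
    show ?thesis
      by (rule self_normalizing_invariant_bilinear_form[OF R h _ inner_product_nondegenerate[OF B(1)] _ B(2)])
        (use B(1) in \<open>auto simp: inner_product_def positive_definite_on_def\<close>)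
  next
    assume "semisimple \<and>
        (\<exists>\<theta>. cartan_involution brR \<theta> \<and> ({x. \<theta> x = x} \<subseteq> hR \<or> {x. \<theta> x = - x} \<subseteq> hR))"
    then obtain \<theta> where \<theta>: "cartan_involution brR \<theta>"
      and sub: "{x. \<theta> x = x} \<subseteq> hR \<or> {x. \<theta> x = - x} \<subseteq> hR" by blast
    have "\<theta> (\<theta> x) = x" for x using \<theta> by (auto simp: cartan_involution_def fun_eq_iff)
    then show ?thesis
      using \<theta> by (intro self_normalizing_cartan_involution[OF h _ _ _ sub])
        (auto simp: cartan_involution_def positive_definite_on_def)
  qed
qed

end
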